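(* Let $R$ be a finite commutative local principal ideal ring with maximal ideal $\mathfrak m=(p)$, $p\neq 0$, and let $n\ge 2$ be minimal with $\mathfrak m^n=0$. Then the arrows of the Gabriel quiver $Q(\mathbb C\mathrm{Aff}(R))$ are precisely the following: (1) there is one arrow from the trivial module $\mathbb C$ to $W_{(\mathcal O,1)}$, where $\mathcal O$ is the orbit of a character $\chi\colon R\to\mathbb C^\times$ with $(p)\subseteq\ker\chi\subsetneq R$ and $1$ is the trivial character of $\mathrm{St}_{U(R)}(\chi)$; (2) if $\mathcal O$ is the orbit of a character $\chi\in\widehat R$ with $(p^{n-1})\subseteq\ker\chi$ and $\rho$ is a character of $\mathrm{St}_{U(R)}(\chi)$ with $1+(p^{n-1})\subseteq\ker\rho$, then there is one arrow from $W_{(\mathcal O,\rho)}$ to each simple module $W_{(\mathcal O',\rho')}$ such that $\mathcal O'$ is the orbit of a character $\chi'\in\widehat R$ with $\chi'(pa)=\chi(a)$ for all $a\in R$ and $\rho|_{\mathrm{St}_{U(R)}(\chi')}=\rho'$ (where $\mathrm{St}_{U(R)}(\chi')\subseteq\mathrm{St}_{U(R)}(\chi)$). In particular, there are no multiple edges in the quiver: between any ordered pair of vertices there is at most one arrow.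
   Context: All rings are unital. For a finite commutative ring $R$, $\mathrm{Aff}(R)$ is the monoid of all maps $R\to R$, $x\mapsto ax+b$ with $a,b\in R$, under composition: $(ax+b)\circ(cx+d)=acx+ad+b$. $U(R)$ is the group of units of $R$, and $U(\mathrm{Aff}(R))=\{ax+b\mid a\in U(R),b\in R\}\cong R\rtimes U(R)$ is the group of units of $\mathrm{Aff}(R)$. The Gabriel quiver $Q(A)$ of a finite dimensional $\mathbb C$-algebra $A$ has as vertices the isomorphism classes of simple left $A$-modules, and the number of arrows from $[S]$ to $[S']$ is $\dim_{\mathbb C}\mathrm{Ext}^1_A(S,S')$. $\widehat R=\mathrm{Hom}((R,+),\mathbb C^\times)$ is the group of characters of the additive group of $R$; $U(R)$ acts on it by $(u\chi)(a)=\chi(ua)$, "orbit" means $U(R)$-orbit, and $\mathrm{St}_{U(R)}(\chi)$ is the stabilizer of $\chi$ (it depends only on the orbit of $\chi$, since $U(R)$ is abelian). For an orbit $\mathcal O$, $\chi\in\mathcal O$, and a degree one character $\rho\colon\mathrm{St}_{U(R)}(\chi)\to\mathbb C^\times$, put $$W_{(\mathcal O,\rho)}=\mathrm{Ind}^{U(\mathrm{Aff}(R))}_{R\rtimes\mathrm{St}_{U(R)}(\chi)}\chi\otimes\rho,\qquad (\chi\otimes\rho)(ax+b)=\chi(b)\rho(a).$$ Up to isomorphism this does not depend on the choice of $\chi\in\mathcal O$, and these modules form a complete irredundant list of simple $\mathbb CU(\mathrm{Aff}(R))$-modules. For $R$ local with maximal ideal $\mathfrak m$, the simple $\mathbb C\mathrm{Aff}(R)$-modules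 are, up to isomorphism: the trivial module $\mathbb C$, on which every element of $\mathrm{Aff}(R)$ acts as the identity; and the modules $W_{(\mathcal O,\rho)}$, regarded as $\mathbb C\mathrm{Aff}(R)$-modules by letting every element of $\mathrm{Aff}(R)\setminus U(\mathrm{Aff}(R))$ (i.e. every $ax+b$ with $a\in\mathfrak m$) act as $0$. In particular the trivial module $\mathbb C$ is distinct from the trivial $U(\mathrm{Aff}(R))$-module extended by zero. The characters $\chi\in\widehat R$ with $\mathfrak m\subseteq\ker\chi\subsetneq R$ form a single $U(R)$-orbit. In (2), the condition for an arrow from $W_{(\mathcal O,\rho)}$ to $W_{(\mathcal O',\rho')}$ is that some representatives $\chi\in\mathcal O$, $\chi'\in\mathcal O'$ satisfy the listed conditions; different choices of representatives do not give additional arrows. *)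

theory Defs
  imports Complex_Main "HOL-Library.Poly_Mapping"
begin

section \<open>Complex algebras\<close>

class complex_vector = ab_group_add +
  fixes scaleC :: "complex \<Rightarrow> 'a \<Rightarrow> 'a" (infixr \<open>*\<^sub>C\<close> 75)
  assumes scaleC_add_right: "c *\<^sub>C (x + y) = c *\<^sub>C x + c *\<^sub>C y"
    and scaleC_add_left: "(c + d) *\<^sub>C x = c *\<^sub>C x + d *\<^sub>C x"
    and scaleC_scaleC: "c *\<^sub>C d *\<^sub>C x = (c * d) *\<^sub>C x"
    and scaleC_one: "1 *\<^sub>C x = x"

class complex_algebra_1 = complex_vector + ring_1 +
  assumes mult_scaleC_left: "(c *\<^sub>C x) * y = c *\<^sub>C (x * y)"
    and mult_scaleC_right: "x * (c *\<^sub>C y) = c *\<^sub>C (x * y)"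

instantiation complex :: complex_algebra_1
begin

definition scaleC_complex :: "complex \<Rightarrow> complex \<Rightarrow> complex"
  where "scaleC_complex = (*)"

instance
  by standard (simp_all add: scaleC_complex_def algebra_simps)

end

lemma scaleC_zero_right [simp]: "c *\<^sub>C (0 :: 'a::complex_vector) = 0"
  using scaleC_add_right[of c 0 0] by simp

instantiation poly_mapping :: (type, complex_vector) complex_vector
begin

definition scaleC_poly_mapping :: "complex \<Rightarrow> ('a \<Rightarrow>\<^sub>0 'b) \<Rightarrow> ('a \<Rightarrow>\<^sub>0 'b)"
  where "scaleC_poly_mapping c = Poly_Mapping.map (scaleC c)"

lemma lookup_scaleC:
  "Poly_Mapping.lookup (c *\<^sub>C f) k = c *\<^sub>C Poly_Mapping.lookup f k"
  for f :: "'a \<Rightarrow>\<^sub>0 'b"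
  by (simp add: scaleC_poly_mapping_def Poly_Mapping.map.rep_eq when_def)

instance
  by standard (rule poly_mapping_eqI; simp add: lookup_scaleC lookup_add
      scaleC_add_right scaleC_add_left scaleC_scaleC scaleC_one)+

end

text \<open>For a monoid \<open>M\<close> written additively, \<open>M \<Rightarrow>\<^sub>0 \<complex>\<close> with the multiplication of
  \<^theory>\<open>HOL-Library.Poly_Mapping\<close> is the monoid algebra of \<open>M\<close> over the complex numbers;
  \<^class>\<open>monoid_add\<close> does not require commutativity.\<close>

lemma scaleC_single: "c *\<^sub>C Poly_Mapping.single k x = Poly_Mapping.single k (c *\<^sub>C x)"
  for x :: "'b::complex_vector"
  by (rule poly_mapping_eqI) (simp add: lookup_scaleC lookup_single when_def)

lemma poly_mapping_add_single_induct:
  fixes f :: "'a \<Rightarrow>\<^sub>0 'b::monoid_add"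
  assumes zero: "P 0" and step: "\<And>k x g. P g \<Longrightarrow> P (Poly_Mapping.single k x + g)"
  shows "P f"
proof (induction f rule: update_induct)
  case const
  show ?case by (rule zero)
next
  case (update f a b)
  have "Poly_Mapping.update a b f = Poly_Mapping.single a b + f"
    using update(1)
    by (intro poly_mapping_eqI)
      (auto simp: lookup_update lookup_add lookup_single when_def in_keys_iff)
  then show ?case
    using step[OF update(3)] by simp
qed

instance poly_mapping :: (monoid_add, complex_algebra_1) complex_algebra_1
proof
  fix c :: complex and f g :: "'a \<Rightarrow>\<^sub>0 'b"
  have *: "(c *\<^sub>C Poly_Mapping.single k x) * g = c *\<^sub>C (Poly_Mapping.single k x * g)
         \<and> Poly_Mapping.single k x * (c *\<^sub>C g) = c *\<^sub>C (Poly_Mapping.single k x * g)" for k x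
    by (induction g rule: poly_mapping_add_single_induct)
      (simp_all add: distrib_left scaleC_add_right scaleC_single mult_single
        mult_scaleC_left mult_scaleC_right)
  show "(c *\<^sub>C f) * g = c *\<^sub>C (f * g)"
    by (induction f rule: poly_mapping_add_single_induct)
      (simp_all add: distrib_right scaleC_add_right *)
  show "f * (c *\<^sub>C g) = c *\<^sub>C (f * g)"
    by (induction f rule: poly_mapping_add_single_induct)
      (simp_all add: distrib_right scaleC_add_right *)
qed


section \<open>Left modules over a (noncommutative) ring\<close>

record ('a, 'v) left_mod =
  mcarrier :: "'v set"
  act :: "'a \<Rightarrow> 'v \<Rightarrow> 'v"

locale left_module =
  fixes M :: "('a::ring_1, 'v::ab_group_add) left_mod"
  assumes zero_mem: "0 \<in> mcarrier M"
    and add_mem: "\<lbrakk>x \<in> mcarrier M; y \<in> mcarrier M\<rbrakk> \<Longrightarrow> x + y \<in> mcarrier M"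
    and uminus_mem: "x \<in> mcarrier M \<Longrightarrow> - x \<in> mcarrier M"
    and act_mem: "x \<in> mcarrier M \<Longrightarrow> act M a x \<in> mcarrier M"
    and act_add_right:
      "\<lbrakk>x \<in> mcarrier M; y \<in> mcarrier M\<rbrakk> \<Longrightarrow> act M a (x + y) = act M a x + act M a y"
    and act_add_left: "x \<in> mcarrier M \<Longrightarrow> act M (a + b) x = act M a x + act M b x"
    and act_mult: "x \<in> mcarrier M \<Longrightarrow> act M (a * b) x = act M a (act M b x)"
    and act_one: "x \<in> mcarrier M \<Longrightarrow> act M 1 x = x"

definition submodule :: "'v set \<Rightarrow> ('a, 'v::ab_group_add) left_mod \<Rightarrow> bool" where
  "submodule N M \<longleftrightarrow> N \<subseteq> mcarrier M \<and> 0 \<in> N \<and> (\<forall>x\<in>N. \<forall>y\<in>N. x + y \<in> N)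
     \<and> (\<forall>a. \<forall>x\<in>N. act M a x \<in> N)"

definition simple_module :: "('a::ring_1, 'v::ab_group_add) left_mod \<Rightarrow> bool" where
  "simple_module M \<longleftrightarrow> left_module M \<and> mcarrier M \<noteq> {0}
     \<and> (\<forall>N. submodule N M \<longrightarrow> N = {0} \<or> N = mcarrier M)"

text \<open>Homomorphisms are normalised to be zero outside the carrier, so that equality of
  homomorphisms is equality of functions.\<close>

definition module_homs ::
    "('a, 'v::ab_group_add) left_mod \<Rightarrow> ('a, 'w::ab_group_add) left_mod \<Rightarrow> ('v \<Rightarrow> 'w) set" where
  "module_homs M N = {f.
     (\<forall>x\<in>mcarrier M. f x \<in> mcarrier N)
     \<and> (\<forall>x\<in>mcarrier M. \<forall>y\<in>mcarrier M. f (x + y) = f x + f y)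
     \<and> (\<forall>a. \<forall>x\<in>mcarrier M. f (act M a x) = act N a (f x))
     \<and> (\<forall>x. x \<notin> mcarrier M \<longrightarrow> f x = 0)}"

definition isomorphic ::
    "('a, 'v::ab_group_add) left_mod \<Rightarrow> ('a, 'w::ab_group_add) left_mod \<Rightarrow> bool"
    (infix \<open>\<cong>\<^sub>m\<close> 50) where
  "M \<cong>\<^sub>m N \<longleftrightarrow> (\<exists>f\<in>module_homs M N. bij_betw f (mcarrier M) (mcarrier N))"


section \<open>The first Ext space\<close>

text \<open>\<open>Ext\<^sup>1(S, T)\<close> is the first cohomology of \<open>Hom(F\<^sub>\<bullet>, T)\<close> for the canonical free
  resolution \<open>F\<^sub>2 \<rightarrow> F\<^sub>1 \<rightarrow> F\<^sub>0 \<rightarrow> S\<close>. Here \<open>F\<^sub>0\<close> is the free module with basis the underlying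
  set of \<open>S\<close>, \<open>F\<^sub>1\<close> the one with basis the underlying set of the kernel of \<open>F\<^sub>0 \<rightarrow> S\<close>,
  and so on.\<close>

definition free_module :: "'x set \<Rightarrow> ('a::ring_1, 'x \<Rightarrow>\<^sub>0 'a) left_mod" where
  "free_module X = \<lparr>mcarrier = {f. Poly_Mapping.keys f \<subseteq> X},
     act = (\<lambda>a. Poly_Mapping.map ((*) a))\<rparr>"

definition free_cover ::
    "('a::ring_1, 'v::ab_group_add) left_mod \<Rightarrow> ('a, 'v \<Rightarrow>\<^sub>0 'a) left_mod" where
  "free_cover M = free_module (mcarrier M)"

definition cover_map :: "('a::ring_1, 'v::ab_group_add) left_mod \<Rightarrow> ('v \<Rightarrow>\<^sub>0 'a) \<Rightarrow> 'v" where
  "cover_map M f = (\<Sum>x\<in>Poly_Mapping.keys f. act M (Poly_Mapping.lookup f x) x)"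

definition syzygy ::
    "('a::ring_1, 'v::ab_group_add) left_mod \<Rightarrow> ('a, 'v \<Rightarrow>\<^sub>0 'a) left_mod" where
  "syzygy M = \<lparr>mcarrier = {f \<in> mcarrier (free_cover M). cover_map M f = 0},
     act = act (free_cover M)\<rparr>"

definition ext1_cocycles ::
    "('a::ring_1, 'v::ab_group_add) left_mod \<Rightarrow> ('a, 'w::ab_group_add) left_mod
     \<Rightarrow> ((('v \<Rightarrow>\<^sub>0 'a) \<Rightarrow>\<^sub>0 'a) \<Rightarrow> 'w) set" where
  "ext1_cocycles S T = {f \<in> module_homs (free_cover (syzygy S)) T.
     \<forall>z\<in>mcarrier (free_cover (syzygy (syzygy S))). f (cover_map (syzygy (syzygy S)) z) = 0}"

definition ext1_coboundaries ::
    "('a::ring_1, 'v::ab_group_add) left_mod \<Rightarrow> ('a, 'w::ab_group_add) left_mod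
     \<Rightarrow> ((('v \<Rightarrow>\<^sub>0 'a) \<Rightarrow>\<^sub>0 'a) \<Rightarrow> 'w) set" where
  "ext1_coboundaries S T =
     (\<lambda>h z. if z \<in> mcarrier (free_cover (syzygy S)) then h (cover_map (syzygy S) z) else 0)
       ` module_homs (free_cover S) T"

text \<open>\<open>dim Ext\<^sup>1(S, T) = d\<close>: there are \<open>d\<close> cocycles whose classes form a basis of the quotient of
  the cocycles by the coboundaries. The scalar \<open>c\<close> acts on \<open>T\<close> as the algebra element \<open>c \<cdot> 1\<close>.\<close>

definition ext1_has_dim ::
    "('a::complex_algebra_1, 'v::ab_group_add) left_mod \<Rightarrow> ('a, 'w::ab_group_add) left_mod
     \<Rightarrow> nat \<Rightarrow> bool" where
  "ext1_has_dim S T d \<longleftrightarrow> (\<exists>B. B \<subseteq> ext1_cocycles S T \<and> finite B \<and> card B = d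
     \<and> (\<forall>f\<in>ext1_cocycles S T. \<exists>!c. (\<forall>b. b \<notin> B \<longrightarrow> c b = 0)
          \<and> (\<lambda>z. f z - (\<Sum>b\<in>B. act T (c b *\<^sub>C 1) (b z))) \<in> ext1_coboundaries S T))"

text \<open>The Gabriel quiver: its vertices are the simple modules up to isomorphism, and
  \<open>gabriel_arrows S S' d\<close> says that \<open>S\<close> and \<open>S'\<close> represent vertices with exactly \<open>d\<close> arrows
  from the first to the second. The two modules may live on different types.\<close>

definition gabriel_arrows ::
    "('a::complex_algebra_1, 'v::ab_group_add) left_mod \<Rightarrow> ('a, 'w::ab_group_add) left_mod
     \<Rightarrow> nat \<Rightarrow> bool" where
  "gabriel_arrows S S' d \<longleftrightarrow> simple_module S \<and> simple_module S' \<and> ext1_has_dim S S' d"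


section \<open>Ideals\<close>

abbreviation ideal :: "'r::comm_ring_1 set \<Rightarrow> bool" where
  "ideal \<equiv> module.subspace (*)"

abbreviation generated_ideal :: "'r::comm_ring_1 set \<Rightarrow> 'r set" where
  "generated_ideal \<equiv> module.span (*)"

definition maximal_ideal :: "'r::comm_ring_1 set \<Rightarrow> bool" where
  "maximal_ideal I \<longleftrightarrow> ideal I \<and> I \<noteq> UNIV \<and> (\<forall>J. ideal J \<and> I \<subseteq> J \<longrightarrow> J = I \<or> J = UNIV)"

primrec ideal_power :: "'r::comm_ring_1 set \<Rightarrow> nat \<Rightarrow> 'r set" where
  "ideal_power I 0 = UNIV"
| "ideal_power I (Suc k) = generated_ideal {x * y | x y. x \<in> I \<and> y \<in> ideal_power I k}"


section \<open>The affine monoid\<close>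

typedef (overloaded) 'r aff = "{f :: 'r::comm_ring_1 \<Rightarrow> 'r. \<exists>a b. f = (\<lambda>x. a * x + b)}"
  by blast

setup_lifting type_definition_aff

lift_definition aff_map :: "'r::comm_ring_1 \<Rightarrow> 'r \<Rightarrow> 'r aff" is "\<lambda>a b x. a * x + b"
  by blast

text \<open>Composition is written \<open>+\<close> and the identity map \<open>0\<close>, so that \<open>'r aff \<Rightarrow>\<^sub>0 complex\<close> is the
  monoid algebra.\<close>

instantiation aff :: (comm_ring_1) monoid_add
begin

lift_definition zero_aff :: "'a aff" is "\<lambda>x. x"
  by (intro exI[of _ 1] exI[of _ 0]) simp

lift_definition plus_aff :: "'a aff \<Rightarrow> 'a aff \<Rightarrow> 'a aff" is "(\<circ>)"
proof -
  fix f g :: "'a \<Rightarrow> 'a"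
  assume "\<exists>a b. f = (\<lambda>x. a * x + b)" and "\<exists>a b. g = (\<lambda>x. a * x + b)"
  then obtain a b c d where "f = (\<lambda>x. a * x + b)" "g = (\<lambda>x. c * x + d)"
    by blast
  then have "f \<circ> g = (\<lambda>x. (a * c) * x + (a * d + b))"
    by (auto simp: fun_eq_iff algebra_simps)
  then show "\<exists>a b. f \<circ> g = (\<lambda>x. a * x + b)"
    by blast
qed

instance
  by standard (transfer; simp add: fun_eq_iff)+

end

lemma aff_map_plus: "aff_map a b + aff_map c d = aff_map (a * c) (a * d + b)"
  by transfer (simp add: fun_eq_iff algebra_simps)

type_synonym 'r aff_algebra = "'r aff \<Rightarrow>\<^sub>0 complex"

definition aff_units :: "'r::comm_ring_1 aff set" where
  "aff_units = {aff_map a b | a b. a dvd 1}"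


section \<open>Characters\<close>

definition additive_character :: "('r::comm_ring_1 \<Rightarrow> complex) \<Rightarrow> bool" where
  "additive_character \<chi> \<longleftrightarrow> (\<forall>a. \<chi> a \<noteq> 0) \<and> (\<forall>a b. \<chi> (a + b) = \<chi> a * \<chi> b)"

definition stabilizer :: "('r::comm_ring_1 \<Rightarrow> complex) \<Rightarrow> 'r set" where
  "stabilizer \<chi> = {u. u dvd 1 \<and> (\<forall>a. \<chi> (u * a) = \<chi> a)}"

text \<open>Degree one characters of a group \<open>H\<close> of units; only the values on \<open>H\<close> matter.\<close>

definition unit_character :: "'r::comm_ring_1 set \<Rightarrow> ('r \<Rightarrow> complex) \<Rightarrow> bool" where
  "unit_character H \<rho> \<longleftrightarrow> (\<forall>u\<in>H. \<rho> u \<noteq> 0) \<and> (\<forall>u\<in>H. \<forall>v\<in>H. \<rho> (u * v) = \<rho> u * \<rho> v)"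


section \<open>The simple modules of the affine monoid\<close>

definition linear_extension ::
    "'v set \<Rightarrow> ('m \<Rightarrow> 'v \<Rightarrow> 'v) \<Rightarrow> ('m \<Rightarrow>\<^sub>0 complex, 'v::complex_vector) left_mod" where
  "linear_extension V \<alpha> = \<lparr>mcarrier = V,
     act = (\<lambda>a v. \<Sum>g\<in>Poly_Mapping.keys a. Poly_Mapping.lookup a g *\<^sub>C \<alpha> g v)\<rparr>"

definition trivial_module :: "('r::comm_ring_1 aff_algebra, complex) left_mod" where
  "trivial_module = linear_extension UNIV (\<lambda>g z. z)"

text \<open>The module induced from a degree one character \<open>\<lambda>\<close> of a subgroup \<open>H\<close> of a finite group \<open>G\<close>,
  as the space of functions \<open>f : G \<rightarrow> \<complex>\<close> with \<open>f (g h) = \<lambda>(h)\<^sup>-\<^sup>1 f(g)\<close>, on which \<open>g\<close> acts by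
  \<open>(g f)(x) = f (g\<^sup>-\<^sup>1 x)\<close>. (It is isomorphic to \<open>\<complex>G \<otimes>\<^bsub>\<complex>H\<^esub> \<lambda>\<close>, where \<open>f\<close> corresponds to the sum
  over coset representatives \<open>g\<close> of \<open>f(g) g \<otimes> 1\<close>.) Here \<open>G\<close> is the group of units of the affine
  monoid, \<open>H\<close> consists of the maps \<open>a x + b\<close> with \<open>a\<close> in the stabilizer of \<open>\<chi>\<close>, and
  \<open>\<lambda>(a x + b) = \<chi>(b) \<rho>(a)\<close>. Functions on \<open>G\<close> are elements of the group algebra of \<open>G\<close>, inside
  the monoid algebra, and left translation by \<open>g\<close> is left multiplication by \<open>g\<close>.

  For \<open>\<O>\<close> the orbit of \<open>\<chi>\<close>, this is the module \<open>W\<^bsub>(\<O>,\<rho>)\<^esub>\<close>, computed with the representative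
  \<open>\<chi>\<close> of \<open>\<O>\<close> and extended by zero to the singular maps.\<close>

definition induced_space ::
    "('r::comm_ring_1 \<Rightarrow> complex) \<Rightarrow> ('r \<Rightarrow> complex) \<Rightarrow> 'r aff_algebra set" where
  "induced_space \<chi> \<rho> = {f. Poly_Mapping.keys f \<subseteq> aff_units
     \<and> (\<forall>g\<in>aff_units. \<forall>a\<in>stabilizer \<chi>. \<forall>b.
          Poly_Mapping.lookup f (g + aff_map a b)
            = inverse (\<chi> b * \<rho> a) * Poly_Mapping.lookup f g)}"

definition W_module ::
    "('r::comm_ring_1 \<Rightarrow> complex) \<Rightarrow> ('r \<Rightarrow> complex) \<Rightarrow> ('r aff_algebra, 'r aff_algebra) left_mod"
  where
  "W_module \<chi> \<rho> = linear_extension (induced_space \<chi> \<rho>)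
     (\<lambda>g f. if g \<in> aff_units then Poly_Mapping.single g 1 * f else 0)"


section \<open>The two kinds of arrows\<close>

definition first_kind :: "'r::comm_ring_1 \<Rightarrow> ('r \<Rightarrow> complex) \<Rightarrow> bool" where
  "first_kind p \<chi> \<longleftrightarrow> additive_character \<chi>
     \<and> generated_ideal {p} \<subseteq> {a. \<chi> a = 1} \<and> {a. \<chi> a = 1} \<subset> UNIV"

text \<open>Under the condition on \<open>\<chi>\<close>, and if \<open>p\<close> is nilpotent and \<open>n \<ge> 2\<close>, the elements
  \<open>1 + x\<close> with \<open>x \<in> (p\<^sup>n\<^sup>-\<^sup>1)\<close> lie in the stabilizer of \<open>\<chi>\<close>.\<close>

definition second_kind ::
    "'r::comm_ring_1 \<Rightarrow> nat \<Rightarrow> ('r \<Rightarrow> complex) \<Rightarrow> ('r \<Rightarrow> complex)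
     \<Rightarrow> ('r \<Rightarrow> complex) \<Rightarrow> ('r \<Rightarrow> complex) \<Rightarrow> bool" where
  "second_kind p n \<chi> \<rho> \<chi>' \<rho>' \<longleftrightarrow>
     additive_character \<chi> \<and> generated_ideal {p ^ (n - 1)} \<subseteq> {a. \<chi> a = 1}
     \<and> unit_character (stabilizer \<chi>) \<rho>
     \<and> (\<forall>x\<in>generated_ideal {p ^ (n - 1)}. \<rho> (1 + x) = 1)
     \<and> additive_character \<chi>' \<and> (\<forall>a. \<chi>' (p * a) = \<chi> a)
     \<and> unit_character (stabilizer \<chi>') \<rho>' \<and> (\<forall>u\<in>stabilizer \<chi>'. \<rho> u = \<rho>' u)"

end

theory Submission
  imports Defs
begin

text \<open>
  Let \<open>A\<close> be the algebra of the affine monoid. Call a map \<open>a x + b\<close> singular if \<open>a\<close> is not a unit, that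
  is, if \<open>p\<close> divides \<open>a\<close>.

  \<^bold>\<open>Extensions.\<close> Suppose that \<open>S\<close> is generated by a vector \<open>v = \<epsilon> v\<close> for an idempotent \<open>\<epsilon>\<close>. Then \<open>A \<epsilon>\<close> is a
  projective module that maps onto \<open>S\<close>, and \<open>Ext\<^sup>1(S, T)\<close> consists of the homomorphisms from the kernel
  \<open>K = {x \<in> A \<epsilon>. x v = 0}\<close> to \<open>T\<close> modulo those of the form \<open>x \<mapsto> x t\<close>. Explicit comparison maps between
  \<open>A \<epsilon>\<close> and the free cover of \<open>S\<close> transport this to the canonical resolution
  (\<open>syzygy_cochain_trivial_iff\<close>).

  \<^bold>\<open>Simple modules.\<close> If the constant map \<open>0\<close> does not annihilate a simple module, every map acts on it as
  the identity. Otherwise all singular maps annihilate it, since \<open>p\<close> is nilpotent. Commuting elements of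
  finite order have common eigenvectors, so there are a character \<open>\<chi>\<close> of \<open>R\<close>, a character \<open>\<rho>\<close> of its
  stabilizer and a nonzero vector \<open>v\<close> on which \<open>a x + b\<close> acts as \<open>\<chi>(b) \<rho>(a)\<close> whenever \<open>a\<close> stabilizes
  \<open>\<chi>\<close>; and this identifies the module with the induced one (\<open>simple_module_classification\<close>).

  \<^bold>\<open>Arrows between induced modules.\<close> For \<open>S\<close> induced from \<open>\<chi>\<close> and \<open>\<rho>\<close>, let \<open>\<epsilon>\<close> be the idempotent of the
  inducing character. Then \<open>K\<close> is generated by \<open>\<pi> \<epsilon>\<close> for \<open>\<pi> = p x\<close>, because every singular map is \<open>g \<pi>\<close>
  for some \<open>g\<close>. If the singular maps annihilate \<open>T\<close>, then maps of the form \<open>x \<mapsto> x t\<close> vanish on \<open>K\<close>, and a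
  homomorphism is determined by the image \<open>t\<close> of \<open>\<pi> \<epsilon>\<close>. The possible \<open>t\<close> are the vectors with
  \<open>(x + p d) t = \<chi>(d) t\<close>, with \<open>(u x) t = \<rho>(u) t\<close> for \<open>u\<close> in the stabilizer of \<open>\<chi>\<close>, and fixed by the
  dilations by \<open>1 + p\<^sup>n\<^sup>-\<^sup>1 c\<close>, since \<open>(p\<^sup>n\<^sup>-\<^sup>1)\<close> is the annihilator of \<open>p\<close>. A nonzero component of \<open>t\<close> of
  some weight \<open>\<chi>'\<close> for the translations exhibits \<open>T\<close> as induced from \<open>\<chi>'\<close> and the restriction of \<open>\<rho>\<close>, with
  \<open>\<chi>'(p a) = \<chi>(a)\<close> (\<open>weight_component_generates\<close>). Conversely such a \<open>T\<close> contains such a vector if \<open>\<rho>\<close> is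
  trivial on \<open>1 + (p\<^sup>n\<^sup>-\<^sup>1)\<close>, and only one up to multiples, because the stabilizer of \<open>\<chi>\<close> permutes the weights \<open>\<chi>'\<close> in the orbit with
  \<open>\<chi>'(p a) = \<chi>(a)\<close> transitively (\<open>extension_vector_exists\<close>, \<open>extension_vectors_one_dimensional\<close>).

  \<^bold>\<open>Arrows at the trivial module.\<close> For trivial \<open>S\<close>, the constant map \<open>0\<close> serves as \<open>\<epsilon>\<close>, and \<open>K\<close> is spanned
  by the differences of constant maps. A homomorphism to an induced module is a cocycle of the group
  \<open>R\<close>, so it has the form \<open>b \<mapsto> (x + b) t - t\<close>, where \<open>t\<close> can be taken to satisfy the conditions above for
  \<open>\<chi> = 1\<close> and \<open>\<rho> = 1\<close>. It vanishes if \<open>t\<close> is fixed by all translations; this excludes \<open>\<chi>' = 1\<close> and leaves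
  the nontrivial characters that are trivial on \<open>(p)\<close>. There are no arrows to the trivial module:
  composing with the constant map \<open>0\<close> shows that every homomorphism from \<open>K\<close> has the form \<open>x \<mapsto> x t\<close>.
\<close>

abbreviation lookup where "lookup \<equiv> Poly_Mapping.lookup"
abbreviation keys where "keys \<equiv> Poly_Mapping.keys"
abbreviation single where "single \<equiv> Poly_Mapping.single"


section \<open>Modules and their homomorphisms\<close>

context left_module
begin

lemma act_zero_right [simp]: "act M a 0 = 0"
  using act_add_right[of 0 0 a] zero_mem by simp

lemma act_zero_left: "x \<in> mcarrier M \<Longrightarrow> act M 0 x = 0"
  using act_add_left[of x 0 0] by simp

lemma act_uminus_right: "x \<in> mcarrier M \<Longrightarrow> act M a (- x) = - act M a x"
  using act_add_right[of x "- x" a] uminus_mem by (simp add: eq_neg_iff_add_eq_0 add.commute)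

lemma act_uminus_left: "x \<in> mcarrier M \<Longrightarrow> act M (- a) x = - act M a x"
  using act_add_left[of x a "- a"] act_zero_left by (simp add: eq_neg_iff_add_eq_0 add.commute)

lemma diff_mem: "x \<in> mcarrier M \<Longrightarrow> y \<in> mcarrier M \<Longrightarrow> x - y \<in> mcarrier M"
  using add_mem[of x "- y"] uminus_mem[of y] by simp

lemma act_diff_right:
  "x \<in> mcarrier M \<Longrightarrow> y \<in> mcarrier M \<Longrightarrow> act M a (x - y) = act M a x - act M a y"
  using act_add_right[of x "- y"] uminus_mem[of y] act_uminus_right[of y] by simp

lemma act_diff_left: "x \<in> mcarrier M \<Longrightarrow> act M (a - b) x = act M a x - act M b x"
  using act_add_left[of x a "- b"] act_uminus_left[of x b] by simp

lemma sum_mem: "(\<And>i. i \<in> I \<Longrightarrow> f i \<in> mcarrier M) \<Longrightarrow> (\<Sum>i\<in>I. f i) \<in> mcarrier M"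
  by (induction I rule: infinite_finite_induct) (auto intro: zero_mem add_mem)

lemma act_sum_right:
  "(\<And>i. i \<in> I \<Longrightarrow> f i \<in> mcarrier M) \<Longrightarrow> act M a (\<Sum>i\<in>I. f i) = (\<Sum>i\<in>I. act M a (f i))"
  by (induction I rule: infinite_finite_induct) (auto simp: act_add_right sum_mem)

lemma act_sum_left:
  "x \<in> mcarrier M \<Longrightarrow> act M (\<Sum>i\<in>I. f i) x = (\<Sum>i\<in>I. act M (f i) x)"
  by (induction I rule: infinite_finite_induct) (auto simp: act_add_left act_zero_left)

lemmas mem_intros = zero_mem add_mem uminus_mem diff_mem act_mem sum_mem

end

definition module_hom ::
    "('a, 'v::ab_group_add) left_mod \<Rightarrow> ('a, 'w::ab_group_add) left_mod \<Rightarrow> ('v \<Rightarrow> 'w) \<Rightarrow> bool" where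
  "module_hom M N f \<longleftrightarrow> (\<forall>x\<in>mcarrier M. f x \<in> mcarrier N)
     \<and> (\<forall>x\<in>mcarrier M. \<forall>y\<in>mcarrier M. f (x + y) = f x + f y)
     \<and> (\<forall>a. \<forall>x\<in>mcarrier M. f (act M a x) = act N a (f x))"

lemma module_homs_iff:
  "f \<in> module_homs M N \<longleftrightarrow> module_hom M N f \<and> (\<forall>x. x \<notin> mcarrier M \<longrightarrow> f x = 0)"
  by (auto simp: module_homs_def module_hom_def)

lemma module_hom_mem: "module_hom M N f \<Longrightarrow> x \<in> mcarrier M \<Longrightarrow> f x \<in> mcarrier N"
  and module_hom_add: "module_hom M N f \<Longrightarrow> x \<in> mcarrier M \<Longrightarrow> y \<in> mcarrier M \<Longrightarrow> f (x + y) = f x + f y"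
  and module_hom_act: "module_hom M N f \<Longrightarrow> x \<in> mcarrier M \<Longrightarrow> f (act M a x) = act N a (f x)"
  by (auto simp: module_hom_def)

lemma module_hom_zero: "module_hom M N f \<Longrightarrow> left_module M \<Longrightarrow> f 0 = 0"
  using module_hom_add[of M N f 0 0] left_module.zero_mem[of M] by simp

lemma module_hom_uminus: "module_hom M N f \<Longrightarrow> left_module M \<Longrightarrow> x \<in> mcarrier M \<Longrightarrow> f (- x) = - f x"
  using module_hom_add[of M N f x "- x"] module_hom_zero[of M N f] left_module.uminus_mem[of M]
  by (simp add: eq_neg_iff_add_eq_0 add.commute)

lemma module_hom_diff:
  assumes "module_hom M N f" "left_module M" "x \<in> mcarrier M" "y \<in> mcarrier M"
  shows "f (x - y) = f x - f y"
  using module_hom_add[of M N f x "- y"] module_hom_uminus[of M N f y] assms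
    left_module.uminus_mem[of M] by simp

lemma module_hom_sum:
  assumes "module_hom M N f" "left_module M" "\<And>i. i \<in> I \<Longrightarrow> g i \<in> mcarrier M"
  shows "f (\<Sum>i\<in>I. g i) = (\<Sum>i\<in>I. f (g i))"
  using assms(3)
proof (induction I rule: infinite_finite_induct)
  case (insert i I)
  have "(\<Sum>i\<in>I. g i) \<in> mcarrier M"
    using insert.prems by (intro left_module.sum_mem[OF assms(2)]) auto
  then show ?case
    using insert module_hom_add[OF assms(1)] by simp
qed (simp_all add: module_hom_zero[OF assms(1,2)])

lemma module_hom_compose:
  "module_hom L M f \<Longrightarrow> module_hom M N g \<Longrightarrow> module_hom L N (\<lambda>x. g (f x))"
  by (simp add: module_hom_def)

lemma isomorphic_iff: "M \<cong>\<^sub>m N \<longleftrightarrow> (\<exists>f. module_hom M N f \<and> bij_betw f (mcarrier M) (mcarrier N))"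
  if "left_module M"
proof
  assume "\<exists>f. module_hom M N f \<and> bij_betw f (mcarrier M) (mcarrier N)"
  then obtain f where f: "module_hom M N f" "bij_betw f (mcarrier M) (mcarrier N)" by blast
  define f' where "f' = (\<lambda>x. if x \<in> mcarrier M then f x else 0)"
  have "f' \<in> module_homs M N"
    using f(1) left_module.add_mem[OF that] left_module.act_mem[OF that]
    by (auto simp: module_homs_iff module_hom_def f'_def)
  moreover have "bij_betw f' (mcarrier M) (mcarrier N)"
    using f(2) by (subst bij_betw_cong[of _ _ f]) (auto simp: f'_def)
  ultimately show "M \<cong>\<^sub>m N" by (auto simp: isomorphic_def)
qed (auto simp: isomorphic_def module_homs_iff)

lemma isomorphic_sym:
  assumes M: "left_module M" and N: "left_module N" and iso: "M \<cong>\<^sub>m N"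
  shows "N \<cong>\<^sub>m M"
proof -
  obtain f where f: "module_hom M N f" "bij_betw f (mcarrier M) (mcarrier N)"
    using iso by (auto simp: isomorphic_iff[OF M])
  define g where "g = the_inv_into (mcarrier M) f"
  have inj: "inj_on f (mcarrier M)" and im: "f ` mcarrier M = mcarrier N"
    using f(2) by (auto simp: bij_betw_def)
  have g_mem: "g y \<in> mcarrier M" and fg: "f (g y) = y" if "y \<in> mcarrier N" for y
    using that the_inv_into_into[OF inj, of y "mcarrier M"] f_the_inv_into_f[OF inj, of y] im
    by (auto simp: g_def)
  have eqI: "x = x'" if "f x = f x'" "x \<in> mcarrier M" "x' \<in> mcarrier M" for x x'
    using that inj by (auto dest: inj_onD)
  have "module_hom N M g"
    unfolding module_hom_def
  proof (intro conjI ballI allI)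
    fix y y' assume y: "y \<in> mcarrier N" "y' \<in> mcarrier N"
    show "g (y + y') = g y + g y'"
      by (rule eqI) (use y in \<open>simp_all add: fg g_mem module_hom_add[OF f(1)]
          left_module.add_mem[OF N] left_module.add_mem[OF M]\<close>)
  next
    fix a y assume y: "y \<in> mcarrier N"
    show "g (act N a y) = act M a (g y)"
      by (rule eqI) (use y in \<open>simp_all add: fg g_mem module_hom_act[OF f(1)]
          left_module.act_mem[OF N] left_module.act_mem[OF M]\<close>)
  qed (rule g_mem)
  moreover have "bij_betw g (mcarrier N) (mcarrier M)"
    unfolding g_def by (rule bij_betw_the_inv_into[OF f(2)])
  ultimately show ?thesis by (auto simp: isomorphic_iff[OF N])
qed

lemma simple_module_left_module: "simple_module S \<Longrightarrow> left_module S"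
  by (simp add: simple_module_def)

lemma simple_module_submodule: "simple_module S \<Longrightarrow> submodule N S \<Longrightarrow> N \<noteq> {0} \<Longrightarrow> N = mcarrier S"
  by (auto simp: simple_module_def)

lemma simple_module_obtain:
  assumes "simple_module S"
  obtains v where "v \<in> mcarrier S" "v \<noteq> 0"
  using assms left_module.zero_mem[of S] by (auto simp: simple_module_def)

lemma simple_module_cyclic:
  assumes S: "simple_module S" and v: "v \<in> mcarrier S" "v \<noteq> 0" and s: "s \<in> mcarrier S"
  obtains a where "act S a v = s"
proof -
  interpret left_module S by (rule simple_module_left_module[OF S])
  have "submodule (range (\<lambda>a. act S a v)) S"
    unfolding submodule_def
  proof (intro conjI ballI allI)
    show "0 \<in> range (\<lambda>a. act S a v)"
      using act_zero_left[OF v(1)] by (metis rangeI)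
  qed (use v in \<open>auto simp: act_mem simp flip: act_add_left act_mult\<close>)
  moreover have "v \<in> range (\<lambda>a. act S a v)"
    using act_one[OF v(1)] by (metis rangeI)
  ultimately have "range (\<lambda>a. act S a v) = mcarrier S"
    using simple_module_submodule[OF S] v by blast
  then obtain a where "act S a v = s"
    using s by (metis rangeE)
  then show thesis by (rule that)
qed

lemma simple_module_kernel:
  assumes S: "simple_module S" and T: "left_module T" and f: "module_hom S T f"
    and s: "s \<in> mcarrier S" "f s \<noteq> 0" and x: "x \<in> mcarrier S" "f x = 0"
  shows "x = 0"
proof -
  interpret S: left_module S by (rule simple_module_left_module[OF S])
  interpret T: left_module T by (rule T)
  have "submodule {x \<in> mcarrier S. f x = 0} S"
    by (auto simp: submodule_def module_hom_add[OF f] module_hom_act[OF f]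
        module_hom_zero[OF f S.left_module_axioms] S.mem_intros)
  then have "{x \<in> mcarrier S. f x = 0} = {0}"
    using simple_module_submodule[OF S] s by blast
  then show ?thesis using x by blast
qed

text \<open>Schur's lemma: the kernel and the image are submodules.\<close>

lemma simple_module_isoI:
  assumes S: "simple_module S" and T: "simple_module T" and f: "module_hom S T f"
    and s: "s \<in> mcarrier S" "f s \<noteq> 0"
  shows "S \<cong>\<^sub>m T"
proof -
  interpret S: left_module S by (rule simple_module_left_module[OF S])
  interpret T: left_module T by (rule simple_module_left_module[OF T])
  have "inj_on f (mcarrier S)"
  proof (rule inj_onI)
    fix x y assume xy: "x \<in> mcarrier S" "y \<in> mcarrier S" "f x = f y"
    then have "x - y = 0"
      by (intro simple_module_kernel[OF S T.left_module_axioms f s])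
        (simp_all add: S.diff_mem module_hom_diff[OF f S.left_module_axioms])
    then show "x = y" by simp
  qed
  moreover have "submodule (f ` mcarrier S) T"
    unfolding submodule_def
  proof (intro conjI ballI allI)
    show "f ` mcarrier S \<subseteq> mcarrier T"
      using module_hom_mem[OF f] by blast
    show "0 \<in> f ` mcarrier S"
      using module_hom_zero[OF f S.left_module_axioms] S.zero_mem by force
  next
    fix x y assume "x \<in> f ` mcarrier S" "y \<in> f ` mcarrier S"
    then show "x + y \<in> f ` mcarrier S"
      by (auto simp: S.add_mem simp flip: module_hom_add[OF f])
  next
    fix a x assume "x \<in> f ` mcarrier S"
    then show "act T a x \<in> f ` mcarrier S"
      by (auto simp: S.act_mem simp flip: module_hom_act[OF f])
  qed
  then have "f ` mcarrier S = mcarrier T"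
    using simple_module_submodule[OF T] s by blast
  ultimately show ?thesis
    using f by (auto simp: isomorphic_iff[OF S.left_module_axioms] bij_betw_def)
qed


section \<open>Free modules and first syzygies\<close>

lemma lookup_map_mult:
  "lookup (Poly_Mapping.map ((*) (a::'a::ring_1)) z) x = a * lookup z x"
  by (simp add: Poly_Mapping.map.rep_eq when_def)

lemma keys_map_mult: "keys (Poly_Mapping.map ((*) (a::'a::ring_1)) z) \<subseteq> keys z"
  by (auto simp: in_keys_iff lookup_map_mult)

lemma free_cover_simps [simp]:
  "mcarrier (free_cover M) = {f. keys f \<subseteq> mcarrier M}"
  "act (free_cover M) a = Poly_Mapping.map ((*) a)"
  by (simp_all add: free_cover_def free_module_def)

lemma left_module_free_cover: "left_module (free_cover M)"
proof
  fix x y assume "x \<in> mcarrier (free_cover M)" "y \<in> mcarrier (free_cover M)"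
  then show "x + y \<in> mcarrier (free_cover M)"
    using Poly_Mapping.keys_add[of x y] by auto
next
  fix a x assume "x \<in> mcarrier (free_cover M)"
  then show "act (free_cover M) a x \<in> mcarrier (free_cover M)"
    using keys_map_mult[of a x] by auto
qed (auto intro!: poly_mapping_eqI simp: lookup_map_mult lookup_add algebra_simps)

definition free_lift :: "('a::ring_1, 'w::ab_group_add) left_mod \<Rightarrow> ('v \<Rightarrow> 'w) \<Rightarrow> ('v \<Rightarrow>\<^sub>0 'a) \<Rightarrow> 'w" where
  "free_lift T h z = (\<Sum>x\<in>keys z. act T (lookup z x) (h x))"

lemma cover_map_eq_free_lift: "cover_map M = free_lift M (\<lambda>x. x)"
  by (simp add: fun_eq_iff cover_map_def free_lift_def)

context left_module
begin

lemma free_lift_superset: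
  assumes "finite F" "keys z \<subseteq> F" "\<And>x. x \<in> F \<Longrightarrow> h x \<in> mcarrier M"
  shows "free_lift M h z = (\<Sum>x\<in>F. act M (lookup z x) (h x))"
  unfolding free_lift_def using assms
  by (intro sum.mono_neutral_left) (auto simp: in_keys_iff act_zero_left)

lemma module_hom_free_lift:
  assumes h: "\<And>x. x \<in> mcarrier N \<Longrightarrow> h x \<in> mcarrier M"
  shows "module_hom (free_cover N) M (free_lift M h)"
  unfolding module_hom_def
proof (intro conjI ballI allI)
  fix z w assume "z \<in> mcarrier (free_cover N)" "w \<in> mcarrier (free_cover N)"
  then have zw: "keys z \<subseteq> mcarrier N" "keys w \<subseteq> mcarrier N" by auto
  let ?F = "keys z \<union> keys w"
  have hF: "h x \<in> mcarrier M" if "x \<in> ?F" for x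
    using that zw h by blast
  have "free_lift M h (z + w) = (\<Sum>x\<in>?F. act M (lookup (z + w) x) (h x))"
    using Poly_Mapping.keys_add[of z w] hF by (intro free_lift_superset) auto
  also have "\<dots> = (\<Sum>x\<in>?F. act M (lookup z x) (h x))
                 + (\<Sum>x\<in>?F. act M (lookup w x) (h x))"
    unfolding sum.distrib[symmetric]
    by (rule sum.cong) (auto simp: lookup_add act_add_left hF)
  also have "\<dots> = free_lift M h z + free_lift M h w"
    using hF by (intro arg_cong2[where f = "(+)"] free_lift_superset[symmetric]) auto
  finally show "free_lift M h (z + w) = free_lift M h z + free_lift M h w" .
next
  fix a z assume "z \<in> mcarrier (free_cover N)"
  then have hF: "h x \<in> mcarrier M" if "x \<in> keys z" for x
    using that h by auto
  have "free_lift M h (act (free_cover N) a z)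
      = (\<Sum>x\<in>keys z. act M (lookup (Poly_Mapping.map ((*) a) z) x) (h x))"
    unfolding free_cover_simps
    by (rule free_lift_superset) (use keys_map_mult[of a z] hF in auto)
  also have "\<dots> = act M a (free_lift M h z)"
    unfolding free_lift_def
    by (subst act_sum_right) (auto simp: lookup_map_mult act_mult hF intro!: act_mem sum.cong)
  finally show "free_lift M h (act (free_cover N) a z) = act M a (free_lift M h z)" .
qed (auto simp: free_lift_def intro!: mem_intros h)

lemma free_lift_single:
  assumes "h x \<in> mcarrier M"
  shows "free_lift M h (single x a) = act M a (h x)"
  by (subst free_lift_superset[where F = "{x}"]) (use assms in auto)

lemma module_hom_cover_map: "module_hom (free_cover M) M (cover_map M)"
  unfolding cover_map_eq_free_lift by (rule module_hom_free_lift)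

lemma cover_map_single: "x \<in> mcarrier M \<Longrightarrow> cover_map M (single x a) = act M a x"
  unfolding cover_map_eq_free_lift by (rule free_lift_single)

lemma left_module_syzygy: "left_module (syzygy M)"
proof -
  interpret F: left_module "free_cover M" by (rule left_module_free_cover)
  note c = module_hom_cover_map
  have iff: "x \<in> mcarrier (syzygy M) \<longleftrightarrow> x \<in> mcarrier (free_cover M) \<and> cover_map M x = 0" for x
    by (simp add: syzygy_def)
  have "act (syzygy M) = act (free_cover M)"
    by (simp add: syzygy_def)
  then show ?thesis
    by unfold_locales
      (auto simp: iff F.mem_intros F.act_add_right F.act_add_left F.act_mult F.act_one
        module_hom_add[OF c] module_hom_act[OF c]
        module_hom_zero[OF c left_module_free_cover] module_hom_uminus[OF c left_module_free_cover]
        simp del: free_cover_simps)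
qed

end


section \<open>Classes of extensions as homomorphisms from the first syzygy\<close>

text \<open>Cochains vanish outside the carrier, like all normalised homomorphisms, so that two of them are
  equal as soon as they come from maps that agree on the syzygy.\<close>

definition syzygy_cochain ::
    "('a::ring_1, 'v::ab_group_add) left_mod \<Rightarrow> (('v \<Rightarrow>\<^sub>0 'a) \<Rightarrow> 'w::ab_group_add)
     \<Rightarrow> (('v \<Rightarrow>\<^sub>0 'a) \<Rightarrow>\<^sub>0 'a) \<Rightarrow> 'w" where
  "syzygy_cochain S \<phi> z =
     (if z \<in> mcarrier (free_cover (syzygy S)) then \<phi> (cover_map (syzygy S) z) else 0)"

lemma syzygy_mem: "z \<in> mcarrier (syzygy S) \<longleftrightarrow> keys z \<subseteq> mcarrier S \<and> cover_map S z = 0"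
  by (simp add: syzygy_def)

lemma act_syzygy [simp]: "act (syzygy S) a = Poly_Mapping.map ((*) a)"
  by (simp add: syzygy_def)

text \<open>The second free module modulo the image of the third is the syzygy, so a cocycle is the same as
  a homomorphism on the syzygy.\<close>

lemma ext1_cocycles_iff:
  assumes S: "left_module S" and T: "left_module T"
  shows "f \<in> ext1_cocycles S T \<longleftrightarrow> (\<exists>\<phi>. module_hom (syzygy S) T \<phi> \<and> f = syzygy_cochain S \<phi>)"
proof
  let ?M = "syzygy S"
  interpret M: left_module ?M by (rule left_module.left_module_syzygy[OF S])
  interpret N: left_module "syzygy ?M" by (rule M.left_module_syzygy)
  note c = M.module_hom_cover_map
  {
    assume "f \<in> ext1_cocycles S T"
    then have f: "module_hom (free_cover ?M) T f" "\<And>z. z \<notin> mcarrier (free_cover ?M) \<Longrightarrow> f z = 0"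
      and van: "\<And>z. z \<in> mcarrier (free_cover (syzygy ?M)) \<Longrightarrow> f (cover_map (syzygy ?M) z) = 0"
      by (auto simp: ext1_cocycles_def module_homs_iff)
    have f0: "f z = 0" if "z \<in> mcarrier (syzygy ?M)" for z
      using van[of "single z 1"] that N.cover_map_single[OF that, of 1] N.act_one[OF that]
      by simp
    define \<phi> where "\<phi> w = f (single w 1)" for w
    have single: "single w a \<in> mcarrier (free_cover ?M)" if "w \<in> mcarrier ?M" for w a
      using that by simp
    have eq: "f z = \<phi> (cover_map ?M z)" if z: "z \<in> mcarrier (free_cover ?M)" for z
    proof -
      let ?s = "single (cover_map ?M z) 1"
      have cz: "cover_map ?M z \<in> mcarrier ?M"
        by (rule module_hom_mem[OF c z])
      have "z - ?s \<in> mcarrier (free_cover ?M)"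
        by (rule left_module.diff_mem[OF left_module_free_cover z single[OF cz]])
      moreover have "cover_map ?M (z - ?s) = 0"
        using M.cover_map_single[OF cz, of 1] M.act_one[OF cz]
        by (simp add: module_hom_diff[OF c left_module_free_cover z single[OF cz]])
      ultimately have "f (z - ?s) = 0"
        by (intro f0) (simp add: syzygy_mem)
      then show ?thesis
        by (simp add: module_hom_diff[OF f(1) left_module_free_cover z single[OF cz]] \<phi>_def)
    qed
    have "module_hom ?M T \<phi>"
      unfolding module_hom_def
    proof (intro conjI ballI allI)
      fix w w' assume w: "w \<in> mcarrier ?M" "w' \<in> mcarrier ?M"
      have "f (single w 1 + single w' 1) = \<phi> (w + w')"
        using w M.cover_map_single[OF w(1), of 1] M.cover_map_single[OF w(2), of 1]
          M.act_one[OF w(1)] M.act_one[OF w(2)]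
        by (subst eq) (auto intro!: left_module.add_mem[OF left_module_free_cover] single
            simp: module_hom_add[OF c single single] simp del: free_cover_simps)
      then show "\<phi> (w + w') = \<phi> w + \<phi> w'"
        using w by (simp add: \<phi>_def module_hom_add[OF f(1) single single])
    next
      fix a w assume w: "w \<in> mcarrier ?M"
      have "f (act (free_cover ?M) a (single w 1)) = \<phi> (act ?M a w)"
        using M.cover_map_single[OF w, of 1] M.act_one[OF w]
        by (subst eq) (auto intro!: left_module.act_mem[OF left_module_free_cover] single w
            simp: module_hom_act[OF c single[OF w]] simp del: free_cover_simps)
      then show "\<phi> (act ?M a w) = act T a (\<phi> w)"
        by (simp only: module_hom_act[OF f(1) single[OF w]] \<phi>_def)
    qed (simp add: \<phi>_def module_hom_mem[OF f(1) single])
    moreover have "f = syzygy_cochain S \<phi>"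
      using eq f(2) by (auto simp: fun_eq_iff syzygy_cochain_def)
    ultimately show "\<exists>\<phi>. module_hom ?M T \<phi> \<and> f = syzygy_cochain S \<phi>" by blast
  next
    assume "\<exists>\<phi>. module_hom ?M T \<phi> \<and> f = syzygy_cochain S \<phi>"
    then obtain \<phi> where \<phi>: "module_hom ?M T \<phi>" and f: "f = syzygy_cochain S \<phi>" by blast
    interpret F: left_module "free_cover ?M" by (rule left_module_free_cover)
    have "module_hom (free_cover ?M) T f"
      using module_hom_compose[OF c \<phi>] unfolding module_hom_def f syzygy_cochain_def
      by (simp add: F.add_mem F.act_mem del: free_cover_simps)
    moreover have "f (cover_map (syzygy ?M) z) = 0" if "z \<in> mcarrier (free_cover (syzygy ?M))" for z
      using module_hom_mem[OF N.module_hom_cover_map that] module_hom_zero[OF \<phi> M.left_module_axioms]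
      by (simp add: f syzygy_cochain_def syzygy_mem)
    ultimately show "f \<in> ext1_cocycles S T"
      by (auto simp: ext1_cocycles_def module_homs_iff f syzygy_cochain_def simp del: free_cover_simps)
  }
qed

lemma syzygy_cochain_coboundary_iff:
  assumes S: "left_module S" and T: "left_module T"
  shows "syzygy_cochain S \<phi> \<in> ext1_coboundaries S T
    \<longleftrightarrow> (\<exists>h. module_hom (free_cover S) T h \<and> (\<forall>w\<in>mcarrier (syzygy S). \<phi> w = h w))"
proof
  let ?M = "syzygy S"
  interpret M: left_module ?M by (rule left_module.left_module_syzygy[OF S])
  {
    assume "syzygy_cochain S \<phi> \<in> ext1_coboundaries S T"
    then obtain h where h: "module_hom (free_cover S) T h" "syzygy_cochain S \<phi> = syzygy_cochain S h"
      by (auto simp: ext1_coboundaries_def module_homs_iff syzygy_cochain_def fun_eq_iff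
          simp del: free_cover_simps)
    have "\<phi> w = h w" if w: "w \<in> mcarrier ?M" for w
      using fun_cong[OF h(2), of "single w 1"] w M.cover_map_single[OF w, of 1] M.act_one[OF w]
      by (simp add: syzygy_cochain_def)
    then show "\<exists>h. module_hom (free_cover S) T h \<and> (\<forall>w\<in>mcarrier ?M. \<phi> w = h w)"
      using h(1) by blast
  next
    assume "\<exists>h. module_hom (free_cover S) T h \<and> (\<forall>w\<in>mcarrier ?M. \<phi> w = h w)"
    then obtain h where h: "module_hom (free_cover S) T h" "\<And>w. w \<in> mcarrier ?M \<Longrightarrow> \<phi> w = h w"
      by blast
    interpret F: left_module "free_cover S" by (rule left_module_free_cover)
    define h' where "h' = (\<lambda>x. if x \<in> mcarrier (free_cover S) then h x else 0)"
    have "h' \<in> module_homs (free_cover S) T"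
      using h(1) by (simp add: module_homs_iff module_hom_def h'_def F.add_mem F.act_mem
          del: free_cover_simps)
    moreover have "syzygy_cochain S \<phi> = (\<lambda>z. if z \<in> mcarrier (free_cover ?M) then h' (cover_map ?M z) else 0)"
      using module_hom_mem[OF M.module_hom_cover_map] h(2)
      by (auto simp: fun_eq_iff syzygy_cochain_def h'_def syzygy_mem)
    ultimately show "syzygy_cochain S \<phi> \<in> ext1_coboundaries S T"
      unfolding ext1_coboundaries_def by blast
  }
qed


section \<open>Dimension counts\<close>

abbreviation scal :: "('a::complex_algebra_1, 'v) left_mod \<Rightarrow> complex \<Rightarrow> 'v \<Rightarrow> 'v" where
  "scal M c \<equiv> act M (c *\<^sub>C 1)"

lemma scaleC_one_central: "(c *\<^sub>C 1) * a = a * (c *\<^sub>C (1::'a::complex_algebra_1))"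
  by (simp add: mult_scaleC_left mult_scaleC_right)

lemma scaleC_zero_left [simp]: "0 *\<^sub>C (x::'a::complex_vector) = 0"
  using scaleC_add_left[of 0 0 x] by simp

lemma scaleC_minus_left: "(- c) *\<^sub>C (x::'a::complex_vector) = - (c *\<^sub>C x)"
  using scaleC_add_left[of c "- c" x] by (simp add: eq_neg_iff_add_eq_0 add.commute)

locale algebra_module = left_module M
  for M :: "('a::complex_algebra_1, 'v::ab_group_add) left_mod"
begin

lemma scal_act: "x \<in> mcarrier M \<Longrightarrow> act M a (scal M c x) = scal M c (act M a x)"
  by (simp flip: act_mult add: scaleC_one_central)

lemma act_scaleC: "x \<in> mcarrier M \<Longrightarrow> act M (c *\<^sub>C a) x = scal M c (act M a x)"
  by (simp flip: act_mult add: mult_scaleC_left)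

lemma scal_scal: "x \<in> mcarrier M \<Longrightarrow> scal M c (scal M d x) = scal M (c * d) x"
  by (simp flip: act_mult add: mult_scaleC_left scaleC_scaleC)

lemma scal_one: "x \<in> mcarrier M \<Longrightarrow> scal M 1 x = x"
  by (simp add: scaleC_one act_one)

lemma scal_zero: "x \<in> mcarrier M \<Longrightarrow> scal M 0 x = 0"
  by (simp add: act_zero_left)

lemma scal_add_left: "x \<in> mcarrier M \<Longrightarrow> scal M (c + d) x = scal M c x + scal M d x"
  by (simp add: scaleC_add_left act_add_left)

lemma scal_minus_left: "x \<in> mcarrier M \<Longrightarrow> scal M (- c) x = - scal M c x"
  by (simp add: scaleC_minus_left act_uminus_left)

lemma scal_diff_left: "x \<in> mcarrier M \<Longrightarrow> scal M (c - d) x = scal M c x - scal M d x"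
  using scal_add_left[of x c "- d"] by (simp add: scal_minus_left)

lemma scal_eq_0_iff: "x \<in> mcarrier M \<Longrightarrow> scal M c x = 0 \<longleftrightarrow> c = 0 \<or> x = 0"
  using scal_scal[of x "inverse c" c] scal_one[of x] scal_zero[of x]
  by (cases "c = 0") auto

lemma scal_cancel:
  assumes "x \<in> mcarrier M" "x \<noteq> 0" "scal M c x = scal M d x"
  shows "c = d"
  using assms scal_add_left[of x c "- d"] scal_minus_left[of x d] scal_eq_0_iff[of x "c - d"] by simp

end

context
  fixes S :: "('a::complex_algebra_1, 'v::ab_group_add) left_mod"
    and T :: "('a, 'w::ab_group_add) left_mod"
  assumes S: "left_module S" and T: "left_module T"
begin

interpretation T: algebra_module T
  using T by (simp add: algebra_module_def)

lemma coboundary_combine: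
  assumes "f \<in> ext1_coboundaries S T" "g \<in> ext1_coboundaries S T"
  shows "(\<lambda>z. scal T c (f z) + scal T d (g z)) \<in> ext1_coboundaries S T"
proof -
  obtain h where h: "module_hom (free_cover S) T h" "f = syzygy_cochain S h"
    using assms(1) by (auto simp: ext1_coboundaries_def module_homs_iff syzygy_cochain_def fun_eq_iff
          simp del: free_cover_simps)
  obtain h' where h': "module_hom (free_cover S) T h'" "g = syzygy_cochain S h'"
    using assms(2) by (auto simp: ext1_coboundaries_def module_homs_iff syzygy_cochain_def fun_eq_iff
          simp del: free_cover_simps)
  have "module_hom (free_cover S) T (\<lambda>x. scal T c (h x) + scal T d (h' x))"
    using h(1) h'(1) by (simp add: module_hom_def T.mem_intros T.act_add_right T.scal_act
        algebra_simps del: free_cover_simps)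
  moreover have eq: "(\<lambda>z. scal T c (f z) + scal T d (g z)) = syzygy_cochain S (\<lambda>x. scal T c (h x) + scal T d (h' x))"
    by (simp add: fun_eq_iff h(2) h'(2) syzygy_cochain_def)
  ultimately show ?thesis
    unfolding eq syzygy_cochain_coboundary_iff[OF S T] by blast
qed

lemma coboundary_zero: "(\<lambda>z. 0) \<in> ext1_coboundaries S T"
proof -
  have "module_hom (free_cover S) T (\<lambda>z. 0)"
    by (simp add: module_hom_def T.zero_mem)
  then have "syzygy_cochain S (\<lambda>z. 0 :: 'w) \<in> ext1_coboundaries S T"
    unfolding syzygy_cochain_coboundary_iff[OF S T] by blast
  moreover have "syzygy_cochain S (\<lambda>z. 0 :: 'w) = (\<lambda>z. 0)"
    by (simp add: syzygy_cochain_def fun_eq_iff)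
  ultimately show ?thesis by simp
qed

lemma cochain_mem: "f \<in> ext1_cocycles S T \<Longrightarrow> f z \<in> mcarrier T"
  by (cases "z \<in> mcarrier (free_cover (syzygy S))")
    (auto simp: ext1_cocycles_def module_homs_iff module_hom_mem T.zero_mem simp del: free_cover_simps)

lemma ext1_has_dim_0_iff: "ext1_has_dim S T 0 \<longleftrightarrow> ext1_cocycles S T \<subseteq> ext1_coboundaries S T"
proof -
  have empty: "(\<exists>B. B \<subseteq> X \<and> finite B \<and> card B = 0 \<and> P B) \<longleftrightarrow> P {}" for X :: "'x set" and P
    by (metis card.empty card_0_eq empty_subsetI finite.emptyI)
  have "ext1_has_dim S T 0 \<longleftrightarrow> (\<forall>f\<in>ext1_cocycles S T. \<exists>!c.
      (\<forall>b :: (('v \<Rightarrow>\<^sub>0 'a) \<Rightarrow>\<^sub>0 'a) \<Rightarrow> 'w. c b = (0::complex)) \<and> f \<in> ext1_coboundaries S T)"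
    unfolding ext1_has_dim_def empty by simp
  also have "\<dots> \<longleftrightarrow> ext1_cocycles S T \<subseteq> ext1_coboundaries S T"
    by (auto intro!: ex1I[of _ "\<lambda>_. 0"])
  finally show ?thesis .
qed

lemma ext1_has_dim_1I:
  assumes b: "b \<in> ext1_cocycles S T" "b \<notin> ext1_coboundaries S T"
    and span: "\<And>f. f \<in> ext1_cocycles S T \<Longrightarrow> \<exists>c. (\<lambda>z. f z - scal T c (b z)) \<in> ext1_coboundaries S T"
  shows "ext1_has_dim S T 1"
  unfolding ext1_has_dim_def
proof (intro exI[of _ "{b}"] conjI ballI)
  fix f assume f: "f \<in> ext1_cocycles S T"
  then obtain c where c: "(\<lambda>z. f z - scal T c (b z)) \<in> ext1_coboundaries S T"
    using span by blast
  have uniq: "c' = c" if c': "(\<lambda>z. f z - scal T c' (b z)) \<in> ext1_coboundaries S T" for c'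
  proof (rule ccontr)
    assume "c' \<noteq> c"
    \<comment> \<open>The difference of the two coboundaries is the multiple \<open>c' - c\<close> of the cocycle.\<close>
    have eq: "scal T k (f z - scal T c (b z)) + scal T (- k) (f z - scal T c' (b z))
        = scal T (k * (c' - c)) (b z)" for k z
      using cochain_mem[OF b(1)] cochain_mem[OF f]
      by (simp add: T.act_diff_right T.mem_intros T.scal_scal T.scal_minus_left T.scal_diff_left
          right_diff_distrib)
    have "(\<lambda>z. scal T (1 / (c' - c)) (f z - scal T c (b z)) + scal T (- (1 / (c' - c))) (f z - scal T c' (b z)))
        = b" (is "?l = _")
      unfolding eq using \<open>c' \<noteq> c\<close> cochain_mem[OF b(1)] by (simp add: T.scal_one)
    moreover have "?l \<in> ext1_coboundaries S T"
      by (rule coboundary_combine[OF c c'])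
    ultimately show False using b(2) by simp
  qed
  show "\<exists>!c. (\<forall>b'. b' \<notin> {b} \<longrightarrow> c b' = 0)
      \<and> (\<lambda>z. f z - (\<Sum>b\<in>{b}. scal T (c b) (b z))) \<in> ext1_coboundaries S T"
  proof (rule ex1I[of _ "\<lambda>b'. if b' = b then c else 0"])
    fix c' :: "_ \<Rightarrow> complex"
    assume c': "(\<forall>b'. b' \<notin> {b} \<longrightarrow> c' b' = 0)
      \<and> (\<lambda>z. f z - (\<Sum>b\<in>{b}. scal T (c' b) (b z))) \<in> ext1_coboundaries S T"
    then have "c' b = c" by (intro uniq) simp
    then show "c' = (\<lambda>b'. if b' = b then c else 0)"
      using c' by (intro ext) auto
  qed (use c in simp)
qed (use b in auto)

text \<open>Two distinct elements of a basis are independent modulo coboundaries, which is impossible in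
  a quotient spanned by one element.\<close>

lemma ext1_has_dim_le_1:
  assumes m: "ext1_has_dim S T m" "m \<le> 1" and d: "ext1_has_dim S T d"
  shows "d \<le> 1"
proof (rule ccontr)
  assume "\<not> d \<le> 1"
  obtain B where B: "B \<subseteq> ext1_cocycles S T" "finite B" "card B = d"
    and uniq: "\<And>f. f \<in> ext1_cocycles S T \<Longrightarrow> \<exists>!c. (\<forall>b. b \<notin> B \<longrightarrow> c b = 0)
          \<and> (\<lambda>z. f z - (\<Sum>b\<in>B. scal T (c b) (b z))) \<in> ext1_coboundaries S T"
    using d unfolding ext1_has_dim_def
    by (elim exE conjE) (rule that, assumption, assumption, assumption, drule bspec, assumption)
  obtain x y where xy: "x \<in> B" "y \<in> B" "x \<noteq> y"
    using card_le_Suc0_iff_eq[OF B(2)] B(3) \<open>\<not> d \<le> 1\<close> by auto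
  have mem: "x z \<in> mcarrier T" "y z \<in> mcarrier T" for z
    using xy B(1) by (auto intro: cochain_mem)
  obtain g \<gamma> \<delta> where g: "\<And>z. g z \<in> mcarrier T"
      "(\<lambda>z. x z - scal T \<gamma> (g z)) \<in> ext1_coboundaries S T"
      "(\<lambda>z. y z - scal T \<delta> (g z)) \<in> ext1_coboundaries S T"
  proof -
    obtain B' where B': "B' \<subseteq> ext1_cocycles S T" "finite B'" "card B' = m"
      and ex: "\<And>f. f \<in> ext1_cocycles S T \<Longrightarrow>
          \<exists>c. (\<lambda>z. f z - (\<Sum>b\<in>B'. scal T (c b) (b z))) \<in> ext1_coboundaries S T"
      using m(1) unfolding ext1_has_dim_def
      by (elim exE conjE)
        (rule that, assumption, assumption, assumption, drule bspec, assumption, erule ex1E, blast)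
    consider "B' = {}" | g where "B' = {g}"
      using B' m(2) by (metis card_0_eq card_1_singletonE le_less less_one)
    then show thesis
    proof cases
      case 1
      then show thesis
        using ex[of x] ex[of y] xy B(1) that[of "\<lambda>_. 0" 0 0] T.zero_mem by auto
    next
      case 2
      then show thesis
        using ex[of x] ex[of y] xy B' B(1) cochain_mem[of g] by (auto intro: that)
    qed
  qed
  obtain \<alpha> \<beta> where ab: "(\<lambda>z. scal T \<alpha> (x z) + scal T \<beta> (y z)) \<in> ext1_coboundaries S T"
      and nz: "\<alpha> \<noteq> 0 \<or> \<beta> \<noteq> 0"
  proof (cases "\<gamma> = 0")
    case True
    then have "x \<in> ext1_coboundaries S T" using g by (simp add: T.act_zero_left)
    then have "(\<lambda>z. scal T 1 (x z) + scal T 0 (y z)) \<in> ext1_coboundaries S T"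
      by (simp only: mem T.scal_zero T.scal_one add_0_right)
    then show thesis using that[of 1 0] by simp
  next
    case False
    have "(\<lambda>z. scal T \<delta> (x z - scal T \<gamma> (g z)) + scal T (- \<gamma>) (y z - scal T \<delta> (g z)))
        = (\<lambda>z. scal T \<delta> (x z) + scal T (- \<gamma>) (y z))"
      by (simp add: fun_eq_iff T.act_diff_right T.mem_intros mem g(1) T.scal_scal T.scal_minus_left
          mult.commute)
    then show thesis
      using that[of \<delta> "- \<gamma>"] False coboundary_combine[OF g(2,3), of \<delta> "- \<gamma>"] by simp
  qed
  \<comment> \<open>The basis element \<open>x\<close> then has two different coordinate vectors.\<close>
  define c where "c u v = (\<lambda>b. if b = x then u else if b = y then v else (0::complex))" for u v
  have sum: "(\<Sum>b\<in>B. scal T (c u v b) (b z)) = scal T u (x z) + scal T v (y z)" for u v z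
  proof -
    have "(\<Sum>b\<in>B. scal T (c u v b) (b z)) = (\<Sum>b\<in>{x, y}. scal T (c u v b) (b z))"
      using xy B cochain_mem
      by (intro sum.mono_neutral_right) (auto simp: c_def intro!: T.act_zero_left)
    then show ?thesis using xy by (simp add: c_def)
  qed
  have x: "x \<in> ext1_cocycles S T" using xy B by blast
  have "(\<lambda>z. x z - (\<Sum>b\<in>B. scal T (c 1 0 b) (b z))) \<in> ext1_coboundaries S T"
    unfolding sum using coboundary_zero by (simp only: mem T.scal_zero T.scal_one add_0_right diff_self)
  moreover have "(\<lambda>z. x z - (\<Sum>b\<in>B. scal T (c (1 - \<alpha>) (- \<beta>) b) (b z))) \<in> ext1_coboundaries S T"
    unfolding sum using ab
    by (simp only: mem T.scal_minus_left T.scal_add_left T.scal_one diff_conv_add_uminus)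
      (simp add: T.scal_minus_left mem add.commute)
  moreover have "\<forall>b. b \<notin> B \<longrightarrow> c u v b = 0" for u v
    using xy by (auto simp: c_def)
  ultimately have "c 1 0 = c (1 - \<alpha>) (- \<beta>)"
    using uniq[OF x] by blast
  from fun_cong[OF this, of x] fun_cong[OF this, of y] show False
    using nz xy by (simp add: c_def)
qed

end


section \<open>Extensions of a module generated by the image of an idempotent\<close>

text \<open>For an idempotent \<open>\<epsilon>\<close>, the left ideal \<open>A \<epsilon>\<close> is projective. It maps onto a module
  generated by a vector \<open>v = \<epsilon> v\<close>; the kernel of this map takes the role of the syzygy.\<close>

locale idempotent_presentation = algebra_module S
  for S :: "('a::complex_algebra_1, 'v::ab_group_add) left_mod" +
  fixes v :: 'v and \<epsilon> :: 'a
  assumes v_mem: "v \<in> mcarrier S" and idem: "\<epsilon> * \<epsilon> = \<epsilon>" and eps_v: "act S \<epsilon> v = v"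
    and generates: "\<And>s. s \<in> mcarrier S \<Longrightarrow> \<exists>a. act S a v = s"
begin

definition relations :: "('a, 'a) left_mod" where
  "relations = \<lparr>mcarrier = {x. x * \<epsilon> = x \<and> act S x v = 0}, act = (*)\<rparr>"

lemma relations_iff: "x \<in> mcarrier relations \<longleftrightarrow> x * \<epsilon> = x \<and> act S x v = 0"
  and act_relations [simp]: "act relations = (*)"
  by (simp_all add: relations_def)

lemma left_module_relations: "left_module relations"
  by unfold_locales
    (auto simp: relations_iff algebra_simps act_zero_left act_add_left act_uminus_left act_mult v_mem)

lemma single_relation_syzygy:
  "x \<in> mcarrier relations \<Longrightarrow> single v x \<in> mcarrier (syzygy S)"
  by (auto simp: relations_iff syzygy_mem v_mem cover_map_single)

text \<open>An element \<open>x\<^sub>s\<close> of \<open>A \<epsilon>\<close> with \<open>x\<^sub>s v = s\<close>. The choice \<open>x\<^sub>v = \<epsilon>\<close> makes the comparison map below a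
  left inverse of \<open>x \<mapsto> x v\<close> on \<open>A \<epsilon>\<close>.\<close>

definition coeff :: "'v \<Rightarrow> 'a" where
  "coeff s = (if s = v then \<epsilon> else (SOME a. act S a v = s) * \<epsilon>)"

lemma coeff_eps: "coeff s * \<epsilon> = coeff s"
  by (simp add: coeff_def idem mult.assoc)

lemma act_coeff: "s \<in> mcarrier S \<Longrightarrow> act S (coeff s) v = s"
  using someI_ex[OF generates, of s] by (simp add: coeff_def eps_v act_mult v_mem)

text \<open>The lift of the identity of the module to a map from its free cover to \<open>A \<epsilon>\<close>.\<close>

definition comparison :: "('v \<Rightarrow>\<^sub>0 'a) \<Rightarrow> 'a" where
  "comparison = free_lift \<lparr>mcarrier = UNIV, act = (*)\<rparr> coeff"

lemma left_module_regular: "left_module \<lparr>mcarrier = UNIV :: 'a set, act = (*)\<rparr>"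
  by unfold_locales (simp_all add: algebra_simps)

lemma module_hom_comparison: "module_hom (free_cover S) \<lparr>mcarrier = UNIV, act = (*)\<rparr> comparison"
  unfolding comparison_def
  by (rule left_module.module_hom_free_lift[OF left_module_regular]) simp

lemma comparison_single: "comparison (single s a) = a * coeff s"
  unfolding comparison_def
  by (subst left_module.free_lift_single[OF left_module_regular]) auto

lemma comparison_eps: "comparison z * \<epsilon> = comparison z"
  by (simp add: comparison_def free_lift_def sum_distrib_right mult.assoc coeff_eps)

lemma act_comparison:
  assumes "keys z \<subseteq> mcarrier S"
  shows "act S (comparison z) v = cover_map S z"
  using assms unfolding comparison_def free_lift_def cover_map_def
  by (auto simp: act_sum_left v_mem act_mult act_coeff intro!: sum.cong)

lemma module_hom_comparison_syzygy: "module_hom (syzygy S) relations comparison"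
  using module_hom_comparison
  by (auto simp: module_hom_def relations_iff syzygy_mem comparison_eps act_comparison)

context
  fixes T :: "('a, 'w::ab_group_add) left_mod"
  assumes T: "left_module T"
begin

interpretation T: algebra_module T
  using T by (simp add: algebra_module_def)

lemma module_hom_relations_of_syzygy:
  assumes \<phi>: "module_hom (syzygy S) T \<phi>"
  shows "module_hom relations T (\<lambda>x. \<phi> (single v x))"
  unfolding module_hom_def
proof (intro conjI ballI allI)
  fix a x assume x: "x \<in> mcarrier relations"
  show "\<phi> (single v (act relations a x)) = act T a (\<phi> (single v x))"
    using module_hom_act[OF \<phi> single_relation_syzygy[OF x], of a] by (simp add: map_single)
qed (simp_all add: single_add module_hom_mem[OF \<phi>] module_hom_add[OF \<phi>] single_relation_syzygy)

text \<open>A map on the syzygy is compared with one on the relations by restricting it to the multiples of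
  the generator. If the restriction is the action on a vector \<open>t\<close>, then the map extends to the free
  cover: a basis element \<open>s\<close> differs from \<open>x\<^sub>s v\<close> by an element of the syzygy, where the map is known,
  and \<open>x\<^sub>s v\<close> is sent to \<open>x\<^sub>s t\<close>.\<close>

lemma syzygy_cochain_trivial_iff:
  assumes \<phi>: "module_hom (syzygy S) T \<phi>"
  shows "syzygy_cochain S \<phi> \<in> ext1_coboundaries S T
    \<longleftrightarrow> (\<exists>t\<in>mcarrier T. \<forall>x\<in>mcarrier relations. \<phi> (single v x) = act T x t)"
  unfolding syzygy_cochain_coboundary_iff[OF left_module_axioms T]
proof
  assume "\<exists>h. module_hom (free_cover S) T h \<and> (\<forall>w\<in>mcarrier (syzygy S). \<phi> w = h w)"
  then obtain h where h: "module_hom (free_cover S) T h" "\<And>w. w \<in> mcarrier (syzygy S) \<Longrightarrow> \<phi> w = h w"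
    by blast
  have v1: "single v 1 \<in> mcarrier (free_cover S)" by (simp add: v_mem)
  show "\<exists>t\<in>mcarrier T. \<forall>x\<in>mcarrier relations. \<phi> (single v x) = act T x t"
  proof (intro bexI[of _ "h (single v 1)"] ballI)
    fix x assume "x \<in> mcarrier relations"
    then show "\<phi> (single v x) = act T x (h (single v 1))"
      using module_hom_act[OF h(1) v1, of x] by (simp add: h(2) single_relation_syzygy map_single)
  qed (rule module_hom_mem[OF h(1) v1])
next
  assume "\<exists>t\<in>mcarrier T. \<forall>x\<in>mcarrier relations. \<phi> (single v x) = act T x t"
  then obtain t where t: "t \<in> mcarrier T"
    "\<And>x. x \<in> mcarrier relations \<Longrightarrow> \<phi> (single v x) = act T x t" by blast
  interpret O: left_module "syzygy S" by (rule left_module_syzygy)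
  define d where "d s = single s 1 - single v (coeff s)" for s
  have d: "d s \<in> mcarrier (syzygy S)" if s: "s \<in> mcarrier S" for s
  proof -
    have F: "single s 1 \<in> mcarrier (free_cover S)"
      "single v (coeff s) \<in> mcarrier (free_cover S)"
      using s v_mem by simp_all
    have "cover_map S (d s) = 0"
      using s by (simp add: d_def module_hom_diff[OF module_hom_cover_map left_module_free_cover F]
          cover_map_single v_mem act_one act_coeff)
    then show ?thesis
      using left_module.diff_mem[OF left_module_free_cover F] by (simp add: syzygy_mem d_def)
  qed
  \<comment> \<open>The basis element \<open>s\<close> is \<open>d s\<close> plus the multiple \<open>coeff s\<close> of the generator.\<close>
  define h where "h = free_lift T (\<lambda>s. \<phi> (d s) + act T (coeff s) t)"
  have "module_hom (free_cover S) T h"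
    unfolding h_def
    by (rule T.module_hom_free_lift) (auto intro!: T.mem_intros module_hom_mem[OF \<phi>] d t(1))
  moreover have "\<phi> w = h w" if w: "w \<in> mcarrier (syzygy S)" for w
  proof -
    let ?c = "lookup w" and ?K = "keys w"
    have K: "s \<in> mcarrier S" if "s \<in> ?K" for s
      using w that by (auto simp: syzygy_mem)
    have cmp: "comparison w = (\<Sum>s\<in>?K. ?c s * coeff s)"
      by (simp add: comparison_def free_lift_def)
    have cmp_rel: "comparison w \<in> mcarrier relations"
      by (rule module_hom_mem[OF module_hom_comparison_syzygy w])
    have "(\<Sum>s\<in>?K. Poly_Mapping.map ((*) (?c s)) (d s))
        = (\<Sum>s\<in>?K. single s (?c s)) - single v (comparison w)"
    proof -
      have "Poly_Mapping.map ((*) (?c s)) (d s)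
          = single s (?c s) - single v (?c s * coeff s)" for s
        by (rule poly_mapping_eqI) (auto simp: d_def lookup_map_mult lookup_minus lookup_single when_def algebra_simps)
      moreover have "single v (comparison w) = (\<Sum>s\<in>?K. single v (?c s * coeff s))"
        by (rule poly_mapping_eqI) (simp add: cmp lookup_sum lookup_single when_def)
      ultimately show ?thesis by (simp add: sum_subtractf)
    qed
    also have "(\<Sum>s\<in>?K. single s (?c s)) = w"
      by (rule poly_mapping_eqI) (auto simp: lookup_sum lookup_single when_def in_keys_iff)
    finally have eq: "w = (\<Sum>s\<in>?K. act (syzygy S) (?c s) (d s)) + single v (comparison w)"
      by simp
    have "\<phi> w = \<phi> (\<Sum>s\<in>?K. act (syzygy S) (?c s) (d s)) + \<phi> (single v (comparison w))"
      by (subst eq, rule module_hom_add[OF \<phi>])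
        (auto intro!: O.sum_mem O.act_mem d K single_relation_syzygy cmp_rel simp del: act_syzygy)
    also have "\<phi> (\<Sum>s\<in>?K. act (syzygy S) (?c s) (d s)) = (\<Sum>s\<in>?K. act T (?c s) (\<phi> (d s)))"
      by (subst module_hom_sum[OF \<phi> O.left_module_axioms])
        (auto intro!: O.act_mem d K sum.cong module_hom_act[OF \<phi>] simp del: act_syzygy)
    also have "\<phi> (single v (comparison w)) = (\<Sum>s\<in>?K. act T (?c s) (act T (coeff s) t))"
      by (simp add: t cmp_rel) (simp add: cmp T.act_sum_left t(1) T.act_mult)
    also have "(\<Sum>s\<in>?K. act T (?c s) (\<phi> (d s))) + \<dots> = h w"
      by (simp add: h_def free_lift_def sum.distrib[symmetric])
        (auto intro!: sum.cong T.act_add_right[symmetric] T.mem_intros t(1) module_hom_mem[OF \<phi>] d K)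
    finally show ?thesis .
  qed
  ultimately show "\<exists>h. module_hom (free_cover S) T h \<and> (\<forall>w\<in>mcarrier (syzygy S). \<phi> w = h w)"
    by blast
qed

lemma ext1_has_dim_0I:
  assumes "\<And>k. module_hom relations T k \<Longrightarrow>
     \<exists>t\<in>mcarrier T. \<forall>x\<in>mcarrier relations. k x = act T x t"
  shows "ext1_has_dim S T 0"
  unfolding ext1_has_dim_0_iff[OF left_module_axioms T]
proof
  fix f assume "f \<in> ext1_cocycles S T"
  then obtain \<phi> where \<phi>: "module_hom (syzygy S) T \<phi>" "f = syzygy_cochain S \<phi>"
    by (auto simp: ext1_cocycles_iff[OF left_module_axioms T])
  then show "f \<in> ext1_coboundaries S T"
    using assms[OF module_hom_relations_of_syzygy[OF \<phi>(1)]]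
    by (simp add: syzygy_cochain_trivial_iff[OF \<phi>(1)])
qed

lemma ext1_has_dim_1_presentationI:
  assumes k: "module_hom relations T k"
    and nontriv: "\<not> (\<exists>t\<in>mcarrier T. \<forall>x\<in>mcarrier relations. k x = act T x t)"
    and span: "\<And>k'. module_hom relations T k' \<Longrightarrow>
     \<exists>c. \<exists>t\<in>mcarrier T. \<forall>x\<in>mcarrier relations. k' x - scal T c (k x) = act T x t"
  shows "ext1_has_dim S T 1"
proof -
  define \<psi> where "\<psi> = (\<lambda>w. k (comparison w))"
  have \<psi>: "module_hom (syzygy S) T \<psi>"
    unfolding \<psi>_def by (rule module_hom_compose[OF module_hom_comparison_syzygy k])
  have \<psi>k: "\<psi> (single v x) = k x" if "x \<in> mcarrier relations" for x
    using that by (simp add: \<psi>_def comparison_single coeff_def relations_iff)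
  show ?thesis
  proof (rule ext1_has_dim_1I[OF left_module_axioms T])
    show "syzygy_cochain S \<psi> \<in> ext1_cocycles S T"
      using \<psi> by (auto simp: ext1_cocycles_iff[OF left_module_axioms T])
    show "syzygy_cochain S \<psi> \<notin> ext1_coboundaries S T"
      using nontriv by (simp add: syzygy_cochain_trivial_iff[OF \<psi>] \<psi>k)
    fix f assume "f \<in> ext1_cocycles S T"
    then obtain \<phi> where \<phi>: "module_hom (syzygy S) T \<phi>" "f = syzygy_cochain S \<phi>"
      by (auto simp: ext1_cocycles_iff[OF left_module_axioms T])
    obtain c t where ct: "t \<in> mcarrier T"
      "\<And>x. x \<in> mcarrier relations \<Longrightarrow> \<phi> (single v x) - scal T c (k x) = act T x t"
      using span[OF module_hom_relations_of_syzygy[OF \<phi>(1)]] by blast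
    have "module_hom (syzygy S) T (\<lambda>w. \<phi> w - scal T c (\<psi> w))"
      using \<phi>(1) \<psi> by (simp add: module_hom_def T.mem_intros T.act_add_right T.act_diff_right T.scal_act)
    then have "syzygy_cochain S (\<lambda>w. \<phi> w - scal T c (\<psi> w)) \<in> ext1_coboundaries S T"
      by (subst syzygy_cochain_trivial_iff) (use ct in \<open>auto simp: \<psi>k\<close>)
    also have "syzygy_cochain S (\<lambda>w. \<phi> w - scal T c (\<psi> w)) = (\<lambda>z. f z - scal T c (syzygy_cochain S \<psi> z))"
      by (auto simp: fun_eq_iff syzygy_cochain_def \<phi>(2))
    finally show "\<exists>c. (\<lambda>z. f z - scal T c (syzygy_cochain S \<psi> z)) \<in> ext1_coboundaries S T"
      by blast
  qed
qed

end

end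


section \<open>Common eigenvectors of commuting elements of finite order\<close>

global_interpretation complex_module: module "scaleC :: complex \<Rightarrow> 'a::complex_vector \<Rightarrow> 'a"
  by unfold_locales (simp_all add: scaleC_add_right scaleC_add_left scaleC_scaleC scaleC_one)

text \<open>There are fewer \<open>i\<close>-th than \<open>k\<close>-th roots of unity, so the map \<open>c \<mapsto> c\<^sup>i\<close> is not constant on the
  latter, and multiplying the sum by one of its values other than \<open>1\<close> only permutes the summands.\<close>

lemma sum_power_roots_of_unity:
  assumes "0 < i" "i < k"
  shows "(\<Sum>c | c ^ k = 1. c ^ i) = (0::complex)"
proof -
  have fin: "finite {c::complex. c ^ j = 1}" if "j > 0" for j
    using that by (intro finite_roots_unity) simp
  have "\<not> {c::complex. c ^ k = 1} \<subseteq> {c. c ^ i = 1}"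
    using card_mono[OF fin[of i], of "{c. c ^ k = 1}"] assms by (auto simp: card_roots_unity_eq)
  then obtain z :: complex where z: "z ^ k = 1" "z ^ i \<noteq> 1" by blast
  then have "z \<noteq> 0" using assms by (auto simp: power_0_left)
  have "(\<Sum>c | c ^ k = 1. c ^ i) = (\<Sum>c | c ^ k = 1. (z * c) ^ i)"
  proof (rule sum.reindex_bij_witness[of _ "\<lambda>c. z * c" "\<lambda>c. c / z"])
  qed (use z \<open>z \<noteq> 0\<close> in \<open>auto simp: power_mult_distrib power_divide\<close>)
  also have "\<dots> = z ^ i * (\<Sum>c | c ^ k = 1. c ^ i)"
    by (simp add: power_mult_distrib sum_distrib_left)
  finally show ?thesis using z(2) by auto
qed

text \<open>The resolvent of an element \<open>g\<close> with \<open>g\<^sup>k = 1\<close> at a \<open>k\<close>-th root of unity \<open>c\<close>: up to the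
  factor \<open>k\<close> it is the projection onto the \<open>c\<close>-eigenspace. The exponent \<open>k - i\<close> stands for \<open>-i\<close>.\<close>

definition resolvent :: "nat \<Rightarrow> 'a::complex_algebra_1 \<Rightarrow> complex \<Rightarrow> 'a" where
  "resolvent k g c = (\<Sum>i<k. c ^ (k - i) *\<^sub>C g ^ i)"

lemma mult_resolvent:
  assumes "g ^ k = 1" "c ^ k = 1"
  shows "g * resolvent k g c = c *\<^sub>C resolvent k g c"
proof -
  let ?f = "\<lambda>i. c ^ (k - i) *\<^sub>C g ^ i"
  have "g * resolvent k g c = (\<Sum>i<k. c *\<^sub>C ?f (Suc i))"
    unfolding resolvent_def sum_distrib_left
  proof (rule sum.cong)
    fix i assume "i \<in> {..<k}"
    then have "c ^ (k - i) = c * c ^ (k - Suc i)"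
      by (metis Suc_diff_Suc lessThan_iff power_Suc)
    then show "g * ?f i = c *\<^sub>C ?f (Suc i)"
      by (simp add: mult_scaleC_right scaleC_scaleC)
  qed simp
  also have "\<dots> = c *\<^sub>C (\<Sum>i<k. ?f (Suc i))"
    by (simp add: complex_module.scale_sum_right)
  also have "(\<Sum>i<k. ?f (Suc i)) = (\<Sum>i<k. ?f i)"
    using sum.lessThan_Suc[of ?f k] sum.lessThan_Suc_shift[of ?f k] assms by simp
  finally show ?thesis by (simp add: resolvent_def)
qed

text \<open>Consequently some resolvent does not annihilate a given nonzero vector, and yields an eigenvector.\<close>

lemma sum_resolvent:
  assumes "k > 0"
  shows "(\<Sum>c | c ^ k = 1. resolvent k g c) = of_nat k *\<^sub>C 1"
proof -
  have "(\<Sum>c | c ^ k = 1. resolvent k g c) = (\<Sum>i<k. (\<Sum>c | c ^ k = 1. c ^ (k - i)) *\<^sub>C g ^ i)"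
    unfolding resolvent_def complex_module.scale_sum_left by (rule sum.swap)
  also have "\<dots> = (\<Sum>i\<in>{0}. (\<Sum>c | c ^ k = 1. c ^ (k - i)) *\<^sub>C g ^ i)"
    using assms by (intro sum.mono_neutral_right) (auto simp: sum_power_roots_of_unity)
  also have "\<dots> = of_nat k *\<^sub>C 1"
    using assms by (simp add: card_roots_unity_eq)
  finally show ?thesis .
qed

text \<open>Two powers agree by finiteness, and the element can be cancelled.\<close>

lemma finite_order:
  fixes g h :: "'a::monoid_mult"
  assumes "h * g = 1" "finite (range (\<lambda>i. g ^ i))"
  obtains k where "k > 0" "g ^ k = 1"
proof -
  have "\<not> inj (\<lambda>i::nat. g ^ i)"
    using assms(2) by (meson finite_imageD infinite_UNIV_nat)
  then obtain i j :: nat where ij: "i < j" "g ^ i = g ^ j"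
    unfolding inj_def by (metis linorder_neqE_nat)
  have cancel: "h ^ m * g ^ m = 1" for m
  proof (induction m)
    case (Suc m)
    have "h ^ Suc m * g ^ Suc m = h ^ m * (h * g) * g ^ m"
      by (simp only: power_Suc2[of h] power_Suc[of g] mult.assoc)
    then show ?case using Suc assms(1) by simp
  qed simp
  have "g ^ (j - i) = h ^ i * g ^ i * g ^ (j - i)"
    by (simp add: cancel)
  also have "\<dots> = h ^ i * g ^ j"
    using ij(1) by (simp add: mult.assoc flip: power_add)
  also have "\<dots> = 1"
    by (simp add: cancel flip: ij(2))
  finally show thesis using ij(1) that[of "j - i"] by simp
qed

context algebra_module
begin

definition subspace :: "'v set \<Rightarrow> bool" where
  "subspace V \<longleftrightarrow> V \<subseteq> mcarrier M \<and> 0 \<in> V \<and> (\<forall>x\<in>V. \<forall>y\<in>V. x + y \<in> V) \<and> (\<forall>c. \<forall>x\<in>V. scal M c x \<in> V)"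

lemma subspace_sum: "subspace V \<Longrightarrow> (\<And>i. i \<in> I \<Longrightarrow> f i \<in> V) \<Longrightarrow> (\<Sum>i\<in>I. f i) \<in> V"
  by (induction I rule: infinite_finite_induct) (auto simp: subspace_def)

lemma finite_order_eigenvector:
  assumes g: "g ^ k = 1" "k > 0" and V: "subspace V" "\<And>x. x \<in> V \<Longrightarrow> act M g x \<in> V"
    and v: "v \<in> V" "v \<noteq> 0"
  obtains c w where "w \<in> V" "w \<noteq> 0" "act M g w = scal M c w"
proof -
  have vM: "v \<in> mcarrier M" using v V(1) by (auto simp: subspace_def)
  have "act M (\<Sum>c | c ^ k = 1. resolvent k g c) v = scal M (of_nat k) v"
    by (simp add: sum_resolvent g)
  then have "(\<Sum>c | c ^ k = 1. act M (resolvent k g c) v) \<noteq> 0"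
    using v g vM by (simp add: act_sum_left scal_eq_0_iff)
  then obtain c where c: "c ^ k = 1" "act M (resolvent k g c) v \<noteq> 0"
    by (metis (mono_tags, lifting) mem_Collect_eq sum.neutral)
  have pow: "act M (g ^ i) v \<in> V" for i
    by (induction i) (simp_all add: act_one act_mult vM v V(2))
  have "act M (resolvent k g c) v = (\<Sum>i<k. scal M (c ^ (k - i)) (act M (g ^ i) v))"
    by (simp add: resolvent_def act_sum_left vM act_scaleC[OF vM])
  also have "\<dots> \<in> V"
    using V(1) pow by (intro subspace_sum) (auto simp: subspace_def)
  finally have "act M (resolvent k g c) v \<in> V" .
  moreover have "act M g (act M (resolvent k g c) v) = scal M c (act M (resolvent k g c) v)"
    by (simp only: act_mult[OF vM, symmetric] mult_resolvent[OF g(1) c(1)] mult_scaleC_left mult_1)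
  ultimately show thesis using c that by blast
qed

text \<open>The eigenspace of one of the elements is stable under the others, since they commute.\<close>

lemma common_eigenvector:
  assumes "finite G" "\<And>g. g \<in> G \<Longrightarrow> \<exists>k>0. g ^ k = 1"
    and "\<And>g h. g \<in> G \<Longrightarrow> h \<in> G \<Longrightarrow> g * h = h * g"
    and "subspace V" "\<And>g x. g \<in> G \<Longrightarrow> x \<in> V \<Longrightarrow> act M g x \<in> V" "v \<in> V" "v \<noteq> 0"
  shows "\<exists>w\<in>V. w \<noteq> 0 \<and> (\<forall>g\<in>G. \<exists>c. act M g w = scal M c w)"
  using assms
proof (induction G arbitrary: V v rule: finite_induct)
  case empty
  then show ?case by blast
next
  case (insert g G)
  obtain k where k: "k > 0" "g ^ k = 1" using insert.prems(1) by blast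
  obtain c w where w: "w \<in> V" "w \<noteq> 0" "act M g w = scal M c w"
    by (rule finite_order_eigenvector[OF k(2,1) insert.prems(3) _ insert.prems(5,6)])
      (use insert.prems(4) in blast)+
  let ?V = "{x \<in> V. act M g x = scal M c x}"
  have VM: "x \<in> mcarrier M" if "x \<in> V" for x
    using that insert.prems(3) by (auto simp: subspace_def)
  have "\<exists>w\<in>?V. w \<noteq> 0 \<and> (\<forall>h\<in>G. \<exists>c. act M h w = scal M c w)"
  proof (rule insert.IH[of ?V w])
    show "subspace ?V"
      using insert.prems(3) by (auto simp: subspace_def act_add_right VM scal_act[of _ g] scal_scal mult.commute)
    fix h x assume hx: "h \<in> G" "x \<in> ?V"
    have "act M g (act M h x) = act M h (act M g x)"
      using hx insert.prems(2)[of g h] VM[of x] by (metis act_mult insertCI mem_Collect_eq)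
    then show "act M h x \<in> ?V"
      using hx insert.prems(4) by (simp add: VM scal_act[of _ h])
  qed (use insert.prems w in auto)
  then show ?case by blast
qed

end


section \<open>The monoid algebra of the affine monoid\<close>

abbreviation mon :: "'m \<Rightarrow> 'm \<Rightarrow>\<^sub>0 complex" where
  "mon g \<equiv> single g 1"

lemma mon_mult: "mon g * mon h = mon (g + h)"
  by (simp add: mult_single)

lemma single_eq_scaleC_mon: "single g c = c *\<^sub>C mon g"
  by (simp add: scaleC_single scaleC_complex_def)

lemma monoid_algebra_induct [case_names zero add]:
  fixes x :: "'m \<Rightarrow>\<^sub>0 complex"
  assumes "P 0" "\<And>g c x. P x \<Longrightarrow> P (c *\<^sub>C mon g + x)"
  shows "P x"
proof (induction x rule: poly_mapping_add_single_induct)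
  case (2 g c x)
  then show ?case
    using assms(2)[of x c g] by (simp only: single_eq_scaleC_mon[symmetric])
qed (rule assms(1))

lemma lookup_scaleC_complex [simp]:
  "lookup (c *\<^sub>C x) g = c * lookup (x :: 'm \<Rightarrow>\<^sub>0 complex) g"
  by (simp add: lookup_scaleC scaleC_complex_def)

lemma lookup_mult_mon:
  assumes "h + h' = 0" "h' + h = (0::'m::monoid_add)"
  shows "lookup (x * mon h) k = lookup x (k + h')"
proof (induction x rule: monoid_algebra_induct)
  case (add g c x)
  have "(g + h) + h' = g" "(k + h') + h = k"
    by (simp_all only: assms add_0_right add.assoc)
  then have "g + h = k \<longleftrightarrow> g = k + h'" by auto
  then show ?case
    using add by (simp add: distrib_right lookup_add mult_scaleC_left mon_mult lookup_single when_def)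
qed simp

lemma lookup_mon_mult:
  assumes "h + h' = 0" "h' + h = (0::'m::monoid_add)"
  shows "lookup (mon h * x) k = lookup x (h' + k)"
proof (induction x rule: monoid_algebra_induct)
  case (add g c x)
  have "h' + (h + g) = g" "h + (h' + k) = k"
    by (simp_all only: assms add_0_left add.assoc[symmetric])
  then have "h + g = k \<longleftrightarrow> g = h' + k" by auto
  then show ?case
    using add by (simp add: distrib_left lookup_add mult_scaleC_right mon_mult lookup_single when_def)
qed simp

lemma zero_eq_aff_map: "0 = aff_map 1 0"
  by transfer (simp add: fun_eq_iff)

lemma aff_map_eq_iff: "aff_map a b = aff_map c d \<longleftrightarrow> a = c \<and> b = d"
proof
  assume "aff_map a b = aff_map c d"
  then have *: "a * x + b = c * x + d" for x
    by transfer (rule fun_cong)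
  show "a = c \<and> b = d"
    using *[of 0] *[of 1] by simp
qed simp

lemma aff_map_cases [case_names aff_map, cases type: aff]:
  obtains a b where "g = aff_map a b"
proof -
  have "\<exists>a b. g = aff_map a b" by transfer blast
  then show thesis using that by blast
qed

instance aff :: ("{finite, comm_ring_1}") finite
proof
  have "UNIV = (\<lambda>(a, b). aff_map a b) ` (UNIV :: ('a \<times> 'a) set)"
    by (auto simp: image_def intro: aff_map_cases)
  then show "finite (UNIV :: 'a aff set)" by (metis finite finite_imageI)
qed

lemma aff_map_in_units: "aff_map a b \<in> aff_units \<longleftrightarrow> a dvd 1"
  by (auto simp: aff_units_def aff_map_eq_iff)

lemma plus_in_aff_units: "g + h \<in> aff_units \<longleftrightarrow> g \<in> aff_units \<and> h \<in> aff_units"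
  by (cases g; cases h) (auto simp: aff_map_plus aff_map_in_units is_unit_mult_iff
      dest: dvd_mult_left dvd_mult_right intro: mult_dvd_mono[of _ 1 _ 1, simplified])

lemma zero_in_aff_units: "0 \<in> aff_units"
  by (simp add: zero_eq_aff_map aff_map_in_units)

lemma aff_units_inverse:
  assumes "g \<in> aff_units"
  obtains h where "h \<in> aff_units" "g + h = 0" "h + g = 0"
proof (cases g)
  case (aff_map a b)
  then obtain a' where a: "a * a' = 1"
    using assms by (auto simp: aff_map_in_units elim: dvdE)
  then have a': "a' * a = 1" "a * (a' * b) = b" by (simp_all add: mult.commute flip: mult.assoc)
  show thesis
    by (rule that[of "aff_map a' (- (a' * b))"])
      (use a a' aff_map in \<open>auto simp: aff_map_in_units aff_map_plus zero_eq_aff_map aff_map_eq_iff dvd_def mult.commute\<close>)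
qed

lemma mon_finite_order:
  fixes g :: "'r::{finite, comm_ring_1} aff"
  assumes "g \<in> aff_units"
  shows "\<exists>k>0. mon g ^ k = 1"
proof -
  obtain h where h: "h + g = 0" using aff_units_inverse[OF assms] by blast
  have "mon g ^ i \<in> mon ` UNIV" for i
    by (induction i) (auto simp: mon_mult simp flip: single_one)
  then have "range (\<lambda>i. mon g ^ i) \<subseteq> mon ` UNIV"
    by blast
  then have "finite (range (\<lambda>i. mon g ^ i))"
    by (rule finite_subset) (rule finite_imageI, rule finite)
  then show ?thesis
    using finite_order[of "mon h" "mon g"] h by (metis mon_mult single_one)
qed


section \<open>Sums over a character\<close>

lemma additive_character_0: "additive_character \<chi> \<Longrightarrow> \<chi> 0 = 1"
  by (metis add_0 additive_character_def mult_cancel_right1)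

lemma additive_character_add: "additive_character \<chi> \<Longrightarrow> \<chi> (a + b) = \<chi> a * \<chi> b"
  by (simp add: additive_character_def)

lemma additive_character_nonzero: "additive_character \<chi> \<Longrightarrow> \<chi> a \<noteq> 0"
  by (simp add: additive_character_def)

lemma additive_character_minus: "additive_character \<chi> \<Longrightarrow> \<chi> (- a) = inverse (\<chi> a)"
  using additive_character_add[of \<chi> a "- a"] additive_character_0[of \<chi>]
  by (simp add: inverse_unique)

lemma additive_character_diff: "additive_character \<chi> \<Longrightarrow> \<chi> (a - b) = \<chi> a / \<chi> b"
  using additive_character_add[of \<chi> a "- b"] additive_character_minus[of \<chi> b]
  by (simp add: divide_inverse)

lemma additive_character_mult: "additive_character \<chi> \<Longrightarrow> additive_character (\<lambda>a. \<chi> (u * a))"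
  by (simp add: additive_character_def distrib_left)

locale unit_subgroup =
  fixes U :: "'r::{finite, comm_ring_1} set"
  assumes one_mem: "1 \<in> U"
    and mult_mem: "\<lbrakk>a \<in> U; b \<in> U\<rbrakk> \<Longrightarrow> a * b \<in> U"
    and inverse_mem: "a \<in> U \<Longrightarrow> \<exists>a'\<in>U. a * a' = 1"

lemma stabilizer_iff: "u \<in> stabilizer \<chi> \<longleftrightarrow> u dvd 1 \<and> (\<forall>a. \<chi> (u * a) = \<chi> a)"
  by (simp add: stabilizer_def)

lemma stabilizer_inverse:
  assumes "u \<in> stabilizer \<chi>" "u * u' = 1"
  shows "u' \<in> stabilizer \<chi>"
proof -
  have "\<chi> (u' * a) = \<chi> a" for a
  proof -
    have "\<chi> (u' * a) = \<chi> (u * (u' * a))" using assms(1) by (simp add: stabilizer_iff)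
    also have "u * (u' * a) = a" using assms(2) by (simp flip: mult.assoc)
    finally show ?thesis .
  qed
  then show ?thesis using assms(2) by (auto simp: stabilizer_iff dvd_def mult.commute)
qed

lemma unit_subgroup_stabilizer: "unit_subgroup (stabilizer \<chi>)"
proof
  fix a assume a: "a \<in> stabilizer \<chi>"
  then obtain a' where "a * a' = 1" by (auto simp: stabilizer_iff elim: dvdE)
  then show "\<exists>a'\<in>stabilizer \<chi>. a * a' = 1" using a stabilizer_inverse by blast
qed (auto simp: stabilizer_iff mult.assoc intro: mult_dvd_mono[of _ 1 _ 1, simplified])

lemma unit_subgroup_trivial: "unit_subgroup {1}"
  by unfold_locales auto

text \<open>If \<open>U\<close> is a group of units that fix \<open>\<chi>\<close>, then \<open>\<lambda>(a x + b) = \<chi>(b) \<rho>(a)\<close> is a degree one character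
  of the group of the maps \<open>a x + b\<close> with \<open>a \<in> U\<close>, and this is its primitive idempotent up to the
  factor \<open>|U| |R|\<close>. Both cases of interest are extreme: \<open>U\<close> is the whole stabilizer, or \<open>U = {1}\<close>.\<close>

definition character_sum ::
    "'r::{finite, comm_ring_1} set \<Rightarrow> ('r \<Rightarrow> complex) \<Rightarrow> ('r \<Rightarrow> complex) \<Rightarrow> 'r aff_algebra" where
  "character_sum U \<chi> \<rho> = (\<Sum>(a, b)\<in>U \<times> UNIV. inverse (\<chi> b * \<rho> a) *\<^sub>C mon (aff_map a b))"

lemma lookup_character_sum:
  "lookup (character_sum U \<chi> \<rho>) (aff_map a b) = (if a \<in> U then inverse (\<chi> b * \<rho> a) else 0)"
proof -
  have "lookup (character_sum U \<chi> \<rho>) (aff_map a b)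
      = (\<Sum>ab\<in>U \<times> UNIV. if ab = (a, b) then inverse (\<chi> b * \<rho> a) else 0)"
    unfolding character_sum_def lookup_sum
    by (rule sum.cong) (auto simp: lookup_single when_def aff_map_eq_iff split: if_splits)
  then show ?thesis by simp
qed

lemma keys_character_sum: "(\<And>a. a \<in> U \<Longrightarrow> a dvd 1) \<Longrightarrow> keys (character_sum U \<chi> \<rho>) \<subseteq> aff_units"
proof
  fix g assume U: "\<And>a. a \<in> U \<Longrightarrow> a dvd 1" and g: "g \<in> keys (character_sum U \<chi> \<rho>)"
  show "g \<in> aff_units"
    using g U by (cases g) (auto simp: in_keys_iff lookup_character_sum aff_map_in_units split: if_splits)
qed

locale semicharacter = unit_subgroup U for U :: "'r::{finite, comm_ring_1} set" +
  fixes \<chi> \<rho> :: "'r \<Rightarrow> complex"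
  assumes additive: "additive_character \<chi>" and stab: "U \<subseteq> stabilizer \<chi>" and unit: "unit_character U \<rho>"
begin

lemma chi_mult: "a \<in> U \<Longrightarrow> \<chi> (a * b) = \<chi> b"
  using stab by (auto simp: stabilizer_iff)

lemma rho_mult: "a \<in> U \<Longrightarrow> b \<in> U \<Longrightarrow> \<rho> (a * b) = \<rho> a * \<rho> b"
  and rho_nonzero: "a \<in> U \<Longrightarrow> \<rho> a \<noteq> 0"
  using unit by (auto simp: unit_character_def)

lemma rho_one: "\<rho> 1 = 1"
  using rho_mult[of 1 1] rho_nonzero[of 1] one_mem by simp

lemma rho_inverse: "a \<in> U \<Longrightarrow> a' \<in> U \<Longrightarrow> a * a' = 1 \<Longrightarrow> \<rho> a' = inverse (\<rho> a)"
  using rho_mult[of a a'] rho_one by (simp add: inverse_unique)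

lemma aff_map_inverse:
  assumes "c * c' = (1 :: 'r)"
  shows "aff_map c d + aff_map c' (- (c' * d)) = 0" "aff_map c' (- (c' * d)) + aff_map c d = 0"
proof -
  have "c * (c' * d) = d" "c' * c = 1" using assms by (simp_all add: mult.commute flip: mult.assoc)
  then show "aff_map c d + aff_map c' (- (c' * d)) = 0" "aff_map c' (- (c' * d)) + aff_map c d = 0"
    using assms by (simp_all add: aff_map_plus zero_eq_aff_map)
qed

lemma mem_U_iff:
  assumes "c \<in> U"
  shows "c * a \<in> U \<longleftrightarrow> a \<in> U"
proof
  assume "c * a \<in> U"
  obtain d where d: "d \<in> U" "c * d = 1" using inverse_mem[OF assms] by blast
  have "d * (c * a) = c * d * a" by (simp add: ac_simps)
  then show "a \<in> U" using mult_mem[OF d(1) \<open>c * a \<in> U\<close>] d(2) by simp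
qed (rule mult_mem[OF assms])

lemma mon_mult_character_sum:
  assumes "c \<in> U"
  shows "mon (aff_map c d) * character_sum U \<chi> \<rho> = (\<chi> d * \<rho> c) *\<^sub>C character_sum U \<chi> \<rho>"
proof (rule poly_mapping_eqI)
  fix g :: "'r aff"
  obtain a b where g: "g = aff_map a b" by (cases g)
  obtain c' where c': "c' \<in> U" "c * c' = 1" using inverse_mem[OF assms] by blast
  have "aff_map c' (- (c' * d)) + g = aff_map (c' * a) (c' * (b - d))"
    by (simp add: g aff_map_plus right_diff_distrib)
  moreover have "inverse (\<chi> (c' * (b - d)) * \<rho> (c' * a)) = \<chi> d * \<rho> c * inverse (\<chi> b * \<rho> a)" if "a \<in> U"
    using that assms c' rho_inverse[OF assms c'] additive_character_nonzero[OF additive]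
    by (simp add: chi_mult rho_mult additive_character_diff[OF additive]) (simp add: field_simps)
  ultimately show "lookup (mon (aff_map c d) * character_sum U \<chi> \<rho>) g
      = lookup ((\<chi> d * \<rho> c) *\<^sub>C character_sum U \<chi> \<rho>) g"
    by (simp add: lookup_mon_mult[OF aff_map_inverse[OF c'(2)]] g lookup_character_sum mem_U_iff[OF c'(1)])
qed

lemma character_sum_mult_mon:
  assumes "c \<in> U"
  shows "character_sum U \<chi> \<rho> * mon (aff_map c d) = (\<chi> d * \<rho> c) *\<^sub>C character_sum U \<chi> \<rho>"
proof (rule poly_mapping_eqI)
  fix g :: "'r aff"
  obtain a b where g: "g = aff_map a b" by (cases g)
  obtain c' where c': "c' \<in> U" "c * c' = 1" using inverse_mem[OF assms] by blast
  have "g + aff_map c' (- (c' * d)) = aff_map (c' * a) (b - a * (c' * d))"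
    by (simp add: g aff_map_plus mult.commute)
  moreover have "inverse (\<chi> (b - a * (c' * d)) * \<rho> (c' * a)) = \<chi> d * \<rho> c * inverse (\<chi> b * \<rho> a)" if "a \<in> U"
    using that assms c' rho_inverse[OF assms c'] additive_character_nonzero[OF additive]
    by (simp add: chi_mult rho_mult additive_character_diff[OF additive]) (simp add: field_simps)
  ultimately show "lookup (character_sum U \<chi> \<rho> * mon (aff_map c d)) g
      = lookup ((\<chi> d * \<rho> c) *\<^sub>C character_sum U \<chi> \<rho>) g"
    by (simp add: lookup_mult_mon[OF aff_map_inverse[OF c'(2)]] g lookup_character_sum mem_U_iff[OF c'(1)])
qed

lemma sum_inverse_character:
  assumes "left_module M" "v \<in> mcarrier M"
    and f: "\<And>a b. a \<in> U \<Longrightarrow> f a b = scal M (\<chi> b * \<rho> a) v"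
  shows "(\<Sum>(a, b)\<in>U \<times> UNIV. scal M (inverse (\<chi> b * \<rho> a)) (f a b))
    = scal M (of_nat (card U * card (UNIV :: 'r set))) v"
proof -
  interpret M: algebra_module M
    using assms(1) by (simp add: algebra_module_def)
  have "(\<Sum>(a, b)\<in>U \<times> UNIV. scal M (inverse (\<chi> b * \<rho> a)) (f a b))
      = (\<Sum>_\<in>U \<times> (UNIV :: 'r set). scal M 1 v)"
  proof (rule sum.cong[OF refl], clarify)
    fix a b assume "a \<in> U"
    then show "scal M (inverse (\<chi> b * \<rho> a)) (f a b) = scal M 1 v"
      using additive_character_nonzero[OF additive, of b] rho_nonzero[of a]
      by (simp add: f assms(2) M.scal_scal M.act_one del: inverse_mult_distrib)
  qed
  also have "\<dots> = act M (\<Sum>_\<in>U \<times> (UNIV :: 'r set). 1 *\<^sub>C 1) v"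
    by (rule M.act_sum_left[OF assms(2), symmetric])
  finally show ?thesis
    by (simp only: complex_module.scale_sum_left[symmetric] sum_constant card_cartesian_product mult_1_right)
qed

lemma act_character_sum:
  assumes "left_module M" "v \<in> mcarrier M"
    and "\<And>a b. a \<in> U \<Longrightarrow> act M (mon (aff_map a b)) v = scal M (\<chi> b * \<rho> a) v"
  shows "act M (character_sum U \<chi> \<rho>) v = scal M (of_nat (card U * card (UNIV :: 'r set))) v"
proof -
  interpret M: algebra_module M
    using assms(1) by (simp add: algebra_module_def)
  have "act M (character_sum U \<chi> \<rho>) v
      = (\<Sum>(a, b)\<in>U \<times> UNIV. scal M (inverse (\<chi> b * \<rho> a)) (act M (mon (aff_map a b)) v))"
    by (simp add: character_sum_def M.act_sum_left assms M.act_scaleC[OF assms(2)] case_prod_unfold)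
  then show ?thesis
    using sum_inverse_character[of M v "\<lambda>a b. act M (mon (aff_map a b)) v", OF assms] by simp
qed

lemma card_U_pos: "card U * card (UNIV :: 'r set) > 0"
  using one_mem by (auto simp: card_gt_0_iff finite_subset[OF subset_UNIV])

lemma character_sum_square:
  "character_sum U \<chi> \<rho> * character_sum U \<chi> \<rho> = of_nat (card U * card (UNIV :: 'r set)) *\<^sub>C character_sum U \<chi> \<rho>"
proof -
  let ?R = "\<lparr>mcarrier = UNIV :: 'r aff_algebra set, act = (*)\<rparr>"
  have "left_module ?R"
    by unfold_locales (simp_all add: algebra_simps)
  then show ?thesis
    using act_character_sum[of ?R "character_sum U \<chi> \<rho>"] mon_mult_character_sum
    by (simp add: mult_scaleC_left)
qed

end

abbreviation weight_sum :: "('r::{finite, comm_ring_1} \<Rightarrow> complex) \<Rightarrow> 'r aff_algebra" where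
  "weight_sum \<chi> \<equiv> character_sum {1} \<chi> (\<lambda>_. 1)"

lemma weight_sum_eq: "weight_sum \<chi> = (\<Sum>b\<in>UNIV. inverse (\<chi> b) *\<^sub>C mon (aff_map 1 b))"
  by (simp add: character_sum_def flip: sum.cartesian_product)

lemma semicharacter_trivial: "additive_character \<chi> \<Longrightarrow> semicharacter {1} \<chi> (\<lambda>_. 1)"
  using unit_subgroup_trivial
  by (auto simp: semicharacter_def semicharacter_axioms_def unit_character_def stabilizer_iff)

lemma semicharacter_stabilizer:
  "additive_character \<chi> \<Longrightarrow> unit_character (stabilizer \<chi>) \<rho> \<Longrightarrow> semicharacter (stabilizer \<chi>) \<chi> \<rho>"
  using unit_subgroup_stabilizer[of \<chi>] by (auto simp: semicharacter_def semicharacter_axioms_def)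

lemma translation_weight_sum:
  assumes "additive_character \<chi>"
  shows "mon (aff_map 1 d) * weight_sum \<chi> = \<chi> d *\<^sub>C weight_sum \<chi>"
    and "weight_sum \<chi> * mon (aff_map 1 d) = \<chi> d *\<^sub>C weight_sum \<chi>"
  using semicharacter.mon_mult_character_sum[OF semicharacter_trivial[OF assms], of 1 d]
    semicharacter.character_sum_mult_mon[OF semicharacter_trivial[OF assms], of 1 d] by simp_all

lemma dilation_weight_sum:
  assumes u: "u * u' = 1"
  shows "mon (aff_map u 0) * weight_sum \<chi> = weight_sum (\<lambda>b. \<chi> (u' * b)) * mon (aff_map u 0)"
proof (rule poly_mapping_eqI)
  fix g :: "'a aff"
  obtain a b where g: "g = aff_map a b" by (cases g)
  have inv: "aff_map u 0 + aff_map u' 0 = 0" "aff_map u' 0 + aff_map u 0 = 0"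
    using u by (simp_all add: aff_map_plus zero_eq_aff_map mult.commute)
  show "lookup (mon (aff_map u 0) * weight_sum \<chi>) g
      = lookup (weight_sum (\<lambda>b. \<chi> (u' * b)) * mon (aff_map u 0)) g"
    by (simp add: lookup_mon_mult[OF inv] lookup_mult_mon[OF inv] g aff_map_plus lookup_character_sum mult.commute)
qed


section \<open>Modules given by a linear action of a monoid\<close>

lemma monoid_algebra_expansion:
  "(\<Sum>g\<in>keys x. lookup x g *\<^sub>C mon g) = (x :: 'm \<Rightarrow>\<^sub>0 complex)"
  by (rule poly_mapping_eqI)
    (auto simp: lookup_sum lookup_single when_def in_keys_iff if_distrib cong: if_cong)

lemma mcarrier_linear_extension [simp]: "mcarrier (linear_extension V \<alpha>) = V"
  by (simp add: linear_extension_def)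

lemma act_linear_extension_superset:
  assumes "finite F" "keys x \<subseteq> F"
  shows "act (linear_extension V \<alpha>) x v = (\<Sum>g\<in>F. lookup x g *\<^sub>C \<alpha> g v)"
  using assms by (auto simp: linear_extension_def in_keys_iff intro!: sum.mono_neutral_left)

lemma act_linear_extension_add:
  "act (linear_extension V \<alpha>) (x + y) v = act (linear_extension V \<alpha>) x v + act (linear_extension V \<alpha>) y v"
proof -
  let ?F = "keys x \<union> keys y"
  have "act (linear_extension V \<alpha>) z v = (\<Sum>g\<in>?F. lookup z g *\<^sub>C \<alpha> g v)"
    if "z \<in> {x, y, x + y}" for z
    by (rule act_linear_extension_superset) (use that Poly_Mapping.keys_add[of x y] in auto)
  then show ?thesis by (simp add: lookup_add scaleC_add_left sum.distrib)
qed

lemma act_linear_extension_scaleC: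
  "act (linear_extension V \<alpha>) (c *\<^sub>C x) v = c *\<^sub>C act (linear_extension V \<alpha>) x v"
proof -
  have "act (linear_extension V \<alpha>) z v = (\<Sum>g\<in>keys x. lookup z g *\<^sub>C \<alpha> g v)"
    if "z \<in> {x, c *\<^sub>C x}" for z
    by (rule act_linear_extension_superset) (use that in \<open>auto simp: in_keys_iff\<close>)
  then show ?thesis by (simp add: complex_module.scale_sum_right scaleC_scaleC)
qed

lemma act_linear_extension_mon: "act (linear_extension V \<alpha>) (mon g) v = \<alpha> g v"
  by (simp add: linear_extension_def)

lemma act_linear_extension_zero: "act (linear_extension V \<alpha>) 0 v = 0"
  by (simp add: linear_extension_def)

lemmas act_linear_extension = act_linear_extension_add act_linear_extension_scaleC
  act_linear_extension_mon act_linear_extension_zero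

lemma left_module_linear_extension:
  fixes V :: "'v::complex_vector set" and \<alpha> :: "'m::monoid_add \<Rightarrow> 'v \<Rightarrow> 'v"
  assumes V: "0 \<in> V" "\<And>v w. v \<in> V \<Longrightarrow> w \<in> V \<Longrightarrow> v + w \<in> V" "\<And>c v. v \<in> V \<Longrightarrow> c *\<^sub>C v \<in> V"
    and \<alpha>: "\<And>g v. v \<in> V \<Longrightarrow> \<alpha> g v \<in> V"
      "\<And>g v w. v \<in> V \<Longrightarrow> w \<in> V \<Longrightarrow> \<alpha> g (v + w) = \<alpha> g v + \<alpha> g w"
      "\<And>g c v. v \<in> V \<Longrightarrow> \<alpha> g (c *\<^sub>C v) = c *\<^sub>C \<alpha> g v"
      "\<And>v. v \<in> V \<Longrightarrow> \<alpha> 0 v = v"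
      "\<And>g h v. v \<in> V \<Longrightarrow> \<alpha> (g + h) v = \<alpha> g (\<alpha> h v)"
  shows "left_module (linear_extension V \<alpha>)"
proof -
  let ?M = "linear_extension V \<alpha>"
  note A = act_linear_extension
  have mem: "act ?M x v \<in> V" if "v \<in> V" for x v
    by (induction x rule: monoid_algebra_induct) (auto simp: A V \<alpha>(1) that)
  have z: "\<alpha> g 0 = 0" for g
    using \<alpha>(2)[of 0 0 g] V(1) by simp
  have mon: "act ?M (mon g * y) v = \<alpha> g (act ?M y v)" if "v \<in> V" for g y v
    by (induction y rule: monoid_algebra_induct)
      (simp_all add: A z distrib_left mult_scaleC_right mon_mult \<alpha> V mem that)
  show ?thesis
  proof
    fix v :: 'v assume "v \<in> mcarrier ?M"
    then show "- v \<in> mcarrier ?M"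
      using V(3)[of v "- 1"] by simp
  next
    fix a and v w :: 'v assume "v \<in> mcarrier ?M" "w \<in> mcarrier ?M"
    then show "act ?M a (v + w) = act ?M a v + act ?M a w"
      by (induction a rule: monoid_algebra_induct) (simp_all add: A \<alpha>(2) scaleC_add_right)
  next
    fix a b and v :: 'v assume "v \<in> mcarrier ?M"
    then show "act ?M (a * b) v = act ?M a (act ?M b v)"
      by (induction a rule: monoid_algebra_induct) (simp_all add: A mon distrib_right mult_scaleC_left)
  next
    fix v :: 'v assume "v \<in> mcarrier ?M"
    then show "act ?M 1 v = v"
      by (simp add: act_linear_extension_mon \<alpha>(4) flip: single_one)
  qed (simp_all add: V mem A)
qed

lemma scal_linear_extension:
  "scal (linear_extension V \<alpha>) c v = c *\<^sub>C \<alpha> (0::'m::monoid_add) v"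
  by (simp add: act_linear_extension flip: single_one)


section \<open>The trivial module\<close>

lemma trivial_module_simps [simp]:
  "mcarrier trivial_module = UNIV"
  "act trivial_module (mon g) z = z"
  "scal trivial_module c z = c * z"
  by (simp_all add: trivial_module_def act_linear_extension_mon scal_linear_extension scaleC_complex_def)

lemma left_module_trivial_module: "left_module trivial_module"
  unfolding trivial_module_def by (rule left_module_linear_extension) auto

lemma simple_trivial_module:
  "simple_module (trivial_module :: ('r::comm_ring_1 aff_algebra, complex) left_mod)"
  (is "simple_module ?T")
  unfolding simple_module_def
proof (intro conjI allI impI)
  show "mcarrier ?T \<noteq> {0}"
    by (auto simp: set_eq_iff intro: exI[of _ "1 :: complex"])
  fix N assume N: "submodule N ?T"
  show "N = {0} \<or> N = mcarrier ?T"
  proof (cases "N = {0}")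
    case False
    then obtain z where z: "z \<in> N" "z \<noteq> 0" using N by (auto simp: submodule_def)
    have "w \<in> N" for w
    proof -
      have "\<forall>a. act ?T a z \<in> N" using N z(1) unfolding submodule_def by (elim conjE) simp
      then have "scal ?T (w / z) z \<in> N" by (rule spec)
      then show ?thesis using z(2) by simp
    qed
    then show ?thesis by auto
  qed simp
qed (rule left_module_trivial_module)

text \<open>A simple module on which all maps act as the identity consists of the multiples of any one of its
  nonzero vectors.\<close>

lemma isomorphic_trivial_module_iff:
  fixes S :: "('r::{finite, comm_ring_1} aff_algebra, 'v::ab_group_add) left_mod"
  assumes S: "simple_module S"
  shows "S \<cong>\<^sub>m (trivial_module :: ('r aff_algebra, complex) left_mod)
    \<longleftrightarrow> (\<forall>g. \<forall>s\<in>mcarrier S. act S (mon g) s = s)"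
proof
  let ?T = "trivial_module :: ('r aff_algebra, complex) left_mod"
  interpret algebra_module S
    using simple_module_left_module[OF S] by (simp add: algebra_module_def)
  {
    assume "S \<cong>\<^sub>m ?T"
    then obtain f where f: "module_hom S ?T f" "bij_betw f (mcarrier S) (mcarrier ?T)"
      by (auto simp: isomorphic_iff[OF left_module_axioms])
    show "\<forall>g. \<forall>s\<in>mcarrier S. act S (mon g) s = s"
    proof (intro allI ballI)
      fix g s assume s: "s \<in> mcarrier S"
      have "f (act S (mon g) s) = f s"
        by (simp add: module_hom_act[OF f(1) s])
      then show "act S (mon g) s = s"
        using f(2) s act_mem[OF s] by (auto simp: bij_betw_def dest: inj_onD)
    qed
  next
    assume triv: "\<forall>g. \<forall>s\<in>mcarrier S. act S (mon g) s = s"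
    obtain v where v: "v \<in> mcarrier S" "v \<noteq> 0" using simple_module_obtain[OF S] by blast
    have "module_hom ?T S (\<lambda>z. scal S z v)"
      unfolding module_hom_def
    proof (intro conjI ballI allI)
      fix a and z :: complex
      show "scal S (act ?T a z) v = act S a (scal S z v)"
      proof (induction a rule: monoid_algebra_induct)
        case zero
        then show ?case using v(1)
          by (simp add: left_module.act_zero_left[OF left_module_trivial_module] act_zero_left act_mem)
      next
        case (add g c x)
        have "act ?T (c *\<^sub>C mon g + x) z = c * z + act ?T x z"
          by (simp add: trivial_module_def act_linear_extension scaleC_complex_def)
        moreover have "act S (c *\<^sub>C mon g + x) (scal S z v) = scal S (c * z) v + act S x (scal S z v)"
          using v(1) triv by (simp add: act_add_left act_mem act_scaleC[of "scal S z v" c "mon g"] scal_scal)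
        ultimately show ?case using add v(1) by (simp add: scal_add_left)
      qed
    qed (simp_all add: v act_mem scal_add_left)
    then have "?T \<cong>\<^sub>m S"
      by (rule simple_module_isoI[OF simple_trivial_module S, of _ 1]) (simp_all add: v act_one)
    then show "S \<cong>\<^sub>m ?T"
      by (rule isomorphic_sym[OF left_module_trivial_module left_module_axioms])
  }
qed


section \<open>The induced modules\<close>

lemma mon_mult_keys:
  assumes "g \<in> aff_units" "keys f \<subseteq> aff_units"
  shows "keys (mon g * f) \<subseteq> aff_units"
proof
  fix k assume k: "k \<in> keys (mon g * f)"
  obtain h where h: "g + h = 0" "h + g = 0" using aff_units_inverse[OF assms(1)] by blast
  have "h + k \<in> aff_units"
    using k assms(2) by (auto simp: in_keys_iff lookup_mon_mult[OF h])
  then show "k \<in> aff_units" by (simp add: plus_in_aff_units)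
qed

text \<open>Written with the multiplication of the algebra, the invariance from the right is visibly
  preserved by multiplication from the left.\<close>

lemma induced_space_iff:
  fixes \<chi> \<rho> :: "'r::{finite, comm_ring_1} \<Rightarrow> complex"
  assumes "additive_character \<chi>" "unit_character (stabilizer \<chi>) \<rho>"
  shows "f \<in> induced_space \<chi> \<rho> \<longleftrightarrow> keys f \<subseteq> aff_units
    \<and> (\<forall>a\<in>stabilizer \<chi>. \<forall>b. f * mon (aff_map a b) = (\<chi> b * \<rho> a) *\<^sub>C f)"
proof (cases "keys f \<subseteq> aff_units")
  case True
  interpret semicharacter "stabilizer \<chi>" \<chi> \<rho>
    by (rule semicharacter_stabilizer[OF assms])
  have "(\<forall>g\<in>aff_units. lookup f (g + aff_map a b) = inverse (\<chi> b * \<rho> a) * lookup f g)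
      \<longleftrightarrow> f * mon (aff_map a b) = (\<chi> b * \<rho> a) *\<^sub>C f" if a: "a \<in> stabilizer \<chi>" for a b
  proof -
    let ?h = "aff_map a b"
    have nz: "\<chi> b * \<rho> a \<noteq> 0"
      using additive_character_nonzero[OF additive] rho_nonzero[OF a] by simp
    obtain h' where h': "?h + h' = 0" "h' + ?h = 0" and hu: "h' \<in> aff_units"
      using aff_units_inverse[of ?h] a by (auto simp: aff_map_in_units stabilizer_iff)
    have inv: "\<chi> b * \<rho> a * (inverse (\<chi> b * \<rho> a) * y) = y" for y
      using nz by (simp flip: mult.assoc del: inverse_mult_distrib)
    have cancel: "k + h' + ?h = k" "k + ?h + h' = k" for k
      by (simp_all only: add.assoc h' add_0_right)
    show ?thesis
    proof
      assume L: "\<forall>g\<in>aff_units. lookup f (g + ?h) = inverse (\<chi> b * \<rho> a) * lookup f g"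
      show "f * mon ?h = (\<chi> b * \<rho> a) *\<^sub>C f"
      proof (rule poly_mapping_eqI)
        fix k
        show "lookup (f * mon ?h) k = lookup ((\<chi> b * \<rho> a) *\<^sub>C f) k"
        proof (cases "k \<in> aff_units")
          case True
          then show ?thesis
            using L[rule_format, of "k + h'"] hu
            by (simp add: lookup_mult_mon[OF h'] cancel plus_in_aff_units inv del: inverse_mult_distrib)
        next
          case False
          then have "lookup f (k + h') = 0" "lookup f k = 0"
            using True by (auto simp: in_keys_iff plus_in_aff_units)
          then show ?thesis by (simp add: lookup_mult_mon[OF h'])
        qed
      qed
    next
      assume R: "f * mon ?h = (\<chi> b * \<rho> a) *\<^sub>C f"
      show "\<forall>g\<in>aff_units. lookup f (g + ?h) = inverse (\<chi> b * \<rho> a) * lookup f g"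
      proof
        fix g
        have "lookup (f * mon ?h) (g + ?h) = lookup f g"
          by (simp add: lookup_mult_mon[OF h'] cancel)
        then have "\<chi> b * \<rho> a * lookup f (g + ?h) = lookup f g"
          unfolding R by simp
        then show "lookup f (g + ?h) = inverse (\<chi> b * \<rho> a) * lookup f g"
          using nz by (simp add: field_simps)
      qed
    qed
  qed
  then show ?thesis
    using True by (auto simp: induced_space_def)
qed (simp add: induced_space_def)

lemma mcarrier_W_module [simp]: "mcarrier (W_module \<chi> \<rho>) = induced_space \<chi> \<rho>"
  by (simp add: W_module_def)

text \<open>The modules \<open>W\<close> up to isomorphism: simple modules that are killed by the singular maps and contain
  a vector \<open>v\<close> on which the inducing subgroup acts by its character. By Frobenius reciprocity such a
  vector amounts to a nonzero homomorphism from the induced module.\<close>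

locale weight_module = algebra_module S
  for S :: "('r::{finite, comm_ring_1} aff_algebra, 'v::ab_group_add) left_mod" +
  fixes \<chi> \<rho> :: "'r \<Rightarrow> complex" and v :: 'v
  assumes simple: "simple_module S"
    and singular: "g \<notin> aff_units \<Longrightarrow> s \<in> mcarrier S \<Longrightarrow> act S (mon g) s = 0"
    and additive_chi: "additive_character \<chi>" and unit_rho: "unit_character (stabilizer \<chi>) \<rho>"
    and v_mem: "v \<in> mcarrier S" and v_nonzero: "v \<noteq> 0"
    and weight: "a \<in> stabilizer \<chi> \<Longrightarrow> act S (mon (aff_map a b)) v = scal S (\<chi> b * \<rho> a) v"
begin

sublocale chr: semicharacter "stabilizer \<chi>" \<chi> \<rho>
  by (rule semicharacter_stabilizer[OF additive_chi unit_rho])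

end

context
  fixes \<chi> \<rho> :: "'r::{finite, comm_ring_1} \<Rightarrow> complex"
  assumes chi: "additive_character \<chi>" and rho: "unit_character (stabilizer \<chi>) \<rho>"
begin

interpretation semicharacter "stabilizer \<chi>" \<chi> \<rho>
  by (rule semicharacter_stabilizer[OF chi rho])

lemma character_sum_in_induced_space: "character_sum (stabilizer \<chi>) \<chi> \<rho> \<in> induced_space \<chi> \<rho>"
  using keys_character_sum[of "stabilizer \<chi>" \<chi> \<rho>]
  by (auto simp: induced_space_iff[OF chi rho] character_sum_mult_mon stabilizer_iff)

lemma character_sum_nonzero: "character_sum (stabilizer \<chi>) \<chi> \<rho> \<noteq> 0"
proof -
  have "lookup (character_sum (stabilizer \<chi>) \<chi> \<rho>) (aff_map 1 0) \<noteq> 0"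
    using one_mem additive_character_nonzero[OF chi] rho_nonzero[OF one_mem]
    by (simp add: lookup_character_sum)
  then show ?thesis by auto
qed

lemma induced_space_closed:
  "f \<in> induced_space \<chi> \<rho> \<Longrightarrow> f' \<in> induced_space \<chi> \<rho> \<Longrightarrow> f + f' \<in> induced_space \<chi> \<rho>"
  "f \<in> induced_space \<chi> \<rho> \<Longrightarrow> c *\<^sub>C f \<in> induced_space \<chi> \<rho>"
  "0 \<in> induced_space \<chi> \<rho>"
  "g \<in> aff_units \<Longrightarrow> f \<in> induced_space \<chi> \<rho> \<Longrightarrow> mon g * f \<in> induced_space \<chi> \<rho>"
proof -
  assume "f \<in> induced_space \<chi> \<rho>" "f' \<in> induced_space \<chi> \<rho>"
  then show "f + f' \<in> induced_space \<chi> \<rho>"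
    using Poly_Mapping.keys_add[of f f']
    by (auto simp: induced_space_iff[OF chi rho] distrib_right scaleC_add_right)
next
  assume f: "f \<in> induced_space \<chi> \<rho>"
  have "keys (c *\<^sub>C f) \<subseteq> keys f"
    by (auto simp: in_keys_iff)
  then show "c *\<^sub>C f \<in> induced_space \<chi> \<rho>"
    using f by (auto simp: induced_space_iff[OF chi rho] mult_scaleC_left scaleC_scaleC mult.commute)
next
  show "0 \<in> induced_space \<chi> \<rho>" by (simp add: induced_space_def)
next
  assume "g \<in> aff_units" "f \<in> induced_space \<chi> \<rho>"
  then show "mon g * f \<in> induced_space \<chi> \<rho>"
    using mon_mult_keys[of g f] by (simp add: induced_space_iff[OF chi rho] mult.assoc mult_scaleC_right)
qed

lemma left_module_W_module: "left_module (W_module \<chi> \<rho>)"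
  unfolding W_module_def
  by (rule left_module_linear_extension)
    (auto simp: induced_space_closed distrib_left mult_scaleC_right zero_in_aff_units plus_in_aff_units
      mult.assoc simp flip: mon_mult)

lemma act_W_module_mon:
  "act (W_module \<chi> \<rho>) (mon g) f = (if g \<in> aff_units then mon g * f else 0)"
  by (simp add: W_module_def act_linear_extension)

lemma scal_W_module: "scal (W_module \<chi> \<rho>) c f = c *\<^sub>C f"
  by (simp add: W_module_def scal_linear_extension zero_in_aff_units)

lemma act_W_module_units:
  assumes "keys x \<subseteq> aff_units"
  shows "act (W_module \<chi> \<rho>) x f = x * f"
proof -
  have "act (W_module \<chi> \<rho>) x f = (\<Sum>g\<in>keys x. lookup x g *\<^sub>C (mon g * f))"
    unfolding W_module_def linear_extension_def using assms by (auto intro!: sum.cong)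
  also have "\<dots> = (\<Sum>g\<in>keys x. lookup x g *\<^sub>C mon g) * f"
    by (simp add: sum_distrib_right mult_scaleC_left)
  finally show ?thesis by (simp only: monoid_algebra_expansion)
qed

lemma mult_character_sum:
  assumes "f \<in> induced_space \<chi> \<rho>"
  shows "f * character_sum (stabilizer \<chi>) \<chi> \<rho>
    = of_nat (card (stabilizer \<chi>) * card (UNIV :: 'r set)) *\<^sub>C f"
proof -
  have "f * character_sum (stabilizer \<chi>) \<chi> \<rho>
      = (\<Sum>(a, b)\<in>stabilizer \<chi> \<times> UNIV. inverse (\<chi> b * \<rho> a) *\<^sub>C (f * mon (aff_map a b)))"
    by (simp add: character_sum_def sum_distrib_left mult_scaleC_right case_prod_unfold)
  also have "\<dots> = (\<Sum>(a, b)\<in>stabilizer \<chi> \<times> (UNIV :: 'r set). 1 *\<^sub>C f)"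
  proof (rule sum.cong[OF refl], clarify)
    fix a b assume "a \<in> stabilizer \<chi>"
    then show "inverse (\<chi> b * \<rho> a) *\<^sub>C (f * mon (aff_map a b)) = 1 *\<^sub>C f"
      using assms additive_character_nonzero[OF chi, of b] rho_nonzero[of a]
      by (simp add: induced_space_iff[OF chi rho] scaleC_scaleC del: inverse_mult_distrib)
  qed
  also have "\<dots> = of_nat (card (stabilizer \<chi>) * card (UNIV :: 'r set)) *\<^sub>C f"
    by (simp only: case_prod_unfold complex_module.scale_sum_left[symmetric] sum_constant
        card_cartesian_product mult_1_right)
  finally show ?thesis .
qed

text \<open>An element of the induced space on which the translations act from the left by \<open>\<chi>\<close> is supported
  in the subgroup from which it is induced. Indeed \<open>(x + b) u x = u x (x + u\<^sup>-\<^sup>1 b)\<close>, so its coefficients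
  at this map and at \<open>u x\<close> differ by the factor \<open>\<chi>(b)\<^sup>-\<^sup>1\<close> and also by \<open>\<chi>(u\<^sup>-\<^sup>1 b)\<^sup>-\<^sup>1\<close>. Hence the
  projection to the weight \<open>\<chi>\<close> yields a multiple of the generator.\<close>

lemma weight_sum_mult_induced:
  assumes f: "f \<in> induced_space \<chi> \<rho>"
  shows "weight_sum \<chi> * f
    = (of_nat (card (UNIV :: 'r set)) * lookup f 0) *\<^sub>C character_sum (stabilizer \<chi>) \<chi> \<rho>"
proof (rule poly_mapping_eqI)
  let ?y = "weight_sum \<chi> * f"
  have y: "?y \<in> induced_space \<chi> \<rho>"
  proof -
    have "keys (weight_sum \<chi>) \<subseteq> aff_units" by (rule keys_character_sum) auto
    then have "?y = act (W_module \<chi> \<rho>) (weight_sum \<chi>) f" by (simp add: act_W_module_units)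
    also have "\<dots> \<in> mcarrier (W_module \<chi> \<rho>)"
      by (rule left_module.act_mem[OF left_module_W_module]) (simp add: f)
    finally show ?thesis by simp
  qed
  have inv: "aff_map 1 b + aff_map 1 (- b) = 0" "aff_map 1 (- b) + aff_map 1 b = 0" for b :: 'r
    by (simp_all add: aff_map_plus zero_eq_aff_map)
  have left: "lookup ?y (aff_map u b) = inverse (\<chi> b) * lookup ?y (aff_map u 0)" for u b
  proof -
    have "mon (aff_map 1 b) * ?y = \<chi> b *\<^sub>C ?y"
      by (simp add: translation_weight_sum[OF chi] mult_scaleC_left flip: mult.assoc)
    then have "lookup (mon (aff_map 1 b) * ?y) (aff_map u b) = \<chi> b * lookup ?y (aff_map u b)"
      by simp
    then show ?thesis
      using additive_character_nonzero[OF chi, of b]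
      by (simp add: lookup_mon_mult[OF inv] aff_map_plus field_simps)
  qed
  have right: "lookup ?y (g + aff_map a b) = inverse (\<chi> b * \<rho> a) * lookup ?y g"
    if "g \<in> aff_units" "a \<in> stabilizer \<chi>" for g a b
    using y that by (simp add: induced_space_def)
  have y0: "lookup ?y (aff_map 1 0) = of_nat (card (UNIV :: 'r set)) * lookup f 0"
  proof -
    have "lookup ?y (aff_map 1 0) = (\<Sum>b\<in>UNIV. inverse (\<chi> b) * lookup (mon (aff_map 1 b) * f) 0)"
      by (simp add: weight_sum_eq sum_distrib_right mult_scaleC_left lookup_sum zero_eq_aff_map)
    also have "\<dots> = (\<Sum>b\<in>(UNIV :: 'r set). lookup f 0)"
    proof (rule sum.cong[OF refl])
      fix b :: 'r
      have "lookup (mon (aff_map 1 b) * f) 0 = lookup f (0 + aff_map 1 (- b))"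
        by (simp add: lookup_mon_mult[OF inv])
      also have "\<dots> = inverse (\<chi> (- b) * \<rho> 1) * lookup f 0"
        using f one_mem zero_in_aff_units by (simp only: induced_space_def mem_Collect_eq) blast
      finally show "inverse (\<chi> b) * lookup (mon (aff_map 1 b) * f) 0 = lookup f 0"
        using additive_character_nonzero[OF chi, of b]
        by (simp add: additive_character_minus[OF chi] rho_one)
    qed
    finally show ?thesis by simp
  qed
  fix g :: "'r aff"
  obtain u b where g: "g = aff_map u b" by (cases g)
  consider "u \<in> stabilizer \<chi>" | "\<not> u dvd 1" | "u dvd 1" "u \<notin> stabilizer \<chi>" by blast
  then show "lookup ?y g = lookup ((of_nat (card (UNIV :: 'r set)) * lookup f 0) *\<^sub>C character_sum (stabilizer \<chi>) \<chi> \<rho>) g"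
  proof cases
    case 1
    then show ?thesis
      using right[of "aff_map 1 0" u b]
      by (simp add: g aff_map_plus aff_map_in_units y0 lookup_character_sum mult.commute)
  next
    case 2
    then have "lookup ?y g = 0"
      using y by (auto simp: induced_space_iff[OF chi rho] g in_keys_iff aff_map_in_units subset_iff)
    then show ?thesis using 2 by (simp add: g lookup_character_sum stabilizer_iff)
  next
    case 3
    have "lookup ?y (aff_map u 0) = 0"
    proof (rule ccontr)
      assume nz: "lookup ?y (aff_map u 0) \<noteq> 0"
      have "\<chi> (u * a) = \<chi> a" for a
      proof -
        have "aff_map u 0 + aff_map 1 a = aff_map u (u * a)" by (simp add: aff_map_plus)
        then have "inverse (\<chi> (u * a)) = inverse (\<chi> a)"
          using right[of "aff_map u 0" 1 a] left[of u "u * a"] 3 one_mem nz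
          by (simp add: aff_map_in_units rho_one)
        then show ?thesis by simp
      qed
      then show False using 3 by (simp add: stabilizer_iff)
    qed
    then show ?thesis using left[of u b] 3 by (simp add: g lookup_character_sum)
  qed
qed

text \<open>Every nonzero submodule contains the generator, by projecting a suitable translate of one of its
  elements to the weight \<open>\<chi>\<close>; and the generator generates, because multiplying it by an element of the
  induced space gives back a multiple of that element.\<close>

lemma simple_W_module: "simple_module (W_module \<chi> \<rho>)"
  unfolding simple_module_def
proof (intro conjI allI impI)
  let ?W = "W_module \<chi> \<rho>" and ?f0 = "character_sum (stabilizer \<chi>) \<chi> \<rho>"
  show "mcarrier ?W \<noteq> {0}"
    using character_sum_in_induced_space character_sum_nonzero by auto
  fix N assume N: "submodule N ?W"
  show "N = {0} \<or> N = mcarrier ?W"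
  proof (cases "N = {0}")
    case False
    then obtain f where f: "f \<in> N" "f \<noteq> 0" using N by (auto simp: submodule_def)
    have act: "act ?W x f' \<in> N" if "f' \<in> N" for x f'
      using N that by (simp add: submodule_def)
    have NW: "f' \<in> induced_space \<chi> \<rho>" if "f' \<in> N" for f'
      using N that by (auto simp: submodule_def)
    obtain g where g: "lookup f g \<noteq> 0"
      using f(2) by (metis poly_mapping_eqI lookup_zero)
    then have gu: "g \<in> aff_units"
      using NW[OF f(1)] by (auto simp: induced_space_def in_keys_iff)
    then obtain h where h: "h \<in> aff_units" "h + g = 0" "g + h = 0"
      using aff_units_inverse[OF gu] by blast
    have hf: "mon h * f \<in> N"
      using act[OF f(1), of "mon h"] h(1) by (simp add: act_W_module_mon)
    have "lookup (mon h * f) 0 = lookup f g"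
      by (simp add: lookup_mon_mult[OF h(2,3)])
    moreover have "weight_sum \<chi> * (mon h * f) \<in> N"
      using act[OF hf, of "weight_sum \<chi>"] act_W_module_units[of "weight_sum \<chi>" "mon h * f"]
        keys_character_sum[of "{1}" \<chi> "\<lambda>_. 1"] by simp
    ultimately have "(of_nat (card (UNIV :: 'r set)) * lookup f g) *\<^sub>C ?f0 \<in> N"
      by (simp add: weight_sum_mult_induced[OF NW[OF hf]])
    from act[OF this, of "inverse (of_nat (card (UNIV :: 'r set)) * lookup f g) *\<^sub>C 1"]
    have f0: "?f0 \<in> N"
      using g by (simp add: scal_W_module scaleC_scaleC del: inverse_mult_distrib)
    have "f' \<in> N" if f': "f' \<in> induced_space \<chi> \<rho>" for f'
    proof -
      let ?m = "of_nat (card (stabilizer \<chi>) * card (UNIV :: 'r set)) :: complex"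
      have "?m \<noteq> 0" using card_U_pos by (metis less_irrefl of_nat_eq_0_iff)
      have "act ?W f' ?f0 = ?m *\<^sub>C f'"
        using f' by (subst act_W_module_units) (auto simp: induced_space_def mult_character_sum)
      then have "scal ?W (inverse ?m) (act ?W f' ?f0) = f'"
        using \<open>?m \<noteq> 0\<close> by (simp add: scal_W_module scaleC_scaleC del: of_nat_mult inverse_mult_distrib)
      then show ?thesis using act[OF act[OF f0]] by metis
    qed
    then show ?thesis using NW by auto
  qed simp
qed (rule left_module_W_module)

lemma weight_module_W_module:
  "weight_module (W_module \<chi> \<rho>) \<chi> \<rho> (character_sum (stabilizer \<chi>) \<chi> \<rho>)"
proof -
  interpret algebra_module "W_module \<chi> \<rho>"
    using left_module_W_module by (simp add: algebra_module_def)
  show ?thesis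
    by unfold_locales
      (auto simp: simple_W_module chi rho character_sum_in_induced_space character_sum_nonzero
        act_W_module_mon mon_mult_character_sum scal_W_module aff_map_in_units stabilizer_iff)
qed

end

context weight_module
begin

text \<open>The elements of the induced space lie in the algebra, so they can be applied to \<open>v\<close>. The singular
  maps act as zero on both sides.\<close>

lemma module_hom_from_W_module: "module_hom (W_module \<chi> \<rho>) S (\<lambda>f. act S f v)"
  unfolding module_hom_def
proof (intro conjI ballI allI)
  fix a f assume "f \<in> mcarrier (W_module \<chi> \<rho>)"
  show "act S (act (W_module \<chi> \<rho>) a f) v = act S a (act S f v)"
  proof (induction a rule: monoid_algebra_induct)
    case zero
    then show ?case by (simp add: W_module_def act_linear_extension act_zero_left v_mem act_mem)
  next
    case (add g c x)
    have "act S (act (W_module \<chi> \<rho>) (c *\<^sub>C mon g) f) v = act S (c *\<^sub>C mon g) (act S f v)"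
    proof (cases "g \<in> aff_units")
      case True
      then have "act (W_module \<chi> \<rho>) (c *\<^sub>C mon g) f = (c *\<^sub>C mon g) * f"
        by (simp add: W_module_def act_linear_extension mult_scaleC_left)
      then show ?thesis by (simp add: act_mult v_mem)
    next
      case False
      then have "act (W_module \<chi> \<rho>) (c *\<^sub>C mon g) f = 0"
        by (simp add: W_module_def act_linear_extension)
      moreover have "act S (c *\<^sub>C mon g) (act S f v) = scal S c (act S (mon g) (act S f v))"
        by (rule act_scaleC) (simp add: act_mem v_mem)
      ultimately show ?thesis
        by (simp add: singular[OF False] act_mem v_mem act_zero_left)
    qed
    then show ?case
      using add by (simp add: W_module_def act_linear_extension_add act_add_left v_mem act_mem)
  qed
qed (simp_all add: v_mem act_mem act_add_left)

lemma act_character_sum_v: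
  "act S (character_sum (stabilizer \<chi>) \<chi> \<rho>) v = scal S (of_nat (card (stabilizer \<chi>) * card (UNIV :: 'r set))) v"
  by (rule chr.act_character_sum[OF left_module_axioms v_mem weight])

lemma act_character_sum_v_nonzero: "act S (character_sum (stabilizer \<chi>) \<chi> \<rho>) v \<noteq> 0"
  unfolding act_character_sum_v
  using chr.card_U_pos v_nonzero by (metis less_irrefl of_nat_eq_0_iff scal_eq_0_iff[OF v_mem])

lemma isomorphic_W_module: "S \<cong>\<^sub>m W_module \<chi> \<rho>"
proof -
  have "W_module \<chi> \<rho> \<cong>\<^sub>m S"
    by (rule simple_module_isoI[OF simple_W_module[OF additive_chi unit_rho] simple module_hom_from_W_module,
          where s = "character_sum (stabilizer \<chi>) \<chi> \<rho>"])
      (simp_all add: character_sum_in_induced_space[OF additive_chi unit_rho] act_character_sum_v_nonzero)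
  then show ?thesis
    by (rule isomorphic_sym[OF left_module_W_module[OF additive_chi unit_rho] left_module_axioms])
qed

lemma induced_space_annihilator:
  assumes "f \<in> induced_space \<chi> \<rho>" "act S f v = 0"
  shows "f = 0"
  by (rule simple_module_kernel[OF simple_W_module[OF additive_chi unit_rho] left_module_axioms
        module_hom_from_W_module _ act_character_sum_v_nonzero])
    (simp_all add: assms character_sum_in_induced_space[OF additive_chi unit_rho])

lemma not_trivial: "\<not> (\<forall>g. \<forall>s\<in>mcarrier S. act S (mon g) s = s)"
  using singular[of "aff_map 0 0" v] v_mem v_nonzero aff_map_in_units[of 0 0]
  by (metis dvd_0_left_iff zero_neq_one act_zero_left scal_zero aff_map_in_units act_mem)

end

lemma weight_module_of_isomorphic:
  fixes S :: "('r::{finite, comm_ring_1} aff_algebra, 'v::ab_group_add) left_mod"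
  assumes S: "simple_module S" and iso: "S \<cong>\<^sub>m W_module \<chi> \<rho>"
    and chi: "additive_character \<chi>" and rho: "unit_character (stabilizer \<chi>) \<rho>"
  shows "\<exists>v. weight_module S \<chi> \<rho> v"
proof -
  interpret W: weight_module "W_module \<chi> \<rho>" \<chi> \<rho> "character_sum (stabilizer \<chi>) \<chi> \<rho>"
    by (rule weight_module_W_module[OF chi rho])
  interpret algebra_module S
    using simple_module_left_module[OF S] by (simp add: algebra_module_def)
  obtain f where f: "module_hom (W_module \<chi> \<rho>) S f" "bij_betw f (mcarrier (W_module \<chi> \<rho>)) (mcarrier S)"
    using isomorphic_sym[OF left_module_axioms W.left_module_axioms iso]
    by (auto simp: isomorphic_iff[OF W.left_module_axioms])
  have f0: "f 0 = 0" by (rule module_hom_zero[OF f(1) W.left_module_axioms])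
  let ?v = "f (character_sum (stabilizer \<chi>) \<chi> \<rho>)"
  have "weight_module S \<chi> \<rho> ?v"
  proof
    fix g :: "'r aff" and s assume g: "g \<notin> aff_units" and "s \<in> mcarrier S"
    then obtain w where w: "w \<in> mcarrier (W_module \<chi> \<rho>)" "s = f w"
      using f(2) by (auto simp: bij_betw_def)
    then show "act S (mon g) s = 0"
      using module_hom_act[OF f(1) w(1), of "mon g"] W.singular[OF g w(1)] f0 by simp
  next
    show "?v \<noteq> 0"
    proof
      assume "?v = 0"
      then have "character_sum (stabilizer \<chi>) \<chi> \<rho> = 0"
        using f(2) f0 W.v_mem W.zero_mem by (metis bij_betw_def inj_onD)
      then show False using W.v_nonzero by simp
    qed
  next
    fix a b assume "a \<in> stabilizer \<chi>"
    then show "act S (mon (aff_map a b)) ?v = scal S (\<chi> b * \<rho> a) ?v"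
      by (simp only: module_hom_act[OF f(1) W.v_mem, symmetric] W.weight)
  qed (simp_all only: S chi rho module_hom_mem[OF f(1) W.v_mem])
  then show ?thesis by blast
qed


section \<open>Weights of the translations\<close>

context algebra_module
begin

lemma submodule_subspaceI:
  assumes "subspace N" "\<And>a x. x \<in> N \<Longrightarrow> act M a x \<in> N"
  shows "submodule N M"
  using assms by (auto simp: submodule_def subspace_def)

end

locale aff_module = algebra_module M
  for M :: "('r::{finite, comm_ring_1} aff_algebra, 'v::ab_group_add) left_mod"
begin

abbreviation opr :: "'r \<Rightarrow> 'r \<Rightarrow> 'v \<Rightarrow> 'v" where
  "opr a b x \<equiv> act M (mon (aff_map a b)) x"

lemma opr_opr: "x \<in> mcarrier M \<Longrightarrow> opr a b (opr c d x) = opr (a * c) (a * d + b) x"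
  by (simp add: mon_mult aff_map_plus flip: act_mult)

lemma opr_one [simp]: "x \<in> mcarrier M \<Longrightarrow> opr 1 0 x = x"
  by (simp add: act_one flip: zero_eq_aff_map)

lemma opr_decompose: "x \<in> mcarrier M \<Longrightarrow> opr a b x = opr 1 b (opr a 0 x)"
  by (simp add: opr_opr)

lemma opr_translation_dilation:
  assumes "x \<in> mcarrier M" "a * a' = 1"
  shows "opr 1 b (opr a 0 x) = opr a 0 (opr 1 (a' * b) x)"
  using assms by (simp add: opr_opr flip: mult.assoc)

lemma submodule_monI:
  assumes V: "subspace N" and N: "\<And>a b x. x \<in> N \<Longrightarrow> opr a b x \<in> N"
  shows "submodule N M"
proof (rule submodule_subspaceI[OF V])
  fix y x assume x: "x \<in> N"
  then have xM: "x \<in> mcarrier M" using V by (auto simp: subspace_def)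
  show "act M y x \<in> N"
  proof (induction y rule: monoid_algebra_induct)
    case zero
    then show ?case using V xM by (simp add: subspace_def act_zero_left)
  next
    case (add g c y)
    have "act M (mon g) x \<in> N" using N[OF x] by (cases g) simp
    then have "act M (c *\<^sub>C mon g) x \<in> N"
      using V by (simp add: act_scaleC[OF xM] subspace_def)
    then show ?case using add V by (simp add: act_add_left xM subspace_def)
  qed
qed

definition has_weight :: "('r \<Rightarrow> complex) \<Rightarrow> 'v \<Rightarrow> bool" where
  "has_weight \<chi> x \<longleftrightarrow> x \<in> mcarrier M \<and> (\<forall>b. opr 1 b x = scal M (\<chi> b) x)"

lemma act_weight_sum_same:
  assumes "additive_character \<chi>" "has_weight \<chi> x"
  shows "act M (weight_sum \<chi>) x = scal M (of_nat (card (UNIV :: 'r set))) x"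
  using semicharacter.act_character_sum[OF semicharacter_trivial[OF assms(1)] left_module_axioms, of x] assms(2)
  by (simp add: has_weight_def)

lemma has_weight_act_weight_sum:
  assumes "additive_character \<chi>" "x \<in> mcarrier M"
  shows "has_weight \<chi> (act M (weight_sum \<chi>) x)"
  unfolding has_weight_def
  by (auto simp: assms act_mem act_mult[symmetric] translation_weight_sum[OF assms(1)]
      mult_scaleC_left)

text \<open>Absorbing a translation into the sum multiplies by \<open>\<chi>(b)\<close>, and applying it to the vector
  multiplies by \<open>\<psi>(b)\<close>.\<close>

lemma act_weight_sum_other:
  assumes "additive_character \<chi>" "has_weight \<psi> x" "\<psi> \<noteq> \<chi>"
  shows "act M (weight_sum \<chi>) x = 0"
proof -
  obtain b where b: "\<psi> b \<noteq> \<chi> b" using assms(3) by (auto simp: fun_eq_iff)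
  have x: "x \<in> mcarrier M" using assms(2) by (simp add: has_weight_def)
  let ?y = "act M (weight_sum \<chi>) x"
  have "scal M (\<psi> b) ?y = act M (weight_sum \<chi>) (opr 1 b x)"
    using assms(2) scal_act[OF x, of "weight_sum \<chi>" "\<psi> b"] by (simp add: has_weight_def)
  also have "\<dots> = scal M (\<chi> b) ?y"
    by (simp only: act_mult[OF x, symmetric] translation_weight_sum[OF assms(1)] mult_scaleC_left mult_1)
  finally show ?thesis
    using scal_cancel[of ?y "\<psi> b" "\<chi> b"] b x by (auto simp: act_mem)
qed

lemma act_weight_sum_dilation:
  assumes "x \<in> mcarrier M" "u dvd 1"
  shows "act M (weight_sum \<chi>) (opr u 0 x) = opr u 0 (act M (weight_sum (\<lambda>b. \<chi> (u * b))) x)"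
proof -
  obtain u' where u: "u * u' = 1" using assms(2) by (auto elim: dvdE)
  have "(\<lambda>b. \<chi> (u * (u' * b))) = \<chi>" using u by (simp add: fun_eq_iff flip: mult.assoc)
  then have "mon (aff_map u 0) * weight_sum (\<lambda>b. \<chi> (u * b)) = weight_sum \<chi> * mon (aff_map u 0)"
    using dilation_weight_sum[OF u, of "\<lambda>b. \<chi> (u * b)"] by simp
  then show ?thesis by (simp add: assms flip: act_mult)
qed

lemma translation_eigenvector_character:
  assumes x: "x \<in> mcarrier M" "x \<noteq> 0" and ev: "\<And>b. \<exists>c. opr 1 b x = scal M c x"
  obtains \<chi> where "additive_character \<chi>" "has_weight \<chi> x"
proof -
  obtain \<chi> where \<chi>: "\<And>b. opr 1 b x = scal M (\<chi> b) x" using ev by metis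
  have add: "\<chi> (a + b) = \<chi> a * \<chi> b" for a b
  proof -
    have "scal M (\<chi> (a + b)) x = opr 1 b (opr 1 a x)"
      by (simp add: opr_opr x flip: \<chi>)
    also have "\<dots> = scal M (\<chi> a) (scal M (\<chi> b) x)"
      using scal_act[OF x(1), of "mon (aff_map 1 b)" "\<chi> a"] by (simp add: \<chi>)
    finally show ?thesis using x scal_cancel by (simp add: scal_scal)
  qed
  have "\<chi> 0 = 1"
    using x \<chi>[of 0] scal_cancel[of x "\<chi> 0" 1] by (simp add: act_one)
  then have "\<chi> a \<noteq> 0" for a
    using add[of a "- a"] by auto
  then have "additive_character \<chi>" using add by (simp add: additive_character_def)
  then show thesis using that x(1) \<chi> by (simp add: has_weight_def)
qed

text \<open>An eigenvector of the translations can be found among the images of the given vector under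
  elements that commute with the translations. Such elements commute with the sum over the character of
  this eigenvector as well, so the sum cannot annihilate the given vector.\<close>

lemma weight_component_nonzero:
  assumes t: "t \<in> mcarrier M" "t \<noteq> 0"
  obtains \<chi> where "additive_character \<chi>" "act M (weight_sum \<chi>) t \<noteq> 0"
proof -
  let ?T = "\<lambda>b. mon (aff_map 1 b) :: 'r aff_algebra"
  let ?C = "{y. \<forall>b. y * ?T b = ?T b * y}"
  let ?V = "(\<lambda>y. act M y t) ` ?C"
  have V: "subspace ?V"
    unfolding subspace_def
  proof (intro conjI ballI allI)
    show "0 \<in> ?V"
      by (rule image_eqI[of _ _ 0]) (simp_all add: act_zero_left t)
    fix x y assume "x \<in> ?V" "y \<in> ?V"
    then show "x + y \<in> ?V"
      by (auto simp: distrib_left distrib_right t simp flip: act_add_left)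
  next
    fix c x assume "x \<in> ?V"
    then obtain y where y: "y \<in> ?C" "x = act M y t" by blast
    show "scal M c x \<in> ?V"
      by (rule image_eqI[of _ _ "c *\<^sub>C y"])
        (use y in \<open>simp_all add: act_scaleC[OF t(1)] mult_scaleC_left mult_scaleC_right\<close>)
  qed (use t in \<open>auto simp: act_mem\<close>)
  have tV: "t \<in> ?V"
    by (rule image_eqI[of _ _ 1]) (simp_all add: act_one t)
  have comm: "?T a * ?T b = ?T b * ?T a" for a b
    by (simp add: mon_mult aff_map_plus add.commute)
  have "\<exists>w\<in>?V. w \<noteq> 0 \<and> (\<forall>g\<in>range ?T. \<exists>c. act M g w = scal M c w)"
  proof (rule common_eigenvector[OF _ _ _ V _ tV t(2)])
    show "finite (range ?T)" by simp
    show "\<And>g. g \<in> range ?T \<Longrightarrow> \<exists>k>0. g ^ k = 1"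
      by (auto simp: aff_map_in_units intro!: mon_finite_order)
    show "\<And>g h. g \<in> range ?T \<Longrightarrow> h \<in> range ?T \<Longrightarrow> g * h = h * g"
      using comm by auto
    fix g x assume "g \<in> range ?T" "x \<in> ?V"
    then obtain a y where ay: "g = ?T a" "y \<in> ?C" "x = act M y t" by blast
    show "act M g x \<in> ?V"
    proof (rule image_eqI)
      show "act M g x = act M (g * y) t" using ay t by (simp add: act_mult)
      show "g * y \<in> ?C"
      proof (intro CollectI allI)
        fix b
        have "y * ?T b = ?T b * y" using ay(2) by blast
        then have "g * y * ?T b = ?T a * (?T b * y)" by (simp only: ay(1) mult.assoc)
        also have "\<dots> = ?T b * (g * y)"
          by (simp only: ay(1) mult.assoc[symmetric] comm[of a b])
        finally show "g * y * ?T b = ?T b * (g * y)" .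
      qed
    qed
  qed
  then obtain y where y: "y \<in> ?C" "act M y t \<noteq> 0" "\<And>b. \<exists>c. opr 1 b (act M y t) = scal M c (act M y t)"
    by auto
  then obtain \<chi> where \<chi>: "additive_character \<chi>" "has_weight \<chi> (act M y t)"
    using translation_eigenvector_character[of "act M y t"] t by (metis act_mem)
  have "weight_sum \<chi> * y = y * weight_sum \<chi>"
    using y(1) by (simp add: weight_sum_eq sum_distrib_left sum_distrib_right mult_scaleC_left mult_scaleC_right)
  then have "act M y (act M (weight_sum \<chi>) t) = act M (weight_sum \<chi>) (act M y t)"
    by (simp add: t flip: act_mult)
  also have "\<dots> \<noteq> 0"
    using y(2) t by (simp add: act_weight_sum_same[OF \<chi>] scal_eq_0_iff act_mem)
  finally show thesis using that[OF \<chi>(1)] by (metis act_zero_right)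
qed

end

sublocale weight_module \<subseteq> aff_module S ..

context weight_module
begin

lemma v_weight: "has_weight \<chi> v"
  using weight[OF chr.one_mem] v_mem by (simp add: has_weight_def chr.rho_one)

lemma v_stabilizer: "a \<in> stabilizer \<chi> \<Longrightarrow> opr a 0 v = scal S (\<rho> a) v"
  by (simp add: weight additive_character_0[OF additive_chi])

lemma act_weight_sum_unit_v:
  assumes "u dvd 1" "additive_character \<psi>"
  shows "act S (weight_sum \<psi>) (opr u b v) = (if (\<lambda>b. \<psi> (u * b)) = \<chi>
    then scal S (of_nat (card (UNIV :: 'r set)) * \<psi> b) (opr u 0 v) else 0)"
proof -
  let ?E = "act S (weight_sum \<psi>)"
  have u: "opr u 0 v \<in> mcarrier S" by (simp add: act_mem v_mem)
  have "?E (opr u b v) = ?E (opr 1 b (opr u 0 v))" by (simp add: opr_decompose[of v u b] v_mem)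
  also have "\<dots> = scal S (\<psi> b) (?E (opr u 0 v))"
    by (simp only: act_mult[OF u, symmetric] translation_weight_sum[OF assms(2)] mult_scaleC_left mult_1)
  also have "?E (opr u 0 v) = opr u 0 (act S (weight_sum (\<lambda>b. \<psi> (u * b))) v)"
    by (rule act_weight_sum_dilation[OF v_mem assms(1)])
  finally have eq: "?E (opr u b v) = scal S (\<psi> b) (opr u 0 (act S (weight_sum (\<lambda>b. \<psi> (u * b))) v))" .
  show ?thesis
  proof (cases "(\<lambda>b. \<psi> (u * b)) = \<chi>")
    case True
    have "opr u 0 (scal S (of_nat (card (UNIV :: 'r set))) v)
        = scal S (of_nat (card (UNIV :: 'r set))) (opr u 0 v)"
      by (rule scal_act[OF v_mem])
    then show ?thesis
      using True by (simp add: eq act_weight_sum_same[OF additive_chi v_weight] scal_scal u mult.commute)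
  next
    case False
    then have "act S (weight_sum (\<lambda>b. \<psi> (u * b))) v = 0"
      using act_weight_sum_other[OF additive_character_mult[OF assms(2)] v_weight] by metis
    then show ?thesis using False by (simp add: eq)
  qed
qed

text \<open>The images of \<open>v\<close> under the units span the module, so that linear conditions on the values of an
  element of the algebra need only be checked there.\<close>

lemma act_unit_span_cases:
  assumes s: "s \<in> mcarrier S" and P: "P 0" "\<And>x y. P x \<Longrightarrow> P y \<Longrightarrow> P (x + y)" "\<And>c x. x \<in> mcarrier S \<Longrightarrow> P x \<Longrightarrow> P (scal S c x)"
    and unit: "\<And>u b. u dvd 1 \<Longrightarrow> P (act S x (opr u b v))"
  shows "P (act S x s)"
proof -
  obtain y where y: "act S y v = s" using simple_module_cyclic[OF simple v_mem v_nonzero s] by blast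
  have "P (act S x (act S y v))"
  proof (induction y rule: monoid_algebra_induct)
    case zero
    then show ?case using P(1) by (simp add: act_zero_left v_mem)
  next
    case (add g c y)
    obtain u b where g: "g = aff_map u b" by (cases g)
    have "P (act S x (opr u b v))"
      using unit[of u b] singular[of g v] P(1) by (cases "u dvd 1") (simp_all add: g aff_map_in_units v_mem)
    moreover have "act S x (act S (c *\<^sub>C mon g) v) = scal S c (act S x (opr u b v))"
      using scal_act[of "opr u b v" x c] by (simp add: g act_scaleC[OF v_mem] act_mem v_mem)
    ultimately have "P (act S x (act S (c *\<^sub>C mon g) v))"
      using P(3) by (simp add: act_mem v_mem)
    then show ?case
      using P(2) add by (simp add: act_add_left act_add_right v_mem act_mem)
  qed
  then show ?thesis by (simp add: y)
qed

text \<open>A unit \<open>u x + b\<close> moves \<open>v\<close> out of the weight space unless \<open>u\<close> stabilizes \<open>\<chi>\<close>, and then it only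
  multiplies \<open>v\<close> by a number.\<close>

lemma weight_space_one_dimensional:
  assumes "s \<in> mcarrier S"
  shows "\<exists>c. act S (weight_sum \<chi>) s = scal S c v"
proof (rule act_unit_span_cases[OF assms])
  show "\<exists>c. 0 = scal S c v" by (rule exI[of _ 0]) (simp add: act_zero_left v_mem)
  show "\<exists>c. x + y = scal S c v" if "\<exists>c. x = scal S c v" "\<exists>c. y = scal S c v" for x y
    using that by (metis scal_add_left v_mem)
  show "\<exists>d. scal S c x = scal S d v" if "\<exists>c. x = scal S c v" for c x
    using that by (metis scal_scal v_mem)
  fix u b :: 'r assume u: "u dvd 1"
  show "\<exists>c. act S (weight_sum \<chi>) (opr u b v) = scal S c v"
  proof (cases "(\<lambda>b. \<chi> (u * b)) = \<chi>")
    case True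
    then have "u \<in> stabilizer \<chi>" using u by (simp add: stabilizer_iff fun_eq_iff)
    then show ?thesis
      using True by (auto simp: act_weight_sum_unit_v[OF u additive_chi] v_stabilizer scal_scal v_mem)
  next
    case False
    then show ?thesis
      by (auto simp: act_weight_sum_unit_v[OF u additive_chi] act_zero_left v_mem intro!: exI[of _ 0])
  qed
qed

lemma weight_in_orbit:
  assumes "s \<in> mcarrier S" "additive_character \<psi>" "act S (weight_sum \<psi>) s \<noteq> 0"
  obtains u where "u dvd 1" "\<And>b. \<psi> (u * b) = \<chi> b"
proof -
  have "\<exists>u. u dvd 1 \<and> (\<lambda>b. \<psi> (u * b)) = \<chi>"
  proof (rule ccontr)
    assume *: "\<not> ?thesis"
    have "act S (weight_sum \<psi>) s = 0"
      by (rule act_unit_span_cases[OF assms(1)])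
        (use * in \<open>auto simp: act_weight_sum_unit_v[OF _ assms(2)]\<close>)
    then show False using assms(3) by simp
  qed
  then show thesis using that by (auto simp: fun_eq_iff)
qed

end


section \<open>Classification of the simple modules\<close>

text \<open>The properties of a finite local principal ideal ring with maximal ideal \<open>(p)\<close> and nilpotency index
  \<open>n\<close> on which the proof rests. The last one determines the annihilator of \<open>p\<close> as \<open>(p\<^sup>n\<^sup>-\<^sup>1)\<close>.\<close>

locale chain_ring =
  fixes p :: "'r::{finite, comm_ring_1}" and n :: nat
  assumes n_ge_2: "2 \<le> n" and p_power: "p ^ n = 0"
    and nonunit_dvd: "\<not> x dvd 1 \<Longrightarrow> p dvd x" and p_nonunit: "\<not> p dvd 1"
    and annihilator: "p * a = 0 \<Longrightarrow> p ^ (n - 1) dvd a"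
begin

lemma nonunit_iff: "\<not> x dvd 1 \<longleftrightarrow> p dvd x"
  using nonunit_dvd p_nonunit dvd_trans by blast

lemma one_plus_unit: "1 + p ^ (n - 1) * c dvd 1"
proof (rule ccontr)
  assume "\<not> ?thesis"
  then have "p dvd 1 + p ^ (n - 1) * c" by (rule nonunit_dvd)
  moreover have "p dvd p ^ (n - 1) * c"
    using n_ge_2 by (intro dvd_mult2 dvd_power) simp
  ultimately show False using p_nonunit by (metis dvd_add_left_iff)
qed

lemma p_mult_power: "p * p ^ (n - 1) = 0"
  using n_ge_2 p_power by (metis Suc_diff_1 power_Suc less_le_trans pos2)

end

context aff_module
begin

text \<open>Composing the constant map \<open>0\<close> with any map on the right gives it back, so that the vectors which
  it annihilates form a submodule; if this is not everything, it is zero.\<close>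

lemma trivial_action:
  assumes S: "simple_module M" and s: "s \<in> mcarrier M" "opr 0 0 s \<noteq> 0" and x: "x \<in> mcarrier M"
  shows "opr a b x = x"
proof -
  let ?N = "{x \<in> mcarrier M. opr 0 0 x = 0}"
  have "submodule ?N M"
  proof (rule submodule_monI)
    show "subspace ?N"
      by (auto simp: subspace_def zero_mem add_mem act_mem act_add_right scal_act[of _ "mon (aff_map 0 0)"])
  qed (auto simp: opr_opr act_mem)
  then have N: "?N = {0}"
    using S s by (auto simp: simple_module_def)
  have e: "opr 0 0 y = y" if "y \<in> mcarrier M" for y
  proof -
    have "opr 0 0 y - y \<in> ?N"
      using that by (simp add: diff_mem act_mem act_diff_right opr_opr)
    then show ?thesis using N by auto
  qed
  have "opr a b x = opr 0 0 (opr a b x)" using e x by (simp add: act_mem)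
  also have "\<dots> = x" using e x by (simp add: opr_opr)
  finally show ?thesis .
qed

text \<open>Otherwise the maps \<open>p\<^sup>j c x + b\<close> act as zero for \<open>j = n\<close>, hence for \<open>j = n - 1\<close>, and so on down
  to \<open>j = 1\<close>. Their common kernel is a submodule, and it contains their images: the composite of two of
  them has a slope divisible by \<open>p\<^sup>2\<^sup>j\<close>, and \<open>2 j \<ge> j + 1\<close>. Whether the kernel is zero or everything, the
  images vanish.\<close>

lemma singular_action:
  assumes S: "simple_module M" and R: "chain_ring (p :: 'r) n"
    and z: "\<And>s. s \<in> mcarrier M \<Longrightarrow> opr 0 0 s = 0"
    and s: "s \<in> mcarrier M" and a: "\<not> a dvd 1"
  shows "opr a b s = 0"
proof -
  interpret chain_ring p n by (rule R)
  have "\<forall>c b. \<forall>s\<in>mcarrier M. opr (p ^ 1 * c) b s = 0"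
  proof (rule inc_induct[of 1 n])
    show "\<forall>c b. \<forall>s\<in>mcarrier M. opr (p ^ n * c) b s = 0"
    proof (intro allI ballI)
      fix c b s assume s: "s \<in> mcarrier M"
      then show "opr (p ^ n * c) b s = 0"
        using opr_decompose[OF s, of 0 b] z[OF s] by (simp add: p_power)
    qed
    fix j assume j: "1 \<le> j" and IH: "\<forall>c b. \<forall>s\<in>mcarrier M. opr (p ^ Suc j * c) b s = 0"
    let ?N = "{s \<in> mcarrier M. \<forall>c b. opr (p ^ j * c) b s = 0}"
    have "submodule ?N M"
    proof (rule submodule_monI)
      show "subspace ?N"
        by (auto simp: subspace_def zero_mem add_mem act_mem act_add_right
            scal_act[of _ "mon (aff_map (p ^ j * c) b)" for c b])
    qed (auto simp: opr_opr act_mem mult.assoc)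
    moreover have im: "opr (p ^ j * c) b s \<in> ?N" if s: "s \<in> mcarrier M" for c b s
    proof -
      have "p ^ j * c' * (p ^ j * c) = p ^ Suc j * (p ^ (j - 1) * c' * c)" for c'
        using j by (cases j) (simp_all add: ac_simps)
      then show ?thesis using s IH by (simp add: opr_opr act_mem)
    qed
    ultimately show "\<forall>c b. \<forall>s\<in>mcarrier M. opr (p ^ j * c) b s = 0"
      using S unfolding simple_module_def by (metis (mono_tags, lifting) mem_Collect_eq singletonD)
  qed (use n_ge_2 in simp)
  moreover obtain c where "a = p * c" using nonunit_dvd[OF a] by (auto elim: dvdE)
  ultimately show ?thesis using s by simp
qed

text \<open>First the translations are diagonalised, and then the stabilizer of the weight that was found,
  within its weight space.\<close>

lemma weight_module_exists:
  assumes S: "simple_module M" and sing: "\<And>a b s. \<not> a dvd 1 \<Longrightarrow> s \<in> mcarrier M \<Longrightarrow> opr a b s = 0"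
  obtains \<chi> \<rho> v where "weight_module M \<chi> \<rho> v"
proof -
  obtain x where x: "x \<in> mcarrier M" "x \<noteq> 0" using simple_module_obtain[OF S] by blast
  obtain \<chi> where \<chi>: "additive_character \<chi>" "act M (weight_sum \<chi>) x \<noteq> 0"
    using weight_component_nonzero[OF x] by blast
  let ?V = "{x. has_weight \<chi> x}"
  have V: "subspace ?V"
    by (auto simp: subspace_def has_weight_def zero_mem add_mem act_mem act_add_right scal_scal mult.commute
        scal_act[of _ "mon (aff_map 1 b)" for b])
  let ?D = "\<lambda>a. mon (aff_map a 0) :: 'r aff_algebra"
  have "\<exists>w\<in>?V. w \<noteq> 0 \<and> (\<forall>g\<in>?D ` stabilizer \<chi>. \<exists>c. act M g w = scal M c w)"
  proof (rule common_eigenvector[OF _ _ _ V])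
    show "act M (weight_sum \<chi>) x \<in> ?V" "act M (weight_sum \<chi>) x \<noteq> 0"
      using has_weight_act_weight_sum[OF \<chi>(1) x(1)] \<chi>(2) by auto
    show "\<exists>k>0. g ^ k = 1" if "g \<in> ?D ` stabilizer \<chi>" for g
      using that by (auto simp: aff_map_in_units stabilizer_iff intro!: mon_finite_order)
    show "g * h = h * g" if "g \<in> ?D ` stabilizer \<chi>" "h \<in> ?D ` stabilizer \<chi>" for g h
      using that by (auto simp: mon_mult aff_map_plus mult.commute)
    fix g y assume "g \<in> ?D ` stabilizer \<chi>" "y \<in> ?V"
    then obtain a where a: "a \<in> stabilizer \<chi>" "g = ?D a" and y: "has_weight \<chi> y" by blast
    obtain a' where a': "a' \<in> stabilizer \<chi>" "a * a' = 1"
      using unit_subgroup.inverse_mem[OF unit_subgroup_stabilizer a(1)] by blast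
    have yM: "y \<in> mcarrier M" using y by (simp add: has_weight_def)
    have "opr 1 b (opr a 0 y) = scal M (\<chi> b) (opr a 0 y)" for b
    proof -
      have "opr 1 b (opr a 0 y) = opr a 0 (opr 1 (a' * b) y)"
        by (rule opr_translation_dilation[OF yM a'(2)])
      also have "opr 1 (a' * b) y = scal M (\<chi> b) y"
        using y a'(1) by (simp add: has_weight_def stabilizer_iff)
      finally show ?thesis by (simp add: scal_act[OF yM])
    qed
    then show "act M g y \<in> ?V" using a(2) yM by (simp add: has_weight_def act_mem)
  qed simp
  then obtain w where w: "has_weight \<chi> w" "w \<noteq> 0" and ev: "\<forall>a\<in>stabilizer \<chi>. \<exists>c. opr a 0 w = scal M c w"
    by auto
  have wM: "w \<in> mcarrier M" using w by (simp add: has_weight_def)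
  obtain \<rho> where \<rho>: "\<And>a. a \<in> stabilizer \<chi> \<Longrightarrow> opr a 0 w = scal M (\<rho> a) w"
    using bchoice[OF ev] by blast
  interpret U: unit_subgroup "stabilizer \<chi>" by (rule unit_subgroup_stabilizer)
  have mult: "\<rho> (a * b) = \<rho> a * \<rho> b" if "a \<in> stabilizer \<chi>" "b \<in> stabilizer \<chi>" for a b
  proof -
    have "scal M (\<rho> (a * b)) w = opr a 0 (opr b 0 w)"
      using that by (simp add: opr_opr wM U.mult_mem flip: \<rho>)
    also have "\<dots> = scal M (\<rho> b) (scal M (\<rho> a) w)"
      using scal_act[OF wM, of "mon (aff_map a 0)" "\<rho> b"] that by (simp add: \<rho>)
    finally show ?thesis using scal_cancel[OF wM w(2)] by (simp add: scal_scal wM mult.commute)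
  qed
  have one: "\<rho> 1 = 1"
    using \<rho>[OF U.one_mem] scal_cancel[OF wM w(2), of "\<rho> 1" 1] wM by (simp add: act_one)
  have "\<rho> a \<noteq> 0" if a: "a \<in> stabilizer \<chi>" for a
  proof -
    obtain a' where "a' \<in> stabilizer \<chi>" "a * a' = 1" using U.inverse_mem[OF a] by blast
    then show ?thesis using mult[OF a, of a'] one by auto
  qed
  then have unit: "unit_character (stabilizer \<chi>) \<rho>"
    using mult by (simp add: unit_character_def)
  have "weight_module M \<chi> \<rho> w"
  proof
    fix g :: "'r aff" and s assume "g \<notin> aff_units" "s \<in> mcarrier M"
    then show "act M (mon g) s = 0" using sing by (cases g) (simp add: aff_map_in_units)
  next
    fix a b assume a: "a \<in> stabilizer \<chi>"
    have "opr a b w = opr 1 b (scal M (\<rho> a) w)"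
      using opr_decompose[OF wM, of a b] a by (simp add: \<rho>)
    also have "\<dots> = scal M (\<rho> a) (opr 1 b w)"
      by (rule scal_act[OF wM])
    also have "\<dots> = scal M (\<chi> b * \<rho> a) w"
      using w(1) by (simp add: has_weight_def scal_scal mult.commute)
    finally show "opr a b w = scal M (\<chi> b * \<rho> a) w" .
  qed (simp_all add: S \<chi> unit wM w)
  then show thesis by (rule that)
qed

lemma simple_module_classification:
  assumes S: "simple_module M" and R: "chain_ring (p :: 'r) n"
  shows "(\<forall>g. \<forall>s\<in>mcarrier M. act M (mon g) s = s) \<or> (\<exists>\<chi> \<rho> v. weight_module M \<chi> \<rho> v)"
proof (cases "\<exists>s\<in>mcarrier M. opr 0 0 s \<noteq> 0")
  case True
  then obtain s where "s \<in> mcarrier M" "opr 0 0 s \<noteq> 0" by blast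
  then show ?thesis using trivial_action[OF S] by (metis aff_map_cases)
next
  case False
  then show ?thesis
    using weight_module_exists[OF S] singular_action[OF S R] by metis
qed

end


section \<open>Vectors that define extensions\<close>

lemma module_mult: "module ((*) :: 'r::comm_ring_1 \<Rightarrow> 'r \<Rightarrow> 'r)"
  by unfold_locales (simp_all add: algebra_simps)

lemma generated_ideal_singleton: "generated_ideal {x} = range (\<lambda>k. k * (x :: 'r::comm_ring_1))"
  by (rule module.span_singleton[OF module_mult])

context chain_ring
begin

text \<open>The map \<open>\<pi> = p x\<close> commutes with the dilations and satisfies \<open>\<pi> (x + d) = (x + p d) \<pi>\<close>, and the
  maps \<open>g\<close> with \<open>g \<pi> = \<pi>\<close> are the dilations by \<open>1 + p\<^sup>n\<^sup>-\<^sup>1 c\<close>. So these are the conditions that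
  \<open>\<pi> v\<close> satisfies in an extension, if \<open>v\<close> is a vector on which \<open>a x + b\<close> acts as \<open>\<chi>(b) \<rho>(a)\<close> for all
  \<open>a\<close> in the stabilizer of \<open>\<chi>\<close>.\<close>

definition extension_vectors ::
    "('r \<Rightarrow> complex) \<Rightarrow> ('r \<Rightarrow> complex) \<Rightarrow> ('r aff_algebra, 'w::ab_group_add) left_mod \<Rightarrow> 'w set" where
  "extension_vectors \<chi> \<rho> T = {t \<in> mcarrier T.
     (\<forall>d. act T (mon (aff_map 1 (p * d))) t = scal T (\<chi> d) t)
     \<and> (\<forall>u\<in>stabilizer \<chi>. act T (mon (aff_map u 0)) t = scal T (\<rho> u) t)
     \<and> (\<forall>c. act T (mon (aff_map (1 + p ^ (n - 1) * c) 0)) t = t)}"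

end

locale extension_setting = chain_ring p n + aff_module T
  for p :: "'r::{finite, comm_ring_1}" and n :: nat
    and T :: "('r aff_algebra, 'w::ab_group_add) left_mod" +
  fixes \<chi> \<rho> :: "'r \<Rightarrow> complex"
  assumes additive: "additive_character \<chi>" and unit: "unit_character (stabilizer \<chi>) \<rho>"
begin

sublocale chr: semicharacter "stabilizer \<chi>" \<chi> \<rho>
  by (rule semicharacter_stabilizer[OF additive unit])

abbreviation X where "X \<equiv> extension_vectors \<chi> \<rho> T"

lemma extension_vectors_D:
  assumes "t \<in> X"
  shows "t \<in> mcarrier T" "opr 1 (p * d) t = scal T (\<chi> d) t"
    "u \<in> stabilizer \<chi> \<Longrightarrow> opr u 0 t = scal T (\<rho> u) t" "opr (1 + p ^ (n - 1) * c) 0 t = t"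
  using assms by (auto simp: extension_vectors_def)

lemma extension_vectors_combine:
  assumes "t \<in> X" "t' \<in> X"
  shows "t - scal T c t' \<in> X"
proof -
  note t = extension_vectors_D[OF assms(1)] and t' = extension_vectors_D[OF assms(2)]
  have opr: "opr a b (t - scal T c t') = opr a b t - scal T c (opr a b t')" for a b
    using t(1) t'(1) scal_act[OF t'(1), of "mon (aff_map a b)" c]
    by (simp add: act_diff_right act_mem)
  show ?thesis
    using t t' by (simp add: extension_vectors_def opr diff_mem act_mem act_diff_right scal_scal mult.commute)
qed

lemma weight_component_weight:
  assumes t: "t \<in> X" and \<psi>: "additive_character \<psi>" "act T (weight_sum \<psi>) t \<noteq> 0"
  shows "\<psi> (p * d) = \<chi> d"
proof -
  let ?s = "act T (weight_sum \<psi>) t"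
  note tT = extension_vectors_D(1)[OF t]
  have "scal T (\<psi> (p * d)) ?s = act T (weight_sum \<psi>) (opr 1 (p * d) t)"
    by (simp only: act_mult[OF tT, symmetric] translation_weight_sum[OF \<psi>(1)] mult_scaleC_left mult_1)
  also have "\<dots> = scal T (\<chi> d) ?s"
    by (simp only: extension_vectors_D(2)[OF t] scal_act[OF tT])
  finally show ?thesis using scal_cancel \<psi>(2) tT by (metis act_mem)
qed

lemma stabilizer_subset:
  assumes "\<And>d. \<psi> (p * d) = \<chi> d"
  shows "stabilizer \<psi> \<subseteq> stabilizer \<chi>"
  by (auto simp: stabilizer_iff simp flip: assms) (metis mult.left_commute)

lemma one_plus_stabilizer:
  assumes "\<And>k. \<chi> (k * p ^ (n - 1)) = 1"
  shows "1 + c * p ^ (n - 1) \<in> stabilizer \<chi>"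
proof -
  have "\<chi> ((1 + c * p ^ (n - 1)) * a) = \<chi> a" for a
  proof -
    have "(1 + c * p ^ (n - 1)) * a = a + (c * a) * p ^ (n - 1)"
      by (simp add: algebra_simps)
    then show ?thesis by (simp only: additive_character_add[OF additive] assms mult_1_right)
  qed
  then show ?thesis
    using one_plus_unit[of c] by (simp add: stabilizer_iff mult.commute)
qed

text \<open>The dilations that stabilize \<open>\<psi>\<close> commute with the sum over \<open>\<psi>\<close>, so they act on the component by
  \<open>\<rho>\<close>, as they do on the whole vector. The condition on \<open>\<rho>\<close> expresses that the dilations by
  \<open>1 + p\<^sup>n\<^sup>-\<^sup>1 c\<close> also fix the vector.\<close>

lemma weight_component_generates:
  assumes T: "simple_module T" and sing: "\<And>g s. g \<notin> aff_units \<Longrightarrow> s \<in> mcarrier T \<Longrightarrow> act T (mon g) s = 0"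
    and t: "t \<in> X" and \<psi>: "additive_character \<psi>" "act T (weight_sum \<psi>) t \<noteq> 0"
  shows "weight_module T \<psi> \<rho> (act T (weight_sum \<psi>) t)" and "second_kind p n \<chi> \<rho> \<psi> \<rho>"
proof -
  note tT = extension_vectors_D(1)[OF t]
  have \<psi>p: "\<psi> (p * d) = \<chi> d" for d by (rule weight_component_weight[OF t \<psi>])
  have sub: "stabilizer \<psi> \<subseteq> stabilizer \<chi>" by (rule stabilizer_subset[OF \<psi>p])
  have unit': "unit_character (stabilizer \<psi>) \<rho>"
    using unit sub by (auto simp: unit_character_def)
  let ?s = "act T (weight_sum \<psi>) t"
  have sT: "?s \<in> mcarrier T" using tT by (rule act_mem)
  have w: "opr 1 b ?s = scal T (\<psi> b) ?s" for b
    using has_weight_act_weight_sum[OF \<psi>(1) tT] by (simp add: has_weight_def)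
  show "weight_module T \<psi> \<rho> ?s"
  proof
    fix a b assume a: "a \<in> stabilizer \<psi>"
    then have "(\<lambda>b. \<psi> (a * b)) = \<psi>" and au: "a dvd 1" by (auto simp: stabilizer_iff)
    then have "opr a 0 ?s = act T (weight_sum \<psi>) (opr a 0 t)"
      using act_weight_sum_dilation[OF tT au, of \<psi>] by simp
    also have "\<dots> = scal T (\<rho> a) ?s"
      using extension_vectors_D(3)[OF t, of a] a sub by (simp only: subsetD scal_act[OF tT])
    finally have "opr a b ?s = opr 1 b (scal T (\<rho> a) ?s)"
      using opr_decompose[OF sT, of a b] by simp
    also have "\<dots> = scal T (\<psi> b * \<rho> a) ?s"
      by (simp only: scal_act[OF sT, of "mon (aff_map 1 b)"] w scal_scal[OF sT] mult.commute)
    finally show "opr a b ?s = scal T (\<psi> b * \<rho> a) ?s" .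
  next
    fix g :: "'r aff" and s assume "g \<notin> aff_units" "s \<in> mcarrier T"
    then show "act T (mon g) s = 0" by (rule sing)
  next
    show "simple_module T" by (rule T)
    show "additive_character \<psi>" "?s \<noteq> 0" by (rule \<psi>)+
    show "unit_character (stabilizer \<psi>) \<rho>" by (rule unit')
    show "?s \<in> mcarrier T" by (rule sT)
  qed
  have \<chi>1: "\<chi> (k * p ^ (n - 1)) = 1" for k
  proof -
    have "p * (k * p ^ (n - 1)) = 0"
      by (simp only: mult.left_commute[of p k] p_mult_power mult_zero_right)
    then show ?thesis using \<psi>p[of "k * p ^ (n - 1)"] additive_character_0[OF \<psi>(1)] by simp
  qed
  have \<rho>1: "\<rho> (1 + k * p ^ (n - 1)) = 1" for k
  proof -
    let ?u = "1 + k * p ^ (n - 1)"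
    have "?u \<in> stabilizer \<chi>" by (rule one_plus_stabilizer[OF \<chi>1])
    then have "scal T (\<rho> ?u) t = t"
      using extension_vectors_D(3)[OF t, of ?u] extension_vectors_D(4)[OF t, of k] by (simp add: mult.commute)
    moreover have "t \<noteq> 0" using \<psi>(2) by auto
    ultimately show ?thesis using scal_cancel[OF tT, of "\<rho> ?u" 1] by (simp add: act_one tT)
  qed
  show "second_kind p n \<chi> \<rho> \<psi> \<rho>"
    unfolding second_kind_def generated_ideal_singleton
    using additive unit unit' \<psi>(1) \<psi>p \<chi>1 \<rho>1 by auto
qed

text \<open>The component of such a vector in one weight space determines it. The weights that occur lie in
  one orbit and restrict to \<open>\<chi>\<close> along multiplication by \<open>p\<close>, so the stabilizer of \<open>\<chi>\<close> permutes them
  transitively, and it acts on the vector by \<open>\<rho>\<close>. Hence two vectors whose components in one weight space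
  are proportional are proportional themselves.\<close>

lemma extension_vectors_one_dimensional:
  assumes T: "simple_module T" and sing: "\<And>g s. g \<notin> aff_units \<Longrightarrow> s \<in> mcarrier T \<Longrightarrow> act T (mon g) s = 0"
    and t: "t \<in> X" "t \<noteq> 0" and t': "t' \<in> X"
  shows "\<exists>c. t' = scal T c t"
proof -
  note tT = extension_vectors_D(1)[OF t(1)] and tT' = extension_vectors_D(1)[OF t']
  obtain \<psi> where \<psi>: "additive_character \<psi>" "act T (weight_sum \<psi>) t \<noteq> 0"
    using weight_component_nonzero[OF tT t(2)] by blast
  interpret W: weight_module T \<psi> \<rho> "act T (weight_sum \<psi>) t"
    by (rule weight_component_generates[OF T sing t(1) \<psi>])
  obtain c where c: "act T (weight_sum \<psi>) t' = scal T c (act T (weight_sum \<psi>) t)"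
    using W.weight_space_one_dimensional[OF tT'] by blast
  let ?t = "t' - scal T c t"
  have X: "?t \<in> X" by (rule extension_vectors_combine[OF t' t(1)])
  note tX = extension_vectors_D(1)[OF X]
  have zero: "act T (weight_sum \<psi>) ?t = 0"
    by (simp add: act_diff_right tT tT' act_mem scal_act[OF tT] c)
  have "?t = 0"
  proof (rule ccontr)
    assume "?t \<noteq> 0"
    then obtain \<psi>' where \<psi>': "additive_character \<psi>'" "act T (weight_sum \<psi>') ?t \<noteq> 0"
      using weight_component_nonzero[OF tX] by blast
    obtain u where u: "u dvd 1" "\<And>b. \<psi>' (u * b) = \<psi> b"
      using W.weight_in_orbit[OF tX \<psi>'] by blast
    have "\<chi> (u * d) = \<chi> d" for d
    proof -
      have "\<chi> (u * d) = \<psi>' (p * (u * d))" by (rule weight_component_weight[OF X \<psi>', symmetric])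
      also have "\<dots> = \<psi> (p * d)" by (simp add: mult.left_commute flip: u(2))
      also have "\<dots> = \<chi> d" by (rule weight_component_weight[OF t(1) \<psi>])
      finally show ?thesis .
    qed
    then have us: "u \<in> stabilizer \<chi>" using u(1) by (simp add: stabilizer_iff)
    have "scal T (\<rho> u) (act T (weight_sum \<psi>') ?t) = act T (weight_sum \<psi>') (opr u 0 ?t)"
      by (simp only: extension_vectors_D(3)[OF X us] scal_act[OF tX])
    also have "\<dots> = opr u 0 (act T (weight_sum \<psi>) ?t)"
      using act_weight_sum_dilation[OF tX u(1), of \<psi>'] by (simp add: u(2))
    also have "\<dots> = 0" by (simp add: zero)
    finally show False
      using \<psi>'(2) chr.rho_nonzero[OF us] tX by (simp add: scal_eq_0_iff act_mem)
  qed
  then show ?thesis by auto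
qed

text \<open>The vector is the projection of the generator of the induced module to the \<open>\<rho>\<close>-isotypic part
  for the stabilizer of \<open>\<chi>\<close>. It does not vanish because the summands in the weight space of the
  generator all agree.\<close>

lemma extension_vector_exists:
  assumes W: "weight_module T \<chi>' \<rho>' w" and kind: "second_kind p n \<chi> \<rho> \<chi>' \<rho>'"
  obtains t where "t \<in> X" "t \<noteq> 0"
proof -
  interpret W: weight_module T \<chi>' \<rho>' w by (rule W)
  have \<chi>p: "\<chi>' (p * d) = \<chi> d" and \<rho>\<rho>': "u \<in> stabilizer \<chi>' \<Longrightarrow> \<rho> u = \<rho>' u" for d u
    using kind by (auto simp: second_kind_def)
  have \<chi>1: "\<chi> (k * p ^ (n - 1)) = 1" and \<rho>1: "\<rho> (1 + k * p ^ (n - 1)) = 1" for k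
    using kind by (auto simp: second_kind_def generated_ideal_singleton)
  have sub: "stabilizer \<chi>' \<subseteq> stabilizer \<chi>" by (rule stabilizer_subset[OF \<chi>p])
  note wT = W.v_mem
  define t where "t = (\<Sum>u\<in>stabilizer \<chi>. scal T (inverse (\<rho> u)) (opr u 0 w))"
  have tT: "t \<in> mcarrier T" by (auto simp: t_def intro!: sum_mem act_mem wT)
  have act_t: "act T a t = (\<Sum>u\<in>stabilizer \<chi>. scal T (inverse (\<rho> u)) (act T a (opr u 0 w)))" for a
    unfolding t_def by (subst act_sum_right) (auto intro!: act_mem wT sum.cong scal_act)
  have tr: "opr 1 (p * d) t = scal T (\<chi> d) t" for d
  proof -
    have "opr 1 (p * d) (opr u 0 w) = scal T (\<chi> d) (opr u 0 w)" if u: "u \<in> stabilizer \<chi>" for u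
    proof -
      obtain u' where u': "u' \<in> stabilizer \<chi>" "u * u' = 1" using chr.inverse_mem[OF u] by blast
      have "opr 1 (p * d) (opr u 0 w) = opr u 0 (opr 1 (u' * (p * d)) w)"
        by (rule opr_translation_dilation[OF wT u'(2)])
      also have "opr 1 (u' * (p * d)) w = scal T (\<chi> d) w"
        using W.v_weight \<chi>p[of "u' * d"] u'(1) by (simp add: has_weight_def mult.left_commute stabilizer_iff)
      finally show ?thesis by (simp only: scal_act[OF wT])
    qed
    then have "opr 1 (p * d) t = (\<Sum>u\<in>stabilizer \<chi>. scal T (inverse (\<rho> u)) (scal T (\<chi> d) (opr u 0 w)))"
      by (simp add: act_t)
    also have "\<dots> = scal T (\<chi> d) t"
      unfolding act_t by (intro sum.cong refl scal_act[symmetric] act_mem wT)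
    finally show ?thesis .
  qed
  have dil: "opr a 0 t = scal T (\<rho> a) t" if a: "a \<in> stabilizer \<chi>" for a
  proof -
    obtain a' where a': "a' \<in> stabilizer \<chi>" "a * a' = 1" using chr.inverse_mem[OF a] by blast
    have aa: "a' * (a * x) = x" "a * (a' * x) = x" for x
      using a'(2) by (simp_all add: mult.commute flip: mult.assoc)
    have "opr a 0 t = (\<Sum>u\<in>stabilizer \<chi>. scal T (inverse (\<rho> u)) (opr (a * u) 0 w))"
      by (simp add: act_t opr_opr wT)
    also have "\<dots> = (\<Sum>u\<in>stabilizer \<chi>. scal T (\<rho> a * inverse (\<rho> u)) (opr u 0 w))"
    proof (rule sum.reindex_bij_witness[of _ "\<lambda>u. a' * u" "\<lambda>u. a * u"])
      fix u assume u: "u \<in> stabilizer \<chi>"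
      show "scal T (\<rho> a * inverse (\<rho> (a * u))) (opr (a * u) 0 w) = scal T (inverse (\<rho> u)) (opr (a * u) 0 w)"
        using chr.rho_nonzero[OF a] by (simp add: chr.rho_mult a u flip: mult.assoc)
    qed (simp_all add: aa chr.mult_mem a a')
    also have "\<dots> = (\<Sum>u\<in>stabilizer \<chi>. scal T (\<rho> a) (scal T (inverse (\<rho> u)) (opr u 0 w)))"
      by (simp add: scal_scal act_mem wT)
    also have "\<dots> = scal T (\<rho> a) t"
      unfolding t_def by (rule act_sum_right[symmetric]) (simp add: act_mem wT)
    finally show ?thesis .
  qed
  have "opr (1 + p ^ (n - 1) * c) 0 t = t" for c
  proof -
    let ?u = "1 + c * p ^ (n - 1)"
    have "?u \<in> stabilizer \<chi>" by (rule one_plus_stabilizer[OF \<chi>1])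
    then have "opr ?u 0 t = scal T (\<rho> ?u) t" by (rule dil)
    also have "\<dots> = t" by (simp only: \<rho>1 scal_one tT)
    finally show ?thesis by (simp add: mult.commute)
  qed
  then have "t \<in> X"
    using tr dil tT by (simp add: extension_vectors_def)
  moreover have "t \<noteq> 0"
  proof
    assume "t = 0"
    let ?R = "of_nat (card (UNIV :: 'r set)) :: complex"
    have "act T (weight_sum \<chi>') t
        = (\<Sum>u\<in>stabilizer \<chi>. if u \<in> stabilizer \<chi>' then scal T ?R w else 0)"
      unfolding act_t
    proof (rule sum.cong[OF refl])
      fix u assume u: "u \<in> stabilizer \<chi>"
      then have uu: "u dvd 1" by (simp add: stabilizer_iff)
      have iff: "u \<in> stabilizer \<chi>' \<longleftrightarrow> (\<lambda>b. \<chi>' (u * b)) = \<chi>'"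
        using uu by (simp add: stabilizer_iff fun_eq_iff)
      show "scal T (inverse (\<rho> u)) (act T (weight_sum \<chi>') (opr u 0 w))
          = (if u \<in> stabilizer \<chi>' then scal T ?R w else 0)"
      proof (cases "u \<in> stabilizer \<chi>'")
        case True
        have c: "inverse (\<rho> u) * (?R * \<rho>' u) = ?R"
          using chr.rho_nonzero[OF u] \<rho>\<rho>'[OF True] by simp
        show ?thesis
          using True iff W.act_weight_sum_unit_v[OF uu W.additive_chi, of 0]
          by (simp add: additive_character_0[OF W.additive_chi] W.v_stabilizer scal_scal wT)
            (simp only: c)
      next
        case False
        then show ?thesis
          using iff W.act_weight_sum_unit_v[OF uu W.additive_chi, of 0] by simp
      qed
    qed
    also have "\<dots> = (\<Sum>u\<in>stabilizer \<chi>'. scal T ?R w)"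
      using sub by (simp add: sum.inter_restrict[symmetric] Int_absorb1 flip: Int_def)
    also have "\<dots> = scal T (of_nat (card (stabilizer \<chi>')) * ?R) w"
      by (simp only: act_sum_left[OF wT, symmetric] complex_module.scale_sum_left[symmetric] sum_constant)
    finally have "scal T (of_nat (card (stabilizer \<chi>')) * ?R) w = 0"
      using \<open>t = 0\<close> by simp
    then show False
      using W.v_nonzero W.chr.card_U_pos scal_eq_0_iff[OF wT]
      by (metis less_irrefl of_nat_eq_0_iff of_nat_mult)
  qed
  ultimately show thesis by (rule that)
qed

end


section \<open>Extensions of induced modules\<close>

definition char_idempotent ::
    "('r::{finite, comm_ring_1} \<Rightarrow> complex) \<Rightarrow> ('r \<Rightarrow> complex) \<Rightarrow> 'r aff_algebra" where
  "char_idempotent \<chi> \<rho> =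
     inverse (of_nat (card (stabilizer \<chi>) * card (UNIV :: 'r set))) *\<^sub>C character_sum (stabilizer \<chi>) \<chi> \<rho>"

context weight_module
begin

abbreviation order :: complex where
  "order \<equiv> of_nat (card (stabilizer \<chi>) * card (UNIV :: 'r set))"

lemma order_nonzero: "order \<noteq> 0"
  using chr.card_U_pos by (metis less_irrefl of_nat_eq_0_iff)

lemma inverse_order: "inverse order * order = 1"
  by (rule left_inverse[OF order_nonzero])

lemma char_idempotent_mult_mon:
  assumes "a \<in> stabilizer \<chi>"
  shows "mon (aff_map a b) * char_idempotent \<chi> \<rho> = (\<chi> b * \<rho> a) *\<^sub>C char_idempotent \<chi> \<rho>"
    and "char_idempotent \<chi> \<rho> * mon (aff_map a b) = (\<chi> b * \<rho> a) *\<^sub>C char_idempotent \<chi> \<rho>"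
  by (simp_all only: char_idempotent_def mult_scaleC_left mult_scaleC_right scaleC_scaleC
      chr.mon_mult_character_sum[OF assms] chr.character_sum_mult_mon[OF assms] mult.commute)

sublocale pres: idempotent_presentation S v "char_idempotent \<chi> \<rho>"
proof
  show "char_idempotent \<chi> \<rho> * char_idempotent \<chi> \<rho> = char_idempotent \<chi> \<rho>"
    by (simp only: char_idempotent_def mult_scaleC_left mult_scaleC_right chr.character_sum_square
        scaleC_scaleC mult.assoc inverse_order mult_1_right)
  show "act S (char_idempotent \<chi> \<rho>) v = v"
    by (simp only: char_idempotent_def act_scaleC[OF v_mem, of _ "character_sum (stabilizer \<chi>) \<chi> \<rho>"] act_character_sum_v scal_scal[OF v_mem]
        inverse_order scal_one[OF v_mem])
  show "\<exists>a. act S a v = s" if "s \<in> mcarrier S" for s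
    using simple_module_cyclic[OF simple v_mem v_nonzero that] by blast
qed (rule v_mem)

lemma act_singular:
  assumes "\<And>g. g \<in> aff_units \<Longrightarrow> lookup x g = 0" "s \<in> mcarrier S"
  shows "act S x s = 0"
proof -
  have "act S x s = (\<Sum>g\<in>keys x. act S (lookup x g *\<^sub>C mon g) s)"
    by (subst monoid_algebra_expansion[of x, symmetric]) (simp add: act_sum_left assms(2))
  also have "\<dots> = (\<Sum>g\<in>keys x. 0)"
  proof (rule sum.cong[OF refl])
    fix g assume "g \<in> keys x"
    then have "g \<notin> aff_units" using assms(1)[of g] by (auto simp: in_keys_iff)
    then show "act S (lookup x g *\<^sub>C mon g) s = 0"
      by (simp add: act_scaleC[OF assms(2)] singular assms(2))
  qed
  finally show ?thesis by simp
qed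

text \<open>The invertible part of a relation lies in the induced space and kills the generator; since the
  induced space maps injectively, a relation involves non-invertible maps only.\<close>

lemma relation_singular:
  assumes x: "x \<in> mcarrier pres.relations" and g: "g \<in> aff_units"
  shows "lookup x g = 0"
proof -
  have xe: "x * char_idempotent \<chi> \<rho> = x" and xv: "act S x v = 0"
    using x by (simp_all add: pres.relations_iff)
  have xh: "x * mon (aff_map a b) = (\<chi> b * \<rho> a) *\<^sub>C x" if "a \<in> stabilizer \<chi>" for a b
  proof -
    have "x * mon (aff_map a b) = x * (char_idempotent \<chi> \<rho> * mon (aff_map a b))"
      by (simp add: xe flip: mult.assoc)
    then show ?thesis by (simp add: char_idempotent_mult_mon(2)[OF that] mult_scaleC_right xe)
  qed
  \<comment> \<open>Passing to the invertible part commutes with right multiplication by units.\<close>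
  define y where "y = (\<Sum>g\<in>aff_units. lookup x g *\<^sub>C mon g)"
  have look: "lookup y h = (if h \<in> aff_units then lookup x h else 0)" for h
    by (simp add: y_def lookup_sum lookup_single when_def if_distrib cong: if_cong)
  have "keys y \<subseteq> aff_units"
    by (auto simp: in_keys_iff look split: if_splits)
  moreover have "y * mon (aff_map a b) = (\<chi> b * \<rho> a) *\<^sub>C y" if a: "a \<in> stabilizer \<chi>" for a b
  proof (rule poly_mapping_eqI)
    fix k
    have u: "aff_map a b \<in> aff_units" using a by (simp add: aff_map_in_units stabilizer_iff)
    obtain h where h: "h \<in> aff_units" "aff_map a b + h = 0" "h + aff_map a b = 0"
      using aff_units_inverse[OF u] by blast
    have "lookup (x * mon (aff_map a b)) k = lookup x (k + h)"
      by (rule lookup_mult_mon[OF h(2,3)])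
    then show "lookup (y * mon (aff_map a b)) k = lookup ((\<chi> b * \<rho> a) *\<^sub>C y) k"
      by (simp add: lookup_mult_mon[OF h(2,3)] look plus_in_aff_units h(1) xh[OF a])
  qed
  ultimately have "y \<in> induced_space \<chi> \<rho>"
    by (simp add: induced_space_iff[OF additive_chi unit_rho])
  moreover have "act S y v = 0"
  proof -
    have "act S (x - y) v = 0"
      by (rule act_singular) (simp_all add: lookup_minus look v_mem)
    then show ?thesis by (simp add: act_diff_left v_mem xv)
  qed
  ultimately have "y = 0" by (rule induced_space_annihilator)
  then show ?thesis using look[of g] g by simp
qed

end

locale weight_extension = extension_setting p n T \<chi> \<rho> + S: weight_module S \<chi> \<rho> v
  for p :: "'r::{finite, comm_ring_1}" and n :: nat
    and T :: "('r aff_algebra, 'w::ab_group_add) left_mod" and \<chi> \<rho> :: "'r \<Rightarrow> complex"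
    and S :: "('r aff_algebra, 'v::ab_group_add) left_mod" and v :: 'v +
  assumes T_singular: "\<And>g s. g \<notin> aff_units \<Longrightarrow> s \<in> mcarrier T \<Longrightarrow> act T (mon g) s = 0"
begin

abbreviation \<pi> :: "'r aff_algebra" where
  "\<pi> \<equiv> mon (aff_map p 0)"

text \<open>A linear map that undoes right multiplication by \<open>\<pi>\<close>. The quotient of maps is chosen
  arbitrarily; two choices act in the same way on the vectors of interest.\<close>

definition quotient_pi :: "'r aff \<Rightarrow> 'r aff" where
  "quotient_pi g = (SOME h. h + aff_map p 0 = g)"

definition divide_pi :: "'r aff_algebra \<Rightarrow> 'r aff_algebra" where
  "divide_pi x = act (linear_extension UNIV (\<lambda>g _. mon (quotient_pi g))) x (0 :: 'r aff_algebra)"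

lemma quotient_pi: "g \<notin> aff_units \<Longrightarrow> quotient_pi g + aff_map p 0 = g"
proof -
  assume g: "g \<notin> aff_units"
  obtain a b where ab: "g = aff_map a b" by (cases g)
  then obtain c where "a = p * c"
    using g nonunit_dvd by (auto simp: aff_map_in_units elim: dvdE)
  then have "aff_map c b + aff_map p 0 = g" by (simp add: ab aff_map_plus mult.commute)
  then show ?thesis unfolding quotient_pi_def by (rule someI)
qed

lemma quotient_pi_plus: "quotient_pi (g + aff_map p 0) + aff_map p 0 = g + aff_map p 0"
  unfolding quotient_pi_def by (rule someI[of _ g]) (rule refl)

lemma divide_pi_mult_pi:
  assumes "\<And>g. g \<in> aff_units \<Longrightarrow> lookup x g = 0"
  shows "divide_pi x * \<pi> = x"
proof -
  have "divide_pi x * \<pi> = (\<Sum>g\<in>keys x. lookup x g *\<^sub>C mon (quotient_pi g + aff_map p 0))"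
    by (simp add: divide_pi_def linear_extension_def sum_distrib_right mult_scaleC_left mon_mult)
  also have "\<dots> = (\<Sum>g\<in>keys x. lookup x g *\<^sub>C mon g)"
  proof (rule sum.cong[OF refl])
    fix g assume "g \<in> keys x"
    then have "g \<notin> aff_units" using assms[of g] by (auto simp: in_keys_iff)
    then show "lookup x g *\<^sub>C mon (quotient_pi g + aff_map p 0) = lookup x g *\<^sub>C mon g"
      by (simp add: quotient_pi)
  qed
  finally show ?thesis by (simp only: monoid_algebra_expansion)
qed

text \<open>Two maps with the same composite with \<open>p x\<close> differ by a dilation by \<open>1 + p\<^sup>n\<^sup>-\<^sup>1 c\<close> on the
  right, or are both non-invertible.\<close>

lemma act_eq_if_mult_pi_eq:
  assumes t: "t \<in> X" and eq: "g + aff_map p 0 = h + aff_map p 0"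
  shows "act T (mon g) t = act T (mon h) t"
proof -
  obtain a b c d where gh: "g = aff_map a b" "h = aff_map c d" by (metis aff_map_cases)
  have bd: "b = d" and "p * a = p * c"
    using eq by (simp_all add: gh aff_map_plus aff_map_eq_iff mult.commute)
  then have "p * (c - a) = 0" by (simp add: right_diff_distrib)
  then obtain k where k: "c - a = p ^ (n - 1) * k" using annihilator by (auto elim: dvdE)
  show ?thesis
  proof (cases "a dvd 1")
    case True
    then obtain a' where a': "a * a' = 1" by (auto elim: dvdE)
    have "a * (1 + p ^ (n - 1) * (a' * k)) = a + (a * a') * (p ^ (n - 1) * k)"
      by (simp add: distrib_left ac_simps)
    also have "\<dots> = c" by (simp only: a' k[symmetric]) simp
    finally have c: "a * (1 + p ^ (n - 1) * (a' * k)) = c" .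
    have "opr a b (opr (1 + p ^ (n - 1) * (a' * k)) 0 t) = opr c b t"
      by (simp only: opr_opr[OF extension_vectors_D(1)[OF t]] c mult_zero_right add_0_left)
    then show ?thesis by (simp only: extension_vectors_D(4)[OF t] gh bd)
  next
    case False
    have "p dvd p ^ (n - 1) * k"
      using n_ge_2 by (intro dvd_mult2 dvd_power) simp
    then have "p dvd c - a" by (simp only: k)
    moreover have "p dvd a" using False nonunit_dvd by blast
    ultimately have "p dvd c" by (metis diff_add_cancel dvd_add)
    then have "\<not> c dvd 1" by (simp add: nonunit_iff)
    then show ?thesis
      using False extension_vectors_D(1)[OF t] by (simp add: gh T_singular aff_map_in_units)
  qed
qed

lemma act_divide_pi:
  assumes t: "t \<in> X"
  shows "act T (divide_pi (y * \<pi>)) t = act T y t"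
proof (induction y rule: monoid_algebra_induct)
  case zero
  then show ?case by (simp add: divide_pi_def act_linear_extension)
next
  case (add g c y)
  have "divide_pi ((c *\<^sub>C mon g + y) * \<pi>) = c *\<^sub>C mon (quotient_pi (g + aff_map p 0)) + divide_pi (y * \<pi>)"
    by (simp add: divide_pi_def act_linear_extension distrib_right mult_scaleC_left mon_mult)
  moreover have "act T (mon (quotient_pi (g + aff_map p 0))) t = act T (mon g) t"
    by (rule act_eq_if_mult_pi_eq[OF t quotient_pi_plus])
  ultimately show ?case
    using add extension_vectors_D(1)[OF t] by (simp add: act_add_left act_scaleC[of t])
qed

abbreviation K where "K \<equiv> S.pres.relations"
abbreviation \<epsilon> where "\<epsilon> \<equiv> char_idempotent \<chi> \<rho>"

lemma divide_pi_relation: "x \<in> mcarrier K \<Longrightarrow> divide_pi x * \<pi> = x"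
  by (rule divide_pi_mult_pi) (rule S.relation_singular)

lemma p_not_unit_map: "aff_map p b \<notin> aff_units"
  by (simp add: aff_map_in_units p_nonunit)

lemma pi_eps_relation: "\<pi> * \<epsilon> \<in> mcarrier K"
  using S.singular[OF p_not_unit_map S.v_mem]
  by (simp add: S.pres.relations_iff mult.assoc S.pres.idem S.act_mult S.v_mem S.pres.eps_v)

text \<open>Every relation is a multiple of \<open>\<pi>\<close> on the right, and the annihilator of \<open>\<pi>\<close> acts as zero on the
  given vector; so \<open>y \<pi> \<mapsto> y t\<close> is well defined, and it is clearly linear.\<close>

lemma module_hom_divide_pi:
  assumes t: "t \<in> X"
  shows "module_hom K T (\<lambda>x. act T (divide_pi x) t)"
  unfolding module_hom_def
proof (intro conjI ballI allI)
  note tT = extension_vectors_D(1)[OF t]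
  fix a x assume x: "x \<in> mcarrier K"
  have "act K a x = a * divide_pi x * \<pi>"
    by (simp add: mult.assoc divide_pi_relation[OF x])
  then show "act T (divide_pi (act K a x)) t = act T a (act T (divide_pi x) t)"
    by (simp only: act_divide_pi[OF t] act_mult[OF tT])
next
  note tT = extension_vectors_D(1)[OF t]
  fix x y
  show "act T (divide_pi (x + y)) t = act T (divide_pi x) t + act T (divide_pi y) t"
    by (simp add: divide_pi_def act_linear_extension_add act_add_left tT)
qed (simp add: act_mem extension_vectors_D(1)[OF t])

lemma divide_pi_pi_eps:
  assumes t: "t \<in> X"
  shows "act T (divide_pi (\<pi> * \<epsilon>)) t = t"
proof -
  note tT = extension_vectors_D(1)[OF t]
  \<comment> \<open>Since \<open>\<pi> (a x + b) = (a x + p b) \<pi>\<close>, the factor \<open>\<pi>\<close> can be moved to the right of the idempotent.\<close>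
  define y where "y = inverse S.order *\<^sub>C
    (\<Sum>(a, b)\<in>stabilizer \<chi> \<times> UNIV. inverse (\<chi> b * \<rho> a) *\<^sub>C mon (aff_map a (p * b)))"
  have "\<pi> * \<epsilon> = y * \<pi>"
    by (simp add: y_def char_idempotent_def character_sum_def sum_distrib_left sum_distrib_right
        mult_scaleC_left mult_scaleC_right mon_mult aff_map_plus case_prod_unfold mult.commute[of p])
  then have "act T (divide_pi (\<pi> * \<epsilon>)) t = act T y t"
    by (simp only: act_divide_pi[OF t])
  also have "\<dots> = scal T (inverse S.order)
      (\<Sum>(a, b)\<in>stabilizer \<chi> \<times> UNIV. scal T (inverse (\<chi> b * \<rho> a)) (opr a (p * b) t))"
    unfolding y_def
    by (simp only: act_scaleC[OF tT, of "inverse S.order"] act_sum_left[OF tT] act_scaleC[OF tT, of _ "mon _"]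
        case_prod_unfold)
  also have "(\<Sum>(a, b)\<in>stabilizer \<chi> \<times> UNIV. scal T (inverse (\<chi> b * \<rho> a)) (opr a (p * b) t)) = scal T S.order t"
  proof (rule chr.sum_inverse_character[OF left_module_axioms tT])
    fix a b assume a: "a \<in> stabilizer \<chi>"
    have "opr a (p * b) t = opr 1 (p * b) (scal T (\<rho> a) t)"
      using opr_decompose[OF tT, of a "p * b"] by (simp only: extension_vectors_D(3)[OF t a])
    also have "\<dots> = scal T (\<rho> a) (opr 1 (p * b) t)"
      by (rule scal_act[OF tT])
    finally show "opr a (p * b) t = scal T (\<chi> b * \<rho> a) t"
      by (simp only: extension_vectors_D(2)[OF t] scal_scal[OF tT] mult.commute[of "\<rho> a"])
  qed
  finally show ?thesis
    by (simp only: scal_scal[OF tT] S.inverse_order scal_one[OF tT])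
qed

text \<open>The relation \<open>\<pi> \<epsilon>\<close> generates all the others, so its image determines the homomorphism; the
  conditions on the image are relations between the multiples of \<open>\<pi> \<epsilon>\<close>.\<close>

lemma relation_hom_value:
  assumes k: "module_hom K T k"
  shows "k (\<pi> * \<epsilon>) \<in> X" and "x \<in> mcarrier K \<Longrightarrow> k x = act T (divide_pi x) (k (\<pi> * \<epsilon>))"
proof -
  have kact: "k (a * (\<pi> * \<epsilon>)) = act T a (k (\<pi> * \<epsilon>))" for a
    using module_hom_act[OF k pi_eps_relation, of a] by simp
  have kT: "k (\<pi> * \<epsilon>) \<in> mcarrier T" by (rule module_hom_mem[OF k pi_eps_relation])
  have kscal: "k (c *\<^sub>C (\<pi> * \<epsilon>)) = scal T c (k (\<pi> * \<epsilon>))" for c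
    by (simp add: mult_scaleC_left flip: kact)
  have "opr 1 (p * d) (k (\<pi> * \<epsilon>)) = scal T (\<chi> d) (k (\<pi> * \<epsilon>))" for d
  proof -
    have "mon (aff_map 1 (p * d)) * (\<pi> * \<epsilon>) = \<pi> * (mon (aff_map 1 d) * \<epsilon>)"
      by (simp add: mon_mult aff_map_plus flip: mult.assoc)
    also have "\<dots> = \<chi> d *\<^sub>C (\<pi> * \<epsilon>)"
      by (simp add: S.char_idempotent_mult_mon(1)[OF chr.one_mem] mult_scaleC_right chr.rho_one)
    finally show ?thesis using kact[of "mon (aff_map 1 (p * d))"] kscal[of "\<chi> d"] by simp
  qed
  moreover have "opr u 0 (k (\<pi> * \<epsilon>)) = scal T (\<rho> u) (k (\<pi> * \<epsilon>))" if u: "u \<in> stabilizer \<chi>" for u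
  proof -
    have "mon (aff_map u 0) * (\<pi> * \<epsilon>) = \<pi> * (mon (aff_map u 0) * \<epsilon>)"
      by (simp add: mon_mult aff_map_plus mult.commute flip: mult.assoc)
    also have "\<dots> = \<rho> u *\<^sub>C (\<pi> * \<epsilon>)"
      by (simp add: S.char_idempotent_mult_mon(1)[OF u] mult_scaleC_right
          additive_character_0[OF additive])
    finally show ?thesis using kact[of "mon (aff_map u 0)"] kscal[of "\<rho> u"] by simp
  qed
  moreover have "opr (1 + p ^ (n - 1) * c) 0 (k (\<pi> * \<epsilon>)) = k (\<pi> * \<epsilon>)" for c
  proof -
    have "(1 + p ^ (n - 1) * c) * p = p"
      using p_mult_power by (simp only: distrib_right mult_1 mult.assoc mult.commute[of c p])
        (simp only: mult.assoc[symmetric] mult.commute[of _ p] mult_zero_left add_0_right)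
    then have "mon (aff_map (1 + p ^ (n - 1) * c) 0) * (\<pi> * \<epsilon>) = \<pi> * \<epsilon>"
      by (simp add: mon_mult aff_map_plus flip: mult.assoc)
    then show ?thesis by (simp only: kact[symmetric])
  qed
  ultimately show "k (\<pi> * \<epsilon>) \<in> X" using kT by (simp add: extension_vectors_def)
  assume x: "x \<in> mcarrier K"
  then have "x = divide_pi x * (\<pi> * \<epsilon>)"
    using divide_pi_relation[OF x] by (simp add: S.pres.relations_iff flip: mult.assoc)
  then show "k x = act T (divide_pi x) (k (\<pi> * \<epsilon>))"
    using kact by metis
qed

lemma T_act_relation:
  assumes x: "x \<in> mcarrier K" and t: "t \<in> mcarrier T"
  shows "act T x t = 0"
proof -
  have "act T x t = act T (divide_pi x) (act T \<pi> t)"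
    using divide_pi_relation[OF x] t by (simp flip: act_mult)
  then show ?thesis using T_singular[OF p_not_unit_map t] by simp
qed

lemma ext1_has_dim_0_weight:
  assumes "X = {0}"
  shows "ext1_has_dim S T 0"
proof (rule S.pres.ext1_has_dim_0I[OF left_module_axioms])
  fix k assume k: "module_hom K T k"
  show "\<exists>t\<in>mcarrier T. \<forall>x\<in>mcarrier K. k x = act T x t"
    using relation_hom_value[OF k] assms by (intro bexI[of _ 0]) (auto simp: zero_mem)
qed

lemma ext1_has_dim_1_weight:
  assumes T: "simple_module T" and t: "t \<in> X" "t \<noteq> 0"
  shows "ext1_has_dim S T 1"
proof (rule S.pres.ext1_has_dim_1_presentationI[OF left_module_axioms module_hom_divide_pi[OF t(1)]])
  show "\<not> (\<exists>s\<in>mcarrier T. \<forall>x\<in>mcarrier K. act T (divide_pi x) t = act T x s)"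
    using t(2) divide_pi_pi_eps[OF t(1)] pi_eps_relation T_act_relation by metis
  fix k assume k: "module_hom K T k"
  obtain c where c: "k (\<pi> * \<epsilon>) = scal T c t"
    using extension_vectors_one_dimensional[OF T T_singular t relation_hom_value(1)[OF k]] by blast
  show "\<exists>c. \<exists>s\<in>mcarrier T. \<forall>x\<in>mcarrier K. k x - scal T c (act T (divide_pi x) t) = act T x s"
  proof (intro exI[of _ c] bexI[of _ 0] ballI)
    fix x assume "x \<in> mcarrier K"
    then show "k x - scal T c (act T (divide_pi x) t) = act T x 0"
      by (simp add: relation_hom_value(2)[OF k] c scal_act[OF extension_vectors_D(1)[OF t(1)]])
  qed (rule zero_mem)
qed

end


section \<open>Extensions from and to the trivial module\<close>

abbreviation augmentation :: "'r::{finite, comm_ring_1} aff_algebra \<Rightarrow> complex" where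
  "augmentation x \<equiv> act trivial_module x 1"

lemma augmentation_add: "augmentation (x + y) = augmentation x + augmentation y"
  and augmentation_scaleC: "augmentation (c *\<^sub>C x) = c * augmentation x"
  and augmentation_mon: "augmentation (mon g) = 1"
  and augmentation_zero: "augmentation 0 = 0"
  by (simp_all add: trivial_module_def act_linear_extension scaleC_complex_def)

abbreviation const0 :: "'r::{finite, comm_ring_1} aff_algebra" where
  "const0 \<equiv> mon (aff_map 0 0)"

lemma const0_mult: "const0 * x = augmentation x *\<^sub>C const0"
proof (induction x rule: monoid_algebra_induct)
  case (add g c x)
  have "const0 * mon g = const0" by (cases g) (simp add: mon_mult aff_map_plus)
  then show ?case
    using add by (simp add: distrib_left mult_scaleC_right augmentation_add augmentation_scaleC
        augmentation_mon scaleC_add_left)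
qed (simp add: augmentation_zero)

lemma const0_idem: "const0 * const0 = const0"
  by (simp add: mon_mult aff_map_plus)

locale trivial_action_module = aff_module T
  for T :: "('r::{finite, comm_ring_1} aff_algebra, 'w::ab_group_add) left_mod" +
  assumes trivial: "s \<in> mcarrier T \<Longrightarrow> act T (mon g) s = s"
begin

lemma act_augmentation: "s \<in> mcarrier T \<Longrightarrow> act T x s = scal T (augmentation x) s"
  by (induction x rule: monoid_algebra_induct)
    (simp_all add: augmentation_zero augmentation_add augmentation_scaleC augmentation_mon trivial
      act_add_left scal_add_left act_scaleC[of s _ "mon _"])

text \<open>Over a trivial module, composing with the constant map \<open>0\<close> does not change the values of a
  homomorphism, but it simplifies their arguments.\<close>

lemma relation_hom_const0:
  assumes "module_hom M T k" "x \<in> mcarrier M"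
  shows "k (act M const0 x) = k x"
  using module_hom_act[OF assms, of const0] trivial[OF module_hom_mem[OF assms]] by simp

lemma ext1_singular_to_trivial:
  assumes "idempotent_presentation S v \<epsilon>" and e: "act S (const0 * \<epsilon>) v = 0"
  shows "ext1_has_dim S T 0"
proof -
  interpret P: idempotent_presentation S v \<epsilon> by (rule assms(1))
  have rel: "const0 * \<epsilon> \<in> mcarrier P.relations"
    using e by (simp add: P.relations_iff mult.assoc P.idem)
  show ?thesis
  proof (rule P.ext1_has_dim_0I[OF left_module_axioms])
    fix k assume k: "module_hom P.relations T k"
    show "\<exists>t\<in>mcarrier T. \<forall>x\<in>mcarrier P.relations. k x = act T x t"
    proof (intro bexI[of _ "k (const0 * \<epsilon>)"] ballI)
      fix x assume x: "x \<in> mcarrier P.relations"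
      then have "const0 * x = const0 * x * \<epsilon>"
        by (simp add: P.relations_iff mult.assoc)
      also have "\<dots> = (augmentation x *\<^sub>C 1) * (const0 * \<epsilon>)"
        by (simp add: const0_mult mult_scaleC_left)
      finally have "k x = scal T (augmentation x) (k (const0 * \<epsilon>))"
        using module_hom_act[OF k rel, of "augmentation x *\<^sub>C 1"] relation_hom_const0[OF k x] by simp
      then show "k x = act T x (k (const0 * \<epsilon>))"
        using act_augmentation[OF module_hom_mem[OF k rel]] by simp
    qed (rule module_hom_mem[OF k rel])
  qed
qed

lemma ext1_trivial_to_trivial:
  assumes "idempotent_presentation S v \<epsilon>" and v: "v \<noteq> 0" "\<And>x. act S x v = scal S (augmentation x) v"
  shows "ext1_has_dim S T 0"
proof -
  interpret P: idempotent_presentation S v \<epsilon> by (rule assms(1))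
  show ?thesis
  proof (rule P.ext1_has_dim_0I[OF left_module_axioms])
    fix k assume k: "module_hom P.relations T k"
    show "\<exists>t\<in>mcarrier T. \<forall>x\<in>mcarrier P.relations. k x = act T x t"
    proof (intro bexI[of _ 0] ballI)
      fix x assume x: "x \<in> mcarrier P.relations"
      then have "act S x v = 0" by (simp add: P.relations_iff)
      then have "augmentation x = 0"
        using v P.scal_eq_0_iff[OF P.v_mem] by metis
      then have "const0 * x = 0" by (simp add: const0_mult)
      then show "k x = act T x 0"
        using relation_hom_const0[OF k x] module_hom_zero[OF k P.left_module_relations] by simp
    qed (rule zero_mem)
  qed
qed

end


context aff_module
begin

text \<open>The vectors fixed by all translations form a submodule.\<close>

lemma translation_invariants:
  assumes T: "simple_module M" and sing: "\<And>g s. g \<notin> aff_units \<Longrightarrow> s \<in> mcarrier M \<Longrightarrow> act M (mon g) s = 0"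
    and s: "s \<in> mcarrier M" "s \<noteq> 0" "\<And>b. opr 1 b s = s" and x: "x \<in> mcarrier M"
  shows "opr 1 b x = x"
proof -
  let ?N = "{x \<in> mcarrier M. \<forall>b. opr 1 b x = x}"
  have "submodule ?N M"
  proof (rule submodule_monI)
    show "subspace ?N"
      by (auto simp: subspace_def zero_mem add_mem act_mem act_add_right scal_act[of _ "mon (aff_map 1 b)" for b])
    fix a b x assume x: "x \<in> ?N"
    show "opr a b x \<in> ?N"
    proof (cases "a dvd 1")
      case True
      then obtain a' where a': "a * a' = 1" by (auto elim: dvdE)
      have "opr 1 c (opr a b x) = opr a b x" for c
      proof -
        have xM: "x \<in> mcarrier M" and fixed: "opr 1 (a' * c) x = x" using x by auto
        have "a * (a' * c) = c" using a' by (simp flip: mult.assoc)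
        then have "opr a b x = opr (a * 1) (c + b) x"
          using opr_opr[OF xM, of a b 1 "a' * c"] by (simp only: fixed)
        also have "\<dots> = opr 1 c (opr a b x)"
          using opr_opr[OF xM, of 1 c a b] by (simp add: add.commute)
        finally show ?thesis by simp
      qed
      then show ?thesis using x by (simp add: act_mem)
    next
      case False
      then have "opr a b x = 0" using x by (intro sing) (auto simp: aff_map_in_units)
      then show ?thesis by (simp add: zero_mem)
    qed
  qed
  then have "?N = mcarrier M"
    using s by (intro simple_module_submodule[OF T]) auto
  then show ?thesis using x by blast
qed

end

definition shift :: "'r::{finite, comm_ring_1} aff \<Rightarrow> 'r" where
  "shift g = Rep_aff g 0"

lemma shift_aff_map [simp]: "shift (aff_map a b) = b"
  by (simp add: shift_def aff_map.rep_eq)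

definition translation_part :: "'r::{finite, comm_ring_1} aff_algebra \<Rightarrow> 'r aff_algebra" where
  "translation_part x = act (linear_extension UNIV (\<lambda>g _. mon (aff_map 1 (shift g)))) x (0 :: 'r aff_algebra)"

lemma translation_part_simps:
  "translation_part (x + y) = translation_part x + translation_part y"
  "translation_part (c *\<^sub>C x) = c *\<^sub>C translation_part x"
  "translation_part (mon g) = mon (aff_map 1 (shift g))"
  "translation_part 0 = 0"
  by (simp_all add: translation_part_def act_linear_extension)

lemma (in trivial_action_module) const0_presentation:
  assumes T: "simple_module T" and v: "v \<in> mcarrier T" "v \<noteq> 0"
  shows "idempotent_presentation T v const0"
proof
  show "\<exists>a. act T a v = s" if "s \<in> mcarrier T" for s
    using simple_module_cyclic[OF T v that] by blast
qed (simp_all add: v const0_idem trivial)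

locale trivial_extension = extension_setting p n T "\<lambda>_. 1" "\<lambda>_. 1" + S: trivial_action_module S
  for p :: "'r::{finite, comm_ring_1}" and n :: nat
    and T :: "('r aff_algebra, 'w::ab_group_add) left_mod"
    and S :: "('r aff_algebra, 'v::ab_group_add) left_mod" +
  fixes v :: 'v
  assumes T_singular: "\<And>g s. g \<notin> aff_units \<Longrightarrow> s \<in> mcarrier T \<Longrightarrow> act T (mon g) s = 0"
    and S_simple: "simple_module S" and v_mem: "v \<in> mcarrier S" and v_nonzero: "v \<noteq> 0"
begin

sublocale pres: idempotent_presentation S v const0
  by (rule S.const0_presentation[OF S_simple v_mem v_nonzero])

abbreviation K where "K \<equiv> pres.relations"

lemma relation_iff: "x \<in> mcarrier K \<longleftrightarrow> x * const0 = x \<and> augmentation x = 0"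
  using S.act_augmentation[OF v_mem, of x] S.scal_eq_0_iff[OF v_mem] v_nonzero
  by (simp add: pres.relations_iff)

lemma const0_singular: "aff_map 0 b \<notin> (aff_units :: 'r aff set)"
  by (simp add: aff_map_in_units)

lemma T_act_relation:
  assumes x: "x \<in> mcarrier K" and t: "t \<in> mcarrier T"
  shows "act T x t = 0"
proof -
  have "act T x t = act T x (act T const0 t)"
    using x t by (simp add: relation_iff flip: act_mult)
  then show ?thesis using T_singular[OF const0_singular t] by simp
qed

lemma extension_vectors_invariant:
  assumes "t \<in> X"
  shows "opr 1 (p * d) t = t" "u dvd 1 \<Longrightarrow> opr u 0 t = t"
  using extension_vectors_D(1)[OF assms] extension_vectors_D(2)[OF assms, of d] extension_vectors_D(3)[OF assms, of u] by (simp_all add: stabilizer_iff act_one)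

text \<open>A vector fixed by the dilations and by the translations by multiples of \<open>p\<close> makes
  \<open>x \<mapsto> x(0)\<close>, followed by translation of the vector, equivariant on elements of augmentation zero.\<close>

lemma act_translation_part_mon:
  assumes t: "t \<in> X"
  shows "act T (translation_part (mon g * x)) t = (if g \<in> aff_units
    then act T (mon g) (act T (translation_part x) t)
    else scal T (augmentation x) (opr 1 (shift g) t))"
proof (induction x rule: monoid_algebra_induct)
  case zero
  then show ?case
    by (simp add: translation_part_simps augmentation_zero act_zero_left extension_vectors_D(1)[OF t] act_mem)
next
  note tT = extension_vectors_D(1)[OF t]
  case (add h c x)
  obtain a b where g: "g = aff_map a b" by (cases g)
  obtain a' d where h: "h = aff_map a' d" by (cases h)
  have single: "opr 1 (shift (g + h)) t = (if g \<in> aff_units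
      then act T (mon g) (opr 1 (shift h) t) else opr 1 (shift g) t)"
  proof (cases "a dvd 1")
    case True
    have "opr a b (opr 1 d t) = opr 1 (a * d + b) (opr a 0 t)"
      by (simp add: opr_opr tT)
    then show ?thesis
      using True by (simp add: g h aff_map_plus aff_map_in_units extension_vectors_invariant(2)[OF t])
  next
    case False
    then obtain c where c: "a = p * c" using nonunit_dvd by (auto elim: dvdE)
    have "opr 1 (a * d + b) t = opr 1 b (opr 1 (p * (c * d)) t)"
      by (simp add: opr_opr tT c mult.assoc)
    then show ?thesis
      using False by (simp add: g h aff_map_plus aff_map_in_units extension_vectors_invariant(1)[OF t])
  qed
  have "act T (translation_part (mon g * (c *\<^sub>C mon h + x))) t
      = scal T c (opr 1 (shift (g + h)) t) + act T (translation_part (mon g * x)) t"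
    by (simp add: distrib_left mult_scaleC_right mon_mult translation_part_simps act_add_left tT
        act_scaleC[OF tT, of _ "mon _"])
  moreover have "act T (translation_part (c *\<^sub>C mon h + x)) t
      = scal T c (opr 1 (shift h) t) + act T (translation_part x) t"
    by (simp add: translation_part_simps act_add_left tT act_scaleC[OF tT, of _ "mon _"])
  ultimately show ?case
    using add scal_act[of "opr 1 (shift h) t" "mon g" c]
    by (simp add: single act_add_right act_mem tT augmentation_add augmentation_scaleC augmentation_mon
        scal_add_left)
qed

lemma module_hom_translation_part:
  assumes t: "t \<in> X"
  shows "module_hom K T (\<lambda>x. act T (translation_part x) t)"
  unfolding module_hom_def
proof (intro conjI ballI allI)
  note tT = extension_vectors_D(1)[OF t]
  fix a x assume x: "x \<in> mcarrier K"
  have "act T (translation_part (a * x)) t = act T a (act T (translation_part x) t)"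
  proof (induction a rule: monoid_algebra_induct)
    case zero
    then show ?case by (simp add: translation_part_simps act_zero_left tT act_mem)
  next
    case (add g c a)
    have "act T (translation_part (mon g * x)) t = act T (mon g) (act T (translation_part x) t)"
      using x T_singular[of g "act T (translation_part x) t"]
      by (simp add: act_translation_part_mon[OF t] relation_iff act_zero_left act_mem tT)
    then show ?case
      using add
      by (simp add: distrib_right mult_scaleC_left translation_part_simps act_add_left tT act_mem
          act_scaleC[OF tT, of c "translation_part _"]
          act_scaleC[of "act T (translation_part x) t" c "mon g"])
  qed
  then show "act T (translation_part (act K a x)) t = act T a (act T (translation_part x) t)"
    by simp
qed (simp_all add: act_mem extension_vectors_D(1)[OF t] translation_part_simps act_add_left)

definition difference :: "'r \<Rightarrow> 'r aff_algebra" where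
  "difference b = mon (aff_map 0 b) - const0"

lemma difference_relation: "difference b \<in> mcarrier K"
proof -
  have "augmentation (difference b) = 0"
    using augmentation_add[of "difference b" const0] by (simp add: difference_def augmentation_mon)
  then show ?thesis
    by (simp add: relation_iff) (simp add: difference_def left_diff_distrib mon_mult aff_map_plus)
qed

context
  fixes k assumes k: "module_hom K T k"
begin

text \<open>The values of a homomorphism at the differences of constant maps form a cocycle of the additive
  group. As for every finite group, minus the average of its values is a vector whose coboundary it
  is.\<close>

definition primitive :: 'w where
  "primitive = scal T (- inverse (of_nat (card (UNIV :: 'r set)))) (\<Sum>b\<in>UNIV. k (difference b))"

lemma k_mem: "k (difference b) \<in> mcarrier T"
  by (rule module_hom_mem[OF k difference_relation])

lemma k_add: "k (difference (b + d)) = k (difference b) + opr 1 b (k (difference d))"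
proof -
  interpret K: left_module K by (rule pres.left_module_relations)
  have "difference (b + d) = difference b + act K (mon (aff_map 1 b)) (difference d)"
    by (simp add: difference_def right_diff_distrib mon_mult aff_map_plus add.commute)
  also have "k \<dots> = k (difference b) + opr 1 b (k (difference d))"
    using module_hom_add[OF k difference_relation K.act_mem[OF difference_relation]]
      module_hom_act[OF k difference_relation] by simp
  finally show ?thesis .
qed

lemma k_dilation: "k (difference (u * d)) = opr u 0 (k (difference d))"
proof -
  have "difference (u * d) = act K (mon (aff_map u 0)) (difference d)"
    by (simp add: difference_def right_diff_distrib mon_mult aff_map_plus)
  then show ?thesis by (simp only: module_hom_act[OF k difference_relation])
qed

lemma sum_k_mem: "(\<Sum>b\<in>UNIV. k (difference b)) \<in> mcarrier T"
  by (rule sum_mem) (rule k_mem)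

lemma primitive_mem: "primitive \<in> mcarrier T"
  by (simp add: primitive_def act_mem sum_k_mem)

lemma translation_primitive: "opr 1 b primitive = primitive + k (difference b)"
proof -
  let ?R = "of_nat (card (UNIV :: 'r set)) :: complex" and ?s = "\<Sum>d\<in>UNIV. k (difference d)"
  have "opr 1 b ?s = (\<Sum>d\<in>UNIV. k (difference (b + d)) - k (difference b))"
    by (simp add: act_sum_right k_mem k_add)
  also have "\<dots> = (\<Sum>d\<in>UNIV. k (difference (b + d))) - (\<Sum>d\<in>(UNIV :: 'r set). k (difference b))"
    by (rule sum_subtractf)
  also have "(\<Sum>d\<in>UNIV. k (difference (b + d))) = ?s"
    by (rule sum.reindex_bij_witness[of _ "\<lambda>d. d - b" "\<lambda>d. b + d"]) simp_all
  also have "(\<Sum>d\<in>(UNIV :: 'r set). k (difference b)) = scal T ?R (k (difference b))"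
  proof -
    have "(\<Sum>d\<in>(UNIV :: 'r set). k (difference b)) = (\<Sum>d\<in>(UNIV :: 'r set). scal T 1 (k (difference b)))"
      by (simp only: scal_one[OF k_mem])
    also have "\<dots> = scal T (\<Sum>d\<in>(UNIV :: 'r set). 1) (k (difference b))"
      by (simp only: act_sum_left[OF k_mem, symmetric] complex_module.scale_sum_left[symmetric])
    finally show ?thesis by simp
  qed
  finally have s: "opr 1 b ?s = ?s - scal T ?R (k (difference b))" .
  have "opr 1 b primitive = scal T (- inverse ?R) (opr 1 b ?s)"
    unfolding primitive_def by (rule scal_act[OF sum_k_mem])
  also have "\<dots> = primitive - scal T (- inverse ?R) (scal T ?R (k (difference b)))"
    unfolding s primitive_def by (rule act_diff_right[OF sum_k_mem]) (simp add: act_mem k_mem)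
  also have "scal T (- inverse ?R) (scal T ?R (k (difference b))) = - k (difference b)"
  proof -
    have "- inverse ?R * ?R = - 1" by simp
    then show ?thesis
      by (simp only: scal_scal[OF k_mem] scal_minus_left[OF k_mem] scal_one[OF k_mem])
  qed
  finally show ?thesis by simp
qed

lemma dilation_primitive:
  assumes "u dvd 1"
  shows "opr u 0 primitive = primitive"
proof -
  obtain u' where u: "u * u' = 1" using assms by (auto elim: dvdE)
  have uu: "u' * (u * x) = x" "u * (u' * x) = x" for x
    using u by (simp_all add: mult.commute flip: mult.assoc)
  have "opr u 0 (\<Sum>b\<in>UNIV. k (difference b)) = (\<Sum>b\<in>UNIV. k (difference (u * b)))"
    by (simp add: act_sum_right k_mem k_dilation)
  also have "\<dots> = (\<Sum>b\<in>UNIV. k (difference b))"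
    by (rule sum.reindex_bij_witness[of _ "\<lambda>b. u' * b" "\<lambda>b. u * b"]) (simp_all add: uu)
  finally show ?thesis
    unfolding primitive_def by (simp only: scal_act[OF sum_k_mem, of "mon (aff_map u 0)"])
qed

lemma primitive_extension_vector: "primitive \<in> X"
proof -
  have "k (difference (p * d)) = 0" for d
    using T_singular[of "aff_map p 0" "k (difference d)"]
    by (simp add: k_dilation k_mem aff_map_in_units p_nonunit)
  then show ?thesis
    unfolding extension_vectors_def
    using one_plus_unit
    by (simp add: primitive_mem translation_primitive dilation_primitive stabilizer_iff act_one)
qed

lemma hom_eq_translation_part:
  assumes x: "x \<in> mcarrier K"
  shows "k x = act T (translation_part x) primitive"
proof -
  interpret K: algebra_module K
    using pres.left_module_relations by (simp add: algebra_module_def)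
  note pT = primitive_mem
  \<comment> \<open>On relations the subtracted terms vanish; with them both sides are defined and linear for all \<open>x\<close>.\<close>
  have "x * const0 - augmentation x *\<^sub>C const0 \<in> mcarrier K
    \<and> k (x * const0 - augmentation x *\<^sub>C const0)
      = act T (translation_part x) primitive - scal T (augmentation x) primitive" for x
  proof (induction x rule: monoid_algebra_induct)
    case zero
    then show ?case
      using module_hom_zero[OF k K.left_module_axioms] K.zero_mem
      by (simp add: augmentation_zero translation_part_simps act_zero_left pT)
  next
    case (add g c x)
    let ?y = "x * const0 - augmentation x *\<^sub>C const0"
    obtain a b where g: "g = aff_map a b" by (cases g)
    have eq: "(c *\<^sub>C mon g + x) * const0 - augmentation (c *\<^sub>C mon g + x) *\<^sub>C const0
        = c *\<^sub>C 1 * difference b + ?y"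
      by (simp add: g distrib_right mult_scaleC_left mon_mult aff_map_plus difference_def
          augmentation_add augmentation_scaleC augmentation_mon scaleC_add_left
          complex_module.scale_right_diff_distrib)
    have cd: "c *\<^sub>C 1 * difference b \<in> mcarrier K"
      using K.act_mem[OF difference_relation, of "c *\<^sub>C 1" b] by simp
    have "k (c *\<^sub>C 1 * difference b) = scal T c (opr 1 b primitive - primitive)"
      using module_hom_act[OF k difference_relation, of "c *\<^sub>C 1" b] translation_primitive[of b]
      by simp
    moreover have "act T (translation_part (c *\<^sub>C mon g + x)) primitive
        = scal T c (opr 1 b primitive) + act T (translation_part x) primitive"
      by (simp add: translation_part_simps act_add_left pT g act_scaleC[OF pT, of c "mon _"])
    ultimately show ?case
      unfolding eq using add cd
      by (simp add: K.add_mem module_hom_add[OF k cd] act_diff_right act_mem pT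
          augmentation_add augmentation_scaleC augmentation_mon scal_add_left)
  qed
  from this[of x] show ?thesis
    using x by (simp add: relation_iff act_zero_left pT)
qed

end

lemma ext1_has_dim_0_trivial:
  assumes "X = {0} \<or> (\<forall>b. \<forall>s\<in>mcarrier T. opr 1 b s = s)"
  shows "ext1_has_dim S T 0"
proof (rule pres.ext1_has_dim_0I[OF left_module_axioms])
  fix k assume k: "module_hom K T k"
  have "act T (translation_part x) (primitive k) = 0" if x: "x \<in> mcarrier K" for x
    using assms
  proof
    assume "X = {0}"
    then show ?thesis using primitive_extension_vector[OF k] by simp
  next
    assume fixed: "\<forall>b. \<forall>s\<in>mcarrier T. opr 1 b s = s"
    have "act T (translation_part x) s = scal T (augmentation x) s" if s: "s \<in> mcarrier T" for s x
      using s fixed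
      by (induction x rule: monoid_algebra_induct)
        (simp_all add: translation_part_simps augmentation_zero augmentation_add augmentation_scaleC
          augmentation_mon act_add_left scal_add_left act_scaleC[of s _ "mon _"])
    then show ?thesis
      using x primitive_mem[OF k] by (simp add: relation_iff act_zero_left)
  qed
  then show "\<exists>t\<in>mcarrier T. \<forall>x\<in>mcarrier K. k x = act T x t"
    using hom_eq_translation_part[OF k] by (intro bexI[of _ 0]) (simp_all add: zero_mem)
qed

lemma ext1_has_dim_1_trivial:
  assumes T: "simple_module T" and t: "t \<in> X" "t \<noteq> 0"
    and moved: "\<not> (\<forall>b. \<forall>s\<in>mcarrier T. opr 1 b s = s)"
  shows "ext1_has_dim S T 1"
proof (rule pres.ext1_has_dim_1_presentationI[OF left_module_axioms module_hom_translation_part[OF t(1)]])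
  note tT = extension_vectors_D(1)[OF t(1)]
  show "\<not> (\<exists>s\<in>mcarrier T. \<forall>x\<in>mcarrier K. act T (translation_part x) t = act T x s)"
  proof
    assume "\<exists>s\<in>mcarrier T. \<forall>x\<in>mcarrier K. act T (translation_part x) t = act T x s"
    then have zero: "act T (translation_part x) t = 0" if "x \<in> mcarrier K" for x
      using that T_act_relation by metis
    have "opr 1 b t = t" for b
    proof -
      have "translation_part (difference b) + translation_part const0 = translation_part (mon (aff_map 0 b))"
        by (simp add: difference_def flip: translation_part_simps(1))
      then have "act T (translation_part (difference b)) t + opr 1 0 t = opr 1 b t"
        using tT act_add_left[OF tT, of "translation_part (difference b)" "mon (aff_map 1 0)"]
        by (simp add: translation_part_simps)
      then show ?thesis using zero[OF difference_relation] tT by simp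
    qed
    then show False
      using translation_invariants[OF T T_singular tT t(2)] moved by blast
  qed
  fix k assume k: "module_hom K T k"
  obtain c where c: "primitive k = scal T c t"
    using extension_vectors_one_dimensional[OF T T_singular t primitive_extension_vector[OF k]] by blast
  show "\<exists>c. \<exists>s\<in>mcarrier T. \<forall>x\<in>mcarrier K. k x - scal T c (act T (translation_part x) t) = act T x s"
  proof (intro exI[of _ c] bexI[of _ 0] ballI)
    fix x assume "x \<in> mcarrier K"
    then show "k x - scal T c (act T (translation_part x) t) = act T x 0"
      by (simp add: hom_eq_translation_part[OF k] c scal_act[OF tT])
  qed (rule zero_mem)
qed

end


section \<open>Dimensions of the extension spaces\<close>

context chain_ring
begin

definition arrow_condition ::
    "('r aff_algebra, 's::ab_group_add) left_mod \<Rightarrow> ('r aff_algebra, 't::ab_group_add) left_mod \<Rightarrow> bool" where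
  "arrow_condition S T \<longleftrightarrow>
     (\<exists>\<chi>. first_kind p \<chi> \<and> S \<cong>\<^sub>m (trivial_module :: ('r aff_algebra, complex) left_mod)
        \<and> T \<cong>\<^sub>m W_module \<chi> (\<lambda>_. 1))
     \<or> (\<exists>\<chi> \<rho> \<chi>' \<rho>'. second_kind p n \<chi> \<rho> \<chi>' \<rho>' \<and> S \<cong>\<^sub>m W_module \<chi> \<rho> \<and> T \<cong>\<^sub>m W_module \<chi>' \<rho>')"

lemma unit_character_one: "unit_character H (\<lambda>_. 1)"
  by (simp add: unit_character_def)

lemma not_isomorphic_trivial:
  assumes "weight_module S \<chi> \<rho> v"
  shows "\<not> S \<cong>\<^sub>m (trivial_module :: ('r aff_algebra, complex) left_mod)"
  using weight_module.not_trivial[OF assms] weight_module.simple[OF assms]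
  by (simp add: isomorphic_trivial_module_iff)

lemma not_isomorphic_W_module:
  fixes \<chi> \<rho> :: "'r \<Rightarrow> complex"
  assumes S: "simple_module S" and triv: "\<forall>g. \<forall>s\<in>mcarrier S. act S (mon g) s = s"
    and "additive_character \<chi>" "unit_character (stabilizer \<chi>) \<rho>"
  shows "\<not> S \<cong>\<^sub>m W_module \<chi> \<rho>"
proof
  assume iso: "S \<cong>\<^sub>m W_module \<chi> \<rho>"
  obtain v where "weight_module S \<chi> \<rho> v"
    using weight_module_of_isomorphic[OF S iso assms(3,4)] by blast
  then show False using weight_module.not_trivial triv by blast
qed

text \<open>If some presentations of the two modules as induced modules satisfy the condition for an arrow,
  then the computation is done with this presentation of the first module. If not, it is done with an
  arbitrary one: a nonzero extension vector would provide a presentation of the second module for which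
  the condition holds.\<close>

lemma ext1_dim_weight_weight:
  assumes S: "weight_module S \<chi>0 \<rho>0 v0" and T: "weight_module T \<chi>1 \<rho>1 v1"
  shows "ext1_has_dim S T (if arrow_condition S T then 1 else 0)"
proof -
  interpret T: weight_module T \<chi>1 \<rho>1 v1 by (rule T)
  have simp_S: "simple_module S" by (rule weight_module.simple[OF S])
  have we: "weight_extension p n T \<chi> \<rho> S v" if "weight_module S \<chi> \<rho> v" for \<chi> \<rho> v
  proof -
    interpret S: weight_module S \<chi> \<rho> v by (rule that)
    show ?thesis
      by unfold_locales (auto simp: S.additive_chi S.unit_rho T.singular)
  qed
  show ?thesis
  proof (cases "arrow_condition S T")
    case True
    then obtain \<chi> \<rho> \<chi>' \<rho>' where kind: "second_kind p n \<chi> \<rho> \<chi>' \<rho>'"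
      and iso: "S \<cong>\<^sub>m W_module \<chi> \<rho>" "T \<cong>\<^sub>m W_module \<chi>' \<rho>'"
      using not_isomorphic_trivial[OF S] unfolding arrow_condition_def by blast
    have chars: "additive_character \<chi>" "unit_character (stabilizer \<chi>) \<rho>"
      "additive_character \<chi>'" "unit_character (stabilizer \<chi>') \<rho>'"
      using kind by (auto simp: second_kind_def)
    obtain v where v: "weight_module S \<chi> \<rho> v"
      using weight_module_of_isomorphic[OF simp_S iso(1) chars(1,2)] by blast
    obtain w where w: "weight_module T \<chi>' \<rho>' w"
      using weight_module_of_isomorphic[OF T.simple iso(2) chars(3,4)] by blast
    interpret E: weight_extension p n T \<chi> \<rho> S v by (rule we[OF v])
    obtain t where "t \<in> E.X" "t \<noteq> 0" using E.extension_vector_exists[OF w kind] by blast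
    then have "ext1_has_dim S T 1" by (rule E.ext1_has_dim_1_weight[OF T.simple])
    then show ?thesis using True by simp
  next
    case False
    interpret E: weight_extension p n T \<chi>0 \<rho>0 S v0 by (rule we[OF S])
    have "E.X = {0}"
    proof (rule ccontr)
      assume "E.X \<noteq> {0}"
      moreover have "0 \<in> E.X" by (simp add: extension_vectors_def T.zero_mem)
      ultimately obtain t where t: "t \<in> E.X" "t \<noteq> 0" by blast
      obtain \<psi> where \<psi>: "additive_character \<psi>" "act T (weight_sum \<psi>) t \<noteq> 0"
        using T.weight_component_nonzero[OF E.extension_vectors_D(1)[OF t(1)] t(2)] by blast
      note gen = E.weight_component_generates[OF T.simple T.singular t(1) \<psi>]
      have "arrow_condition S T"
        unfolding arrow_condition_def
        using gen(2) weight_module.isomorphic_W_module[OF S] weight_module.isomorphic_W_module[OF gen(1)]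
        by blast
      then show False using False by simp
    qed
    then have "ext1_has_dim S T 0" by (rule E.ext1_has_dim_0_weight)
    then show ?thesis using False by simp
  qed
qed

text \<open>The trivial module behaves like an induced module with trivial characters, and the condition on
  \<open>\<chi>'\<close> becomes \<open>\<chi>'(p a) = 1\<close>. But the extensions for \<open>\<chi>' = 1\<close> split, as all their extension vectors are
  fixed by the translations.\<close>

lemma ext1_dim_trivial_weight:
  assumes S: "simple_module S" and triv: "\<forall>g. \<forall>s\<in>mcarrier S. act S (mon g) s = s"
    and T: "weight_module T \<chi>1 \<rho>1 v1"
  shows "ext1_has_dim S T (if arrow_condition S T then 1 else 0)"
proof -
  interpret T: weight_module T \<chi>1 \<rho>1 v1 by (rule T)
  obtain v where v: "v \<in> mcarrier S" "v \<noteq> 0" using simple_module_obtain[OF S] by blast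
  have "left_module S" by (rule simple_module_left_module[OF S])
  then interpret S: left_module S .
  interpret E: trivial_extension p n T S v
    by unfold_locales (auto simp: triv S v T.singular unit_character_one additive_character_def)
  have not_second: "\<not> second_kind p n \<chi> \<rho> \<chi>' \<rho>'" if "S \<cong>\<^sub>m W_module \<chi> \<rho>" for \<chi> \<rho> \<chi>' \<rho>'
    using not_isomorphic_W_module[OF S triv] that by (auto simp: second_kind_def)
  show ?thesis
  proof (cases "arrow_condition S T")
    case True
    then obtain \<chi> where \<chi>: "first_kind p \<chi>" and iso: "T \<cong>\<^sub>m W_module \<chi> (\<lambda>_. 1)"
      using not_second unfolding arrow_condition_def by blast
    have ker: "\<chi> (k * p) = 1" for k
      using \<chi> by (auto simp: first_kind_def generated_ideal_singleton)
    obtain b where b: "\<chi> b \<noteq> 1" using \<chi> by (auto simp: first_kind_def)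
    have add: "additive_character \<chi>" using \<chi> by (simp add: first_kind_def)
    obtain w where w: "weight_module T \<chi> (\<lambda>_. 1) w"
      using weight_module_of_isomorphic[OF T.simple iso add unit_character_one] by blast
    have kind: "second_kind p n (\<lambda>_. 1) (\<lambda>_. 1) \<chi> (\<lambda>_. 1)"
      using ker add by (auto simp: second_kind_def unit_character_one additive_character_def mult.commute)
    obtain t where t: "t \<in> E.X" "t \<noteq> 0" using E.extension_vector_exists[OF w kind] by blast
    have "\<not> (\<forall>b. \<forall>s\<in>mcarrier T. act T (mon (aff_map 1 b)) s = s)"
    proof
      assume *: "\<forall>b. \<forall>s\<in>mcarrier T. act T (mon (aff_map 1 b)) s = s"
      have wT: "w \<in> mcarrier T" by (rule weight_module.v_mem[OF w])
      have "scal T (\<chi> b) w = scal T 1 w"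
        using * wT weight_module.v_weight[OF w] by (simp add: T.has_weight_def T.act_one)
      then show False
        using b T.scal_cancel[OF wT weight_module.v_nonzero[OF w]] by blast
    qed
    then have "ext1_has_dim S T 1" by (rule E.ext1_has_dim_1_trivial[OF T.simple t])
    then show ?thesis using True by simp
  next
    case False
    have "E.X = {0} \<or> (\<forall>b. \<forall>s\<in>mcarrier T. act T (mon (aff_map 1 b)) s = s)"
    proof (rule ccontr)
      assume *: "\<not> ?thesis"
      moreover have "0 \<in> E.X" by (simp add: extension_vectors_def T.zero_mem)
      ultimately obtain t where t: "t \<in> E.X" "t \<noteq> 0" by blast
      obtain \<psi> where \<psi>: "additive_character \<psi>" "act T (weight_sum \<psi>) t \<noteq> 0"
        using T.weight_component_nonzero[OF E.extension_vectors_D(1)[OF t(1)] t(2)] by blast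
      note gen = E.weight_component_generates[OF T.simple T.singular t(1) \<psi>]
      have "\<exists>b. \<psi> b \<noteq> 1"
      proof (rule ccontr)
        assume "\<nexists>b. \<psi> b \<noteq> 1"
        then have "act T (mon (aff_map 1 b)) (act T (weight_sum \<psi>) t) = act T (weight_sum \<psi>) t" for b
          using T.has_weight_act_weight_sum[OF \<psi>(1) E.extension_vectors_D(1)[OF t(1)]] E.extension_vectors_D(1)[OF t(1)]
          by (simp add: T.has_weight_def T.act_one T.act_mem)
        then show False
          using T.translation_invariants[OF T.simple T.singular _ \<psi>(2)] * E.extension_vectors_D(1)[OF t(1)]
          by (metis T.act_mem)
      qed
      then have "first_kind p \<psi>"
        using \<psi>(1) gen(2) by (auto simp: first_kind_def second_kind_def generated_ideal_singleton mult.commute)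
      moreover have "S \<cong>\<^sub>m (trivial_module :: ('r aff_algebra, complex) left_mod)"
        using triv by (simp add: isomorphic_trivial_module_iff[OF S])
      ultimately have "arrow_condition S T"
        unfolding arrow_condition_def using weight_module.isomorphic_W_module[OF gen(1)] by blast
      then show False using False by simp
    qed
    then have "ext1_has_dim S T 0" by (rule E.ext1_has_dim_0_trivial)
    then show ?thesis using False by simp
  qed
qed

lemma ext1_dim_into_trivial:
  assumes S: "simple_module S" and T: "simple_module T" "\<forall>g. \<forall>s\<in>mcarrier T. act T (mon g) s = s"
  shows "ext1_has_dim S T (if arrow_condition S T then 1 else 0)"
proof -
  have no: "\<not> T \<cong>\<^sub>m W_module \<chi> \<rho>" if "additive_character \<chi>" "unit_character (stabilizer \<chi>) \<rho>" for \<chi> \<rho>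
    by (rule not_isomorphic_W_module[OF T that])
  have "\<not> arrow_condition S T"
    unfolding arrow_condition_def first_kind_def second_kind_def
    using no unit_character_one by blast
  moreover have "left_module T" "left_module S"
    using S T(1) by (simp_all add: simple_module_left_module)
  then interpret T: trivial_action_module T + S: aff_module S
    using T(2) by (auto simp: trivial_action_module_def trivial_action_module_axioms_def
        aff_module_def algebra_module_def)
  have "ext1_has_dim S T 0"
  proof -
    consider "\<forall>g. \<forall>s\<in>mcarrier S. act S (mon g) s = s" | \<chi> \<rho> v where "weight_module S \<chi> \<rho> v"
      using S.simple_module_classification[OF S chain_ring_axioms] by blast
    then show ?thesis
    proof cases
      case 1
      then interpret S': trivial_action_module S by unfold_locales auto
      obtain v where v: "v \<in> mcarrier S" "v \<noteq> 0" using simple_module_obtain[OF S] by blast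
      have "idempotent_presentation S v const0"
        by (rule S'.const0_presentation[OF S v])
      then show ?thesis
        by (rule T.ext1_trivial_to_trivial) (rule v(2), rule S'.act_augmentation[OF v(1)])
    next
      case (2 \<chi> \<rho> v)
      then interpret S': weight_module S \<chi> \<rho> v .
      have "act S (const0 * char_idempotent \<chi> \<rho>) v = 0"
        by (simp add: S.act_mult S'.v_mem S'.pres.eps_v S'.singular aff_map_in_units)
      then show ?thesis
        by (rule T.ext1_singular_to_trivial[OF S'.pres.idempotent_presentation_axioms])
    qed
  qed
  ultimately show ?thesis by simp
qed

lemma ext1_dim:
  assumes S: "simple_module S" and T: "simple_module T"
  shows "ext1_has_dim S T (if arrow_condition S T then 1 else 0)"
proof -
  interpret S: aff_module S
    using simple_module_left_module[OF S] by (simp add: aff_module_def algebra_module_def)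
  interpret T: aff_module T
    using simple_module_left_module[OF T] by (simp add: aff_module_def algebra_module_def)
  show ?thesis
    using S.simple_module_classification[OF S chain_ring_axioms]
      T.simple_module_classification[OF T chain_ring_axioms]
      ext1_dim_into_trivial[OF S T] ext1_dim_trivial_weight[OF S] ext1_dim_weight_weight by metis
qed

end


section \<open>Finite local principal ideal rings\<close>

text \<open>In a finite ring, a proper ideal of the largest size is maximal.\<close>

lemma subset_maximal_ideal:
  fixes I :: "'r::{finite, comm_ring_1} set"
  assumes "ideal I" "I \<noteq> UNIV"
  obtains J where "maximal_ideal J" "I \<subseteq> J"
proof -
  let ?F = "{J. ideal J \<and> J \<noteq> UNIV \<and> I \<subseteq> J}"
  have "finite ?F" "?F \<noteq> {}" using assms by auto
  then have "Max (card ` ?F) \<in> card ` ?F" by (intro Max_in) auto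
  then obtain J where J: "Max (card ` ?F) = card J" "J \<in> ?F" by (rule imageE)
  then have max: "card J' \<le> card J" if "J' \<in> ?F" for J'
    using that \<open>finite ?F\<close> unfolding J(1)[symmetric] by (intro Max_ge) auto
  have "maximal_ideal J"
    unfolding maximal_ideal_def
  proof (intro conjI allI impI)
    fix J' assume J': "ideal J' \<and> J \<subseteq> J'"
    show "J' = J \<or> J' = UNIV"
    proof (cases "J' = UNIV")
      case False
      then have "card J' \<le> card J" using J J' by (intro max) auto
      then show ?thesis using J' card_seteq[of J' J] by simp
    qed simp
  qed (use J in auto)
  then show thesis using that J by blast
qed

lemma ideal_power_principal:
  "ideal_power (generated_ideal {p}) k = generated_ideal {p ^ k :: 'r::comm_ring_1}"
proof (induction k)
  case 0
  then show ?case by (simp add: generated_ideal_singleton)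
next
  case (Suc k)
  have "{x * y | x y. x \<in> generated_ideal {p} \<and> y \<in> generated_ideal {p ^ k}} = generated_ideal {p ^ Suc k}"
  proof (intro set_eqI iffI)
    fix z assume "z \<in> {x * y | x y. x \<in> generated_ideal {p} \<and> y \<in> generated_ideal {p ^ k}}"
    then obtain a b where "z = (a * p) * (b * p ^ k)"
      by (auto simp: generated_ideal_singleton)
    then have "z = (a * b) * p ^ Suc k" by (simp add: ac_simps)
    then show "z \<in> generated_ideal {p ^ Suc k}" unfolding generated_ideal_singleton by blast
  next
    fix z assume "z \<in> generated_ideal {p ^ Suc k}"
    then obtain a where "z = (a * p) * (1 * p ^ k)"
      by (auto simp: generated_ideal_singleton mult.assoc)
    then show "z \<in> {x * y | x y. x \<in> generated_ideal {p} \<and> y \<in> generated_ideal {p ^ k}}"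
      unfolding generated_ideal_singleton by blast
  qed
  then show ?case by (simp add: Suc module.span_span[OF module_mult])
qed

text \<open>A nonunit generates a proper ideal, which lies in the only maximal ideal. If \<open>p a = 0\<close>, then powers of
  \<open>p\<close> can be split off from \<open>a\<close> as long as the cofactor is not a unit; a unit as cofactor of \<open>p\<^sup>k\<close> would
  mean \<open>p\<^sup>k\<^sup>+\<^sup>1 = 0\<close>, so this goes on until \<open>k = n - 1\<close>.\<close>

lemma chain_ring_if_local_principal:
  fixes p :: "'r::{finite, comm_ring_1}"
  assumes maximal: "maximal_ideal \<mm>" and "local": "\<And>I. maximal_ideal I \<Longrightarrow> I = \<mm>"
    and generator: "\<mm> = generated_ideal {p}" and n: "n \<ge> 2" and zero: "ideal_power \<mm> n = {0}"
    and minimal: "\<And>k. k < n \<Longrightarrow> ideal_power \<mm> k \<noteq> {0}"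
  shows "chain_ring p n"
proof -
  have mem: "x \<in> \<mm> \<longleftrightarrow> p dvd x" for x
    by (auto simp: generator generated_ideal_singleton dvd_def mult.commute)
  have power: "p ^ k = 0 \<longleftrightarrow> ideal_power \<mm> k = {0}" for k
    unfolding generator ideal_power_principal unfolding generated_ideal_singleton
  proof
    assume "range (\<lambda>a. a * p ^ k) = {0}"
    moreover have "1 * p ^ k \<in> range (\<lambda>a. a * p ^ k)" by (rule rangeI)
    ultimately show "p ^ k = 0" by simp
  qed auto
  have nonunit: "p dvd x" if "\<not> x dvd 1" for x
  proof -
    have "1 \<notin> generated_ideal {x}"
      using that by (auto simp: generated_ideal_singleton dvd_def mult.commute)
    then obtain J where "maximal_ideal J" "generated_ideal {x} \<subseteq> J"
      using subset_maximal_ideal[of "generated_ideal {x}"] module.subspace_span[OF module_mult] by blast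
    moreover have "x \<in> generated_ideal {x}"
      by (rule module.span_base[OF module_mult]) simp
    ultimately show ?thesis using "local" mem by blast
  qed
  show ?thesis
  proof
    show "\<not> p dvd 1"
    proof
      assume "p dvd 1"
      then have "x \<in> \<mm>" for x by (metis mem dvd_trans one_dvd)
      then show False using maximal by (auto simp: maximal_ideal_def)
    qed
    fix a assume a: "p * a = 0"
    have "k \<le> n - 1 \<Longrightarrow> p ^ k dvd a" for k
    proof (induction k)
      case (Suc k)
      then obtain c where c: "a = p ^ k * c" by (auto elim: dvdE)
      have "\<not> c dvd 1"
      proof
        assume "c dvd 1"
        then obtain c' where "c * c' = 1" by (auto elim: dvdE)
        then have "p ^ Suc k = p * a * c'" by (simp add: c mult.assoc)
        then have "p ^ Suc k = 0" by (simp add: a)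
        moreover have "Suc k < n" using Suc.prems n by linarith
        ultimately show False using minimal power by metis
      qed
      then show ?case using nonunit[of c] by (simp add: c mult.commute mult_dvd_mono)
    qed simp
    then show "p ^ (n - 1) dvd a" by simp
  qed (use n zero power nonunit in auto)
qed

theorem corollary3p5:
  fixes p :: "'r::{finite, comm_ring_1}" and \<mm> :: "'r set" and n :: nat
    and S :: "('r aff_algebra, 's::ab_group_add) left_mod"
    and S' :: "('r aff_algebra, 't::ab_group_add) left_mod"
  assumes principal: "\<And>I :: 'r set. ideal I \<Longrightarrow> \<exists>x. I = generated_ideal {x}"
    and maximal: "maximal_ideal \<mm>"
    and "local": "\<And>I. maximal_ideal I \<Longrightarrow> I = \<mm>"
    and generator: "\<mm> = generated_ideal {p}" and "p \<noteq> 0"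
    and "n \<ge> 2" and "ideal_power \<mm> n = {0}"
    and minimal: "\<And>k. k < n \<Longrightarrow> ideal_power \<mm> k \<noteq> {0}"
  shows
    "(\<forall>\<chi>. first_kind p \<chi> \<longrightarrow> gabriel_arrows trivial_module (W_module \<chi> (\<lambda>_. 1)) 1)
     \<and> (\<forall>\<chi> \<rho> \<chi>' \<rho>'. second_kind p n \<chi> \<rho> \<chi>' \<rho>' \<longrightarrow>
          stabilizer \<chi>' \<subseteq> stabilizer \<chi> \<and> gabriel_arrows (W_module \<chi> \<rho>) (W_module \<chi>' \<rho>') 1)
     \<and> (simple_module S \<and> simple_module S' \<longrightarrow>
          gabriel_arrows S S'
            (if (\<exists>\<chi>. first_kind p \<chi> \<and> S \<cong>\<^sub>m (trivial_module :: ('r aff_algebra, complex) left_mod)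
                   \<and> S' \<cong>\<^sub>m W_module \<chi> (\<lambda>_. 1))
                \<or> (\<exists>\<chi> \<rho> \<chi>' \<rho>'. second_kind p n \<chi> \<rho> \<chi>' \<rho>'
                   \<and> S \<cong>\<^sub>m W_module \<chi> \<rho> \<and> S' \<cong>\<^sub>m W_module \<chi>' \<rho>')
             then 1 else 0))
     \<and> (\<forall>d. gabriel_arrows S S' d \<longrightarrow> d \<le> 1)"
proof (intro conjI allI impI)
  interpret chain_ring p n
    by (rule chain_ring_if_local_principal[OF maximal "local" generator \<open>n \<ge> 2\<close>
          \<open>ideal_power \<mm> n = {0}\<close> minimal])
  have W: "W_module \<chi> \<rho> \<cong>\<^sub>m W_module \<chi> \<rho>" "simple_module (W_module \<chi> \<rho>)"
    if "additive_character \<chi>" "unit_character (stabilizer \<chi>) \<rho>" for \<chi> \<rho> :: "'r \<Rightarrow> complex"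
    using weight_module.isomorphic_W_module[OF weight_module_W_module[OF that]] simple_W_module[OF that]
    by simp_all
  {
    fix \<chi> assume \<chi>: "first_kind p \<chi>"
    then have chars: "additive_character \<chi>" "unit_character (stabilizer \<chi>) (\<lambda>_. 1)"
      by (simp_all add: first_kind_def unit_character_one)
    have "trivial_module \<cong>\<^sub>m (trivial_module :: ('r aff_algebra, complex) left_mod)"
      by (simp add: isomorphic_trivial_module_iff[OF simple_trivial_module])
    then have "arrow_condition trivial_module (W_module \<chi> (\<lambda>_. 1))"
      using \<chi> W(1)[OF chars] unfolding arrow_condition_def by blast
    then show "gabriel_arrows trivial_module (W_module \<chi> (\<lambda>_. 1)) 1"
      using ext1_dim[OF simple_trivial_module W(2)[OF chars]]
      by (simp add: gabriel_arrows_def simple_trivial_module W(2)[OF chars])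
  next
    fix \<chi> \<rho> \<chi>' \<rho>' assume kind: "second_kind p n \<chi> \<rho> \<chi>' \<rho>'"
    then show "stabilizer \<chi>' \<subseteq> stabilizer \<chi>"
      by (auto simp: second_kind_def stabilizer_iff) (metis mult.left_commute)
    have chars: "additive_character \<chi>" "unit_character (stabilizer \<chi>) \<rho>"
      "additive_character \<chi>'" "unit_character (stabilizer \<chi>') \<rho>'"
      using kind by (auto simp: second_kind_def)
    have "arrow_condition (W_module \<chi> \<rho>) (W_module \<chi>' \<rho>')"
      using kind W(1)[OF chars(1,2)] W(1)[OF chars(3,4)] unfolding arrow_condition_def by blast
    then show "gabriel_arrows (W_module \<chi> \<rho>) (W_module \<chi>' \<rho>') 1"
      using ext1_dim[OF W(2)[OF chars(1,2)] W(2)[OF chars(3,4)]]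
      by (simp add: gabriel_arrows_def W(2) chars)
  next
    assume "simple_module S \<and> simple_module S'"
    then show "gabriel_arrows S S'
            (if (\<exists>\<chi>. first_kind p \<chi> \<and> S \<cong>\<^sub>m (trivial_module :: ('r aff_algebra, complex) left_mod)
                   \<and> S' \<cong>\<^sub>m W_module \<chi> (\<lambda>_. 1))
                \<or> (\<exists>\<chi> \<rho> \<chi>' \<rho>'. second_kind p n \<chi> \<rho> \<chi>' \<rho>'
                   \<and> S \<cong>\<^sub>m W_module \<chi> \<rho> \<and> S' \<cong>\<^sub>m W_module \<chi>' \<rho>')
             then 1 else 0)"
      using ext1_dim[of S S'] unfolding arrow_condition_def by (simp only: gabriel_arrows_def)
  next
    fix d assume d: "gabriel_arrows S S' d"
    then have S: "simple_module S" "simple_module S'" and dim: "ext1_has_dim S S' d"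
      by (simp_all add: gabriel_arrows_def)
    show "d \<le> 1"
      by (rule ext1_has_dim_le_1[OF S[THEN simple_module_left_module] ext1_dim[OF S] _ dim]) simp
  }
qed

end
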